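(* Let $G',G$ be groups, $\varphi:G'\to G$ a pseudomorphism whose image $\mathcal{U}=\mathrm{Im}(\varphi)$ is a ring-supporting subset of $G$, $A$ a $G$-graded algebra, $B=A_{\mathcal{U}}$, and $\tilde{B}$ the $G'$-graded algebra which equals $B$ as an ungraded algebra with $\tilde{B}_\sigma=B_{\varphi(\sigma)}$ for $\sigma\in G'$. Let $(\mathcal{S},\mathcal{U})$ be a right modular pair of subsets of $G$ with $(\mathcal{S}:\mathcal{U})\neq\emptyset$, fix $g\in(\mathcal{S}:\mathcal{U})$ (so $\mathcal{S}=g\mathcal{U}$), and let $\Phi:Gr_A\to Gr_{\tilde{B}}$ be the functor $M\mapsto\widetilde{M_{\mathcal{S}}}$, i.e. $\Phi(M)=M_{\mathcal{S}}$ as an ungraded module, with grading $\Phi(M)_\sigma=M_{g\varphi(\sigma)}$ for $\sigma\in G'$. The following assertions hold: (1) $H'=\varphi^{-1}[(\mathcal{U}:\mathcal{U})]$ is a subgroup of $G'$. (2) The functor $\Phi$ induces an equivalence of categories between $\mathcal{G}(\mathcal{S},\mathcal{U})$ and the full subcategory $\mathcal{L}_{\tilde{B}}$ of $Gr_{\tilde{B}}$ consisting of those $V\in Gr_{\tilde{B}}$ such that $V\cong\tilde{X}$ for some $X\in\mathcal{L}(\mathcal{S},\mathcal{U})$. (3) All $V\in\mathcal{L}_{\tilde{B}}$ are graded $\tilde{B}$-modules generated in degrees belonging to $H'$, and $\mathcal{L}_{\tilde{B}}$ contains all the graded $\tilde{B}$-modules presented in degrees belonging to $H'$.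
   Context: Algebras are associative with unit over a commutative ring, modules are right modules; $Gr_A$ etc. denote categories of graded right modules with degree-preserving morphisms. A pseudomorphism of groups $\varphi:G'\to G$ is an injective map with $\varphi(1)=1$ such that $\varphi(\sigma\tau)=\varphi(\sigma)\varphi(\tau)$ whenever $\varphi(\sigma)\varphi(\tau)\in\mathrm{Im}(\varphi)$. $(\mathcal{S}:\mathcal{U})=\{g\in G:g\mathcal{U}=\mathcal{S}\}$. A subset $\mathcal{U}\subseteq G$ is ring-supporting if $1\in\mathcal{U}$ and whenever $u,v,w,uvw\in\mathcal{U}$, $uv\in\mathcal{U}\iff vw\in\mathcal{U}$. A pair $(\mathcal{S},\mathcal{U})$ of nonempty subsets is right modular if $\mathcal{U}$ is ring-supporting and for all $(s,u,v)\in\mathcal{S}\times\mathcal{U}\times\mathcal{U}$ with $suv\in\mathcal{S}$, $su\in\mathcal{S}\iff uv\in\mathcal{U}$. $A_{\mathcal{U}}=\bigoplus_{u\in\mathcal{U}}A_u$ is the $G$-graded algebra with multiplication of nonzero homogeneous elements $a\cdot b=ab$ if $\deg(a)\deg(b)\in\mathcal{U}$, and $0$ otherwise. The functor $(-)_{\mathcal{S}}:Gr_A\to Gr_{A_{\mathcal{U}}}$ sends $M$ to $M_{\mathcal{S}}=\bigoplus_{s\in\mathcal{S}}M_s$ with $x\cdot a=xa$ if $\deg(x)\deg(a)\in\mathcal{S}$ and $x\cdot a=0$ otherwise, for nonzero homogeneous $x\in M_{\mathcal S}$, $a\in A_{\mathcal U}$. For a graded $B$-module $X$ with support in $\mathcal{S}=g\,\mathrm{Im}(\varphi)$,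 $\tilde{X}$ denotes the $G'$-graded $\tilde{B}$-module equal to $X$ as an ungraded module with $\tilde{X}_\sigma=X_{g\varphi(\sigma)}$. A graded module is generated in degrees belonging to $\mathcal{X}$ if it is generated by its homogeneous elements with degree in $\mathcal{X}$; presented in degrees belonging to $\mathcal{X}$ if it is the cokernel of a morphism $P\to Q$ of graded modules with $P,Q$ gr-projective and generated in degrees belonging to $\mathcal{X}$. $\mathcal{G}(\mathcal{S},\mathcal{U})$ is the full subcategory of $Gr_A$ of modules $M$ generated in degrees belonging to $(\mathcal{S}:\mathcal{U})$ such that $N_{\mathcal{S}}\neq0$ for every nonzero graded submodule $N\leq M$. $\mathcal{L}(\mathcal{S},\mathcal{U})$ is the full subcategory of $Gr_{A_{\mathcal{U}}}$ of modules which are isomorphic to $M_{\mathcal{S}}$ for some $M\in Gr_A$ and are generated in degrees belonging to $(\mathcal{S}:\mathcal{U})$. *)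

theory Defs
  imports "HOL-Algebra.AbelCoset" "HOL-Algebra.Module" "HOL-Library.FuncSet" "HOL-Library.Equipollence"
begin

section \<open>Categories, functors, equivalences\<close>

text \<open>
  \<open>Cmp C X Y Z v u\<close> is the composite of \<open>u : X \<rightarrow> Y\<close> followed by \<open>v : Y \<rightarrow> Z\<close>.
\<close>

record ('o, 'h) cat =
  Ob :: "'o set"
  Hom :: "'o \<Rightarrow> 'o \<Rightarrow> 'h set"
  Idm :: "'o \<Rightarrow> 'h"
  Cmp :: "'o \<Rightarrow> 'o \<Rightarrow> 'o \<Rightarrow> 'h \<Rightarrow> 'h \<Rightarrow> 'h"

definition full_subcat :: "('o, 'h) cat \<Rightarrow> ('o \<Rightarrow> bool) \<Rightarrow> ('o, 'h) cat" where
  "full_subcat C P = C\<lparr>Ob := {X \<in> Ob C. P X}\<rparr>"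

definition is_iso :: "('o, 'h) cat \<Rightarrow> 'o \<Rightarrow> 'o \<Rightarrow> 'h \<Rightarrow> bool" where
  "is_iso C X Y u \<longleftrightarrow> u \<in> Hom C X Y \<and>
     (\<exists>v \<in> Hom C Y X. Cmp C X Y X v u = Idm C X \<and> Cmp C Y X Y u v = Idm C Y)"

definition isomorphic :: "('o, 'h) cat \<Rightarrow> 'o \<Rightarrow> 'o \<Rightarrow> bool" where
  "isomorphic C X Y \<longleftrightarrow> (\<exists>u. is_iso C X Y u)"

definition is_functor ::
  "('o1, 'h1) cat \<Rightarrow> ('o2, 'h2) cat \<Rightarrow> ('o1 \<Rightarrow> 'o2) \<Rightarrow> ('o1 \<Rightarrow> 'o1 \<Rightarrow> 'h1 \<Rightarrow> 'h2) \<Rightarrow> bool" where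
  "is_functor C D F Fm \<longleftrightarrow>
     (\<forall>X \<in> Ob C. F X \<in> Ob D) \<and>
     (\<forall>X \<in> Ob C. \<forall>Y \<in> Ob C. \<forall>u \<in> Hom C X Y. Fm X Y u \<in> Hom D (F X) (F Y)) \<and>
     (\<forall>X \<in> Ob C. Fm X X (Idm C X) = Idm D (F X)) \<and>
     (\<forall>X \<in> Ob C. \<forall>Y \<in> Ob C. \<forall>Z \<in> Ob C. \<forall>u \<in> Hom C X Y. \<forall>v \<in> Hom C Y Z.
        Fm X Z (Cmp C X Y Z v u) = Cmp D (F X) (F Y) (F Z) (Fm Y Z v) (Fm X Y u))"

definition is_nat_iso ::
  "('o1, 'h1) cat \<Rightarrow> ('o2, 'h2) cat \<Rightarrow>
   ('o1 \<Rightarrow> 'o2) \<Rightarrow> ('o1 \<Rightarrow> 'o1 \<Rightarrow> 'h1 \<Rightarrow> 'h2) \<Rightarrow>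
   ('o1 \<Rightarrow> 'o2) \<Rightarrow> ('o1 \<Rightarrow> 'o1 \<Rightarrow> 'h1 \<Rightarrow> 'h2) \<Rightarrow> ('o1 \<Rightarrow> 'h2) \<Rightarrow> bool" where
  "is_nat_iso C D F Fm K Km \<eta> \<longleftrightarrow>
     (\<forall>X \<in> Ob C. is_iso D (F X) (K X) (\<eta> X)) \<and>
     (\<forall>X \<in> Ob C. \<forall>Y \<in> Ob C. \<forall>u \<in> Hom C X Y.
        Cmp D (F X) (F Y) (K Y) (\<eta> Y) (Fm X Y u) = Cmp D (F X) (K X) (K Y) (Km X Y u) (\<eta> X))"

definition is_equivalence ::
  "('o1, 'h1) cat \<Rightarrow> ('o2, 'h2) cat \<Rightarrow> ('o1 \<Rightarrow> 'o2) \<Rightarrow> ('o1 \<Rightarrow> 'o1 \<Rightarrow> 'h1 \<Rightarrow> 'h2) \<Rightarrow> bool" where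
  "is_equivalence C D F Fm \<longleftrightarrow> is_functor C D F Fm \<and>
     (\<exists>K Km. is_functor D C K Km \<and>
        (\<exists>\<eta>. is_nat_iso C C (\<lambda>X. X) (\<lambda>X Y u. u)
                (\<lambda>X. K (F X)) (\<lambda>X Y u. Km (F X) (F Y) (Fm X Y u)) \<eta>) \<and>
        (\<exists>\<epsilon>. is_nat_iso D D (\<lambda>Y. F (K Y)) (\<lambda>X Y u. Fm (K X) (K Y) (Km X Y u))
                (\<lambda>Y. Y) (\<lambda>X Y u. u) \<epsilon>))"

section \<open>Subsets of groups and pseudomorphisms\<close>

definition pseudomorphism :: "('h, 'x) monoid_scheme \<Rightarrow> ('g, 'y) monoid_scheme \<Rightarrow> ('h \<Rightarrow> 'g) \<Rightarrow> bool" where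
  "pseudomorphism G' G \<phi> \<longleftrightarrow>
     \<phi> \<in> carrier G' \<rightarrow> carrier G \<and> inj_on \<phi> (carrier G') \<and> \<phi> \<one>\<^bsub>G'\<^esub> = \<one>\<^bsub>G\<^esub> \<and>
     (\<forall>\<sigma> \<in> carrier G'. \<forall>\<tau> \<in> carrier G'. \<phi> \<sigma> \<otimes>\<^bsub>G\<^esub> \<phi> \<tau> \<in> \<phi> ` carrier G' \<longrightarrow>
        \<phi> (\<sigma> \<otimes>\<^bsub>G'\<^esub> \<tau>) = \<phi> \<sigma> \<otimes>\<^bsub>G\<^esub> \<phi> \<tau>)"

definition transporter :: "('g, 'y) monoid_scheme \<Rightarrow> 'g set \<Rightarrow> 'g set \<Rightarrow> 'g set" where
  "transporter G S U = {g \<in> carrier G. g <#\<^bsub>G\<^esub> U = S}"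

definition ring_supporting :: "('g, 'y) monoid_scheme \<Rightarrow> 'g set \<Rightarrow> bool" where
  "ring_supporting G U \<longleftrightarrow> U \<subseteq> carrier G \<and> \<one>\<^bsub>G\<^esub> \<in> U \<and>
     (\<forall>u \<in> U. \<forall>v \<in> U. \<forall>w \<in> U. u \<otimes>\<^bsub>G\<^esub> v \<otimes>\<^bsub>G\<^esub> w \<in> U \<longrightarrow>
        (u \<otimes>\<^bsub>G\<^esub> v \<in> U \<longleftrightarrow> v \<otimes>\<^bsub>G\<^esub> w \<in> U))"

definition right_modular :: "('g, 'y) monoid_scheme \<Rightarrow> 'g set \<Rightarrow> 'g set \<Rightarrow> bool" where
  "right_modular G S U \<longleftrightarrow> S \<subseteq> carrier G \<and> S \<noteq> {} \<and> U \<noteq> {} \<and> ring_supporting G U \<and>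
     (\<forall>s \<in> S. \<forall>u \<in> U. \<forall>v \<in> U. s \<otimes>\<^bsub>G\<^esub> u \<otimes>\<^bsub>G\<^esub> v \<in> S \<longrightarrow>
        (s \<otimes>\<^bsub>G\<^esub> u \<in> S \<longleftrightarrow> u \<otimes>\<^bsub>G\<^esub> v \<in> U))"

section \<open>Internal direct sums and homogeneous parts\<close>

definition decomposition ::
  "('m, 'r) ring_scheme \<Rightarrow> 'i set \<Rightarrow> ('i \<Rightarrow> 'm set) \<Rightarrow> 'm \<Rightarrow> ('i \<Rightarrow> 'm) \<Rightarrow> bool" where
  "decomposition M I C x f \<longleftrightarrow> f \<in> (\<Pi>\<^sub>E i\<in>I. C i) \<and> finite {i \<in> I. f i \<noteq> \<zero>\<^bsub>M\<^esub>} \<and>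
     x = (\<Oplus>\<^bsub>M\<^esub>i\<in>{i \<in> I. f i \<noteq> \<zero>\<^bsub>M\<^esub>}. f i)"

definition direct_sum_of :: "('m, 'r) ring_scheme \<Rightarrow> 'i set \<Rightarrow> ('i \<Rightarrow> 'm set) \<Rightarrow> bool" where
  "direct_sum_of M I C \<longleftrightarrow> (\<forall>i \<in> I. additive_subgroup (C i) M) \<and>
     (\<forall>x \<in> carrier M. \<exists>!f. decomposition M I C x f)"

definition hpart :: "('m, 'r) ring_scheme \<Rightarrow> 'i set \<Rightarrow> ('i \<Rightarrow> 'm set) \<Rightarrow> 'm \<Rightarrow> 'i \<Rightarrow> 'm" where
  "hpart M I C x = (THE f. decomposition M I C x f)"

definition hsupp :: "('m, 'r) ring_scheme \<Rightarrow> 'i set \<Rightarrow> ('i \<Rightarrow> 'm set) \<Rightarrow> 'm \<Rightarrow> 'i set" where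
  "hsupp M I C x = {i \<in> I. hpart M I C x i \<noteq> \<zero>\<^bsub>M\<^esub>}"

section \<open>Graded algebras\<close>

record ('k, 'a, 'g) gr_algebra = "('k, 'a) module" +
  agr :: "'g \<Rightarrow> 'a set"

text \<open>
  The library locale \<open>algebra\<close> requires commutativity of the algebra, so the associative
  unital case is spelled out here.
\<close>

definition graded_algebra ::
  "('k, 'x) ring_scheme \<Rightarrow> ('g, 'y) monoid_scheme \<Rightarrow> ('k, 'a, 'g) gr_algebra \<Rightarrow> bool" where
  "graded_algebra K G A \<longleftrightarrow> group G \<and> cring K \<and> Module.module K A \<and> ring A \<and>
     (\<forall>k \<in> carrier K. \<forall>a \<in> carrier A. \<forall>b \<in> carrier A.
        (k \<odot>\<^bsub>A\<^esub> a) \<otimes>\<^bsub>A\<^esub> b = k \<odot>\<^bsub>A\<^esub> (a \<otimes>\<^bsub>A\<^esub> b) \<and>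
        a \<otimes>\<^bsub>A\<^esub> (k \<odot>\<^bsub>A\<^esub> b) = k \<odot>\<^bsub>A\<^esub> (a \<otimes>\<^bsub>A\<^esub> b)) \<and>
     direct_sum_of A (carrier G) (agr A) \<and>
     (\<forall>g \<in> carrier G. \<forall>k \<in> carrier K. \<forall>a \<in> agr A g. k \<odot>\<^bsub>A\<^esub> a \<in> agr A g) \<and>
     \<one>\<^bsub>A\<^esub> \<in> agr A \<one>\<^bsub>G\<^esub> \<and>
     (\<forall>g \<in> carrier G. \<forall>h \<in> carrier G. \<forall>a \<in> agr A g. \<forall>b \<in> agr A h.
        a \<otimes>\<^bsub>A\<^esub> b \<in> agr A (g \<otimes>\<^bsub>G\<^esub> h))"

text \<open>
  The algebra \<open>A\<^sub>U\<close>: homogeneous elements multiply as in \<open>A\<close> if the product of their degrees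
  lies in \<open>U\<close>, and to zero otherwise; the formula for \<open>mult\<close> is the biadditive extension.
\<close>

definition alg_restrict ::
  "('g, 'y) monoid_scheme \<Rightarrow> 'g set \<Rightarrow> ('k, 'a, 'g) gr_algebra \<Rightarrow> ('k, 'a, 'g) gr_algebra" where
  "alg_restrict G U A = A\<lparr>
     carrier := {a \<in> carrier A. hsupp A (carrier G) (agr A) a \<subseteq> U},
     mult := (\<lambda>a b. finsum A
        (\<lambda>(u, v). hpart A (carrier G) (agr A) a u \<otimes>\<^bsub>A\<^esub> hpart A (carrier G) (agr A) b v)
        {(u, v). u \<in> hsupp A (carrier G) (agr A) a \<and> v \<in> hsupp A (carrier G) (agr A) b \<and>
           u \<otimes>\<^bsub>G\<^esub> v \<in> U}),
     agr := (\<lambda>g. if g \<in> U then agr A g else {\<zero>\<^bsub>A\<^esub>})\<rparr>"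

definition alg_tilde :: "('h \<Rightarrow> 'g) \<Rightarrow> ('k, 'a, 'g) gr_algebra \<Rightarrow> ('k, 'a, 'h) gr_algebra" where
  "alg_tilde \<phi> B = \<lparr>carrier = carrier B, mult = mult B, one = one B, zero = zero B,
     add = add B, smult = smult B, agr = (\<lambda>\<sigma>. agr B (\<phi> \<sigma>))\<rparr>"

section \<open>Graded right modules\<close>

text \<open>
  The abelian group of a module is given by the additive part of a \<open>ring\<close> record, as for
  \<open>module\<close> in the library; the fields \<open>mult\<close> and \<open>one\<close> carry no information.
\<close>

record ('a, 'm, 'g) gr_module = "'m ring" +
  ract :: "'m \<Rightarrow> 'a \<Rightarrow> 'm"  (infixl \<open>\<cdot>\<index>\<close> 70)
  mgr :: "'g \<Rightarrow> 'm set"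

definition right_module :: "('a, 'x) ring_scheme \<Rightarrow> ('a, 'm, 'g) gr_module \<Rightarrow> bool" where
  "right_module A M \<longleftrightarrow> abelian_group M \<and>
     (\<forall>x \<in> carrier M. \<forall>a \<in> carrier A. x \<cdot>\<^bsub>M\<^esub> a \<in> carrier M) \<and>
     (\<forall>x \<in> carrier M. \<forall>y \<in> carrier M. \<forall>a \<in> carrier A.
        (x \<oplus>\<^bsub>M\<^esub> y) \<cdot>\<^bsub>M\<^esub> a = (x \<cdot>\<^bsub>M\<^esub> a) \<oplus>\<^bsub>M\<^esub> (y \<cdot>\<^bsub>M\<^esub> a)) \<and>
     (\<forall>x \<in> carrier M. \<forall>a \<in> carrier A. \<forall>b \<in> carrier A.
        x \<cdot>\<^bsub>M\<^esub> (a \<oplus>\<^bsub>A\<^esub> b) = (x \<cdot>\<^bsub>M\<^esub> a) \<oplus>\<^bsub>M\<^esub> (x \<cdot>\<^bsub>M\<^esub> b) \<and>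
        x \<cdot>\<^bsub>M\<^esub> (a \<otimes>\<^bsub>A\<^esub> b) = (x \<cdot>\<^bsub>M\<^esub> a) \<cdot>\<^bsub>M\<^esub> b) \<and>
     (\<forall>x \<in> carrier M. x \<cdot>\<^bsub>M\<^esub> \<one>\<^bsub>A\<^esub> = x)"

definition graded_module ::
  "('g, 'y) monoid_scheme \<Rightarrow> ('k, 'a, 'g) gr_algebra \<Rightarrow> ('a, 'm, 'g) gr_module \<Rightarrow> bool" where
  "graded_module G A M \<longleftrightarrow> right_module A M \<and> direct_sum_of M (carrier G) (mgr M) \<and>
     (\<forall>g \<in> carrier G. \<forall>h \<in> carrier G. \<forall>x \<in> mgr M g. \<forall>a \<in> agr A h.
        x \<cdot>\<^bsub>M\<^esub> a \<in> mgr M (g \<otimes>\<^bsub>G\<^esub> h))"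

definition gr_hom ::
  "('g, 'y) monoid_scheme \<Rightarrow> ('k, 'a, 'g) gr_algebra \<Rightarrow>
   ('a, 'm, 'g) gr_module \<Rightarrow> ('a, 'm, 'g) gr_module \<Rightarrow> ('m \<Rightarrow> 'm) set" where
  "gr_hom G A M N = {f \<in> carrier M \<rightarrow>\<^sub>E carrier N.
     (\<forall>x \<in> carrier M. \<forall>y \<in> carrier M. f (x \<oplus>\<^bsub>M\<^esub> y) = f x \<oplus>\<^bsub>N\<^esub> f y) \<and>
     (\<forall>x \<in> carrier M. \<forall>a \<in> carrier A. f (x \<cdot>\<^bsub>M\<^esub> a) = f x \<cdot>\<^bsub>N\<^esub> a) \<and>
     (\<forall>g \<in> carrier G. f ` mgr M g \<subseteq> mgr N g)}"

text \<open>
  The type \<open>'m\<close> is the universe of the category: its objects are the graded right \<open>A\<close>-modules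
  whose underlying set is a subset of \<open>'m\<close>.  For results about the category to reflect the
  category of all graded modules, \<open>'m\<close> has to be large enough to contain free modules, i.e.
  infinite and at least as large as the algebra; it can otherwise be chosen arbitrarily.
\<close>

definition Gr ::
  "('g, 'y) monoid_scheme \<Rightarrow> ('k, 'a, 'g) gr_algebra \<Rightarrow> (('a, 'm, 'g) gr_module, 'm \<Rightarrow> 'm) cat" where
  "Gr G A = \<lparr>Ob = {M. graded_module G A M}, Hom = gr_hom G A,
     Idm = (\<lambda>M. \<lambda>x \<in> carrier M. x), Cmp = (\<lambda>M N L v u. compose (carrier M) v u)\<rparr>"

definition submodule_of :: "('k, 'a, 'g) gr_algebra \<Rightarrow> 'm set \<Rightarrow> ('a, 'm, 'g) gr_module \<Rightarrow> bool" where
  "submodule_of A N M \<longleftrightarrow> N \<subseteq> carrier M \<and> right_module A (M\<lparr>carrier := N\<rparr>)"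

definition gr_sub :: "('a, 'm, 'g) gr_module \<Rightarrow> 'm set \<Rightarrow> ('a, 'm, 'g) gr_module" where
  "gr_sub M N = M\<lparr>carrier := N, mgr := (\<lambda>g. mgr M g \<inter> N)\<rparr>"

definition graded_submodule ::
  "('g, 'y) monoid_scheme \<Rightarrow> ('k, 'a, 'g) gr_algebra \<Rightarrow> 'm set \<Rightarrow> ('a, 'm, 'g) gr_module \<Rightarrow> bool" where
  "graded_submodule G A N M \<longleftrightarrow> N \<subseteq> carrier M \<and> graded_module G A (gr_sub M N)"

definition generated_in ::
  "('k, 'a, 'g) gr_algebra \<Rightarrow> 'g set \<Rightarrow> ('a, 'm, 'g) gr_module \<Rightarrow> bool" where
  "generated_in A X M \<longleftrightarrow>
     (\<forall>N. submodule_of A N M \<and> (\<Union>g \<in> X. mgr M g) \<subseteq> N \<longrightarrow> N = carrier M)"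

definition gr_projective ::
  "('g, 'y) monoid_scheme \<Rightarrow> ('k, 'a, 'g) gr_algebra \<Rightarrow> ('a, 'm, 'g) gr_module \<Rightarrow> bool" where
  "gr_projective G A P \<longleftrightarrow> graded_module G A P \<and>
     (\<forall>(M :: ('a, 'm, 'g) gr_module) N. graded_module G A M \<longrightarrow> graded_module G A N \<longrightarrow>
        (\<forall>e \<in> gr_hom G A M N. e ` carrier M = carrier N \<longrightarrow>
          (\<forall>f \<in> gr_hom G A P N. \<exists>f' \<in> gr_hom G A P M. compose (carrier P) e f' = f)))"

definition is_cokernel ::
  "('g, 'y) monoid_scheme \<Rightarrow> ('k, 'a, 'g) gr_algebra \<Rightarrow>
   ('a, 'm, 'g) gr_module \<Rightarrow> ('a, 'm, 'g) gr_module \<Rightarrow> ('m \<Rightarrow> 'm) \<Rightarrow>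
   ('a, 'm, 'g) gr_module \<Rightarrow> ('m \<Rightarrow> 'm) \<Rightarrow> bool" where
  "is_cokernel G A P Q f V p \<longleftrightarrow> graded_module G A V \<and> p \<in> gr_hom G A Q V \<and>
     (\<forall>x \<in> carrier P. p (f x) = \<zero>\<^bsub>V\<^esub>) \<and>
     (\<forall>W. graded_module G A W \<longrightarrow>
        (\<forall>q \<in> gr_hom G A Q W. (\<forall>x \<in> carrier P. q (f x) = \<zero>\<^bsub>W\<^esub>) \<longrightarrow>
          (\<exists>!r. r \<in> gr_hom G A V W \<and> compose (carrier Q) r p = q)))"

definition presented_in ::
  "('g, 'y) monoid_scheme \<Rightarrow> ('k, 'a, 'g) gr_algebra \<Rightarrow> 'g set \<Rightarrow> ('a, 'm, 'g) gr_module \<Rightarrow> bool" where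
  "presented_in G A X V \<longleftrightarrow>
     (\<exists>P Q f p. gr_projective G A P \<and> generated_in A X P \<and>
        gr_projective G A Q \<and> generated_in A X Q \<and>
        f \<in> gr_hom G A P Q \<and> is_cokernel G A P Q f V p)"

section \<open>The functor and the categories of the theorem\<close>

text \<open>
  \<open>mod_restrict\<close> is the object part of \<open>(-)\<^sub>S\<close>; the action is the biadditive extension of
  the rule for homogeneous elements.
\<close>

definition mod_restrict ::
  "('g, 'y) monoid_scheme \<Rightarrow> 'g set \<Rightarrow> ('k, 'a, 'g) gr_algebra \<Rightarrow>
   ('a, 'm, 'g) gr_module \<Rightarrow> ('a, 'm, 'g) gr_module" where
  "mod_restrict G S A M = M\<lparr>
     carrier := {x \<in> carrier M. hsupp M (carrier G) (mgr M) x \<subseteq> S},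
     ract := (\<lambda>x a. finsum M
        (\<lambda>(s, u). hpart M (carrier G) (mgr M) x s \<cdot>\<^bsub>M\<^esub> hpart A (carrier G) (agr A) a u)
        {(s, u). s \<in> hsupp M (carrier G) (mgr M) x \<and> u \<in> hsupp A (carrier G) (agr A) a \<and>
           s \<otimes>\<^bsub>G\<^esub> u \<in> S}),
     mgr := (\<lambda>g. if g \<in> S then mgr M g else {\<zero>\<^bsub>M\<^esub>})\<rparr>"

definition mod_tilde ::
  "('g, 'y) monoid_scheme \<Rightarrow> 'g \<Rightarrow> ('h \<Rightarrow> 'g) \<Rightarrow> ('a, 'm, 'g) gr_module \<Rightarrow> ('a, 'm, 'h) gr_module" where
  "mod_tilde G g \<phi> X = \<lparr>carrier = carrier X, mult = mult X, one = one X, zero = zero X,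
     add = add X, ract = ract X, mgr = (\<lambda>\<sigma>. mgr X (g \<otimes>\<^bsub>G\<^esub> \<phi> \<sigma>))\<rparr>"

definition Phi_ob ::
  "('g, 'y) monoid_scheme \<Rightarrow> ('k, 'a, 'g) gr_algebra \<Rightarrow> ('h \<Rightarrow> 'g) \<Rightarrow> 'g \<Rightarrow> 'g set \<Rightarrow>
   ('a, 'm, 'g) gr_module \<Rightarrow> ('a, 'm, 'h) gr_module" where
  "Phi_ob G A \<phi> g S M = mod_tilde G g \<phi> (mod_restrict G S A M)"

definition Phi_mor ::
  "('g, 'y) monoid_scheme \<Rightarrow> ('k, 'a, 'g) gr_algebra \<Rightarrow> 'g set \<Rightarrow>
   ('a, 'm, 'g) gr_module \<Rightarrow> ('a, 'm, 'g) gr_module \<Rightarrow> ('m \<Rightarrow> 'm) \<Rightarrow> ('m \<Rightarrow> 'm)" where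
  "Phi_mor G A S M N f = restrict f (carrier (mod_restrict G S A M))"

definition cat_G ::
  "('g, 'y) monoid_scheme \<Rightarrow> ('k, 'a, 'g) gr_algebra \<Rightarrow> 'g set \<Rightarrow> 'g set \<Rightarrow>
   (('a, 'm, 'g) gr_module, 'm \<Rightarrow> 'm) cat" where
  "cat_G G A S U = full_subcat (Gr G A)
     (\<lambda>M. generated_in A (transporter G S U) M \<and>
       (\<forall>N. graded_submodule G A N M \<and> N \<noteq> {\<zero>\<^bsub>M\<^esub>} \<longrightarrow>
          carrier (mod_restrict G S A (gr_sub M N)) \<noteq> {\<zero>\<^bsub>M\<^esub>}))"

definition cat_L ::
  "('g, 'y) monoid_scheme \<Rightarrow> ('k, 'a, 'g) gr_algebra \<Rightarrow> 'g set \<Rightarrow> 'g set \<Rightarrow>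
   (('a, 'm, 'g) gr_module, 'm \<Rightarrow> 'm) cat" where
  "cat_L G A S U = full_subcat (Gr G (alg_restrict G U A))
     (\<lambda>X. (\<exists>M :: ('a, 'm, 'g) gr_module. M \<in> Ob (Gr G A) \<and>
             isomorphic (Gr G (alg_restrict G U A)) X (mod_restrict G S A M)) \<and>
       generated_in (alg_restrict G U A) (transporter G S U) X)"

definition cat_L_tilde ::
  "('h, 'z) monoid_scheme \<Rightarrow> ('g, 'y) monoid_scheme \<Rightarrow> ('k, 'a, 'g) gr_algebra \<Rightarrow>
   ('h \<Rightarrow> 'g) \<Rightarrow> 'g \<Rightarrow> 'g set \<Rightarrow> 'g set \<Rightarrow> (('a, 'm, 'h) gr_module, 'm \<Rightarrow> 'm) cat" where
  "cat_L_tilde G' G A \<phi> g S U =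
     (let Bt = alg_tilde \<phi> (alg_restrict G U A) in
      full_subcat (Gr G' Bt)
        (\<lambda>V. \<exists>X :: ('a, 'm, 'g) gr_module.
           X \<in> Ob (cat_L G A S U) \<and> isomorphic (Gr G' Bt) V (mod_tilde G g \<phi> X)))"

end

theory Submission
  imports Defs
begin

text \<open>
  Write \<open>T = (S : U)\<close> and \<open>H' = \<phi>\<^sup>-\<^sup>1(U : U)\<close>; then \<open>T = g \<phi>(H')\<close>, and for \<open>t \<in> T\<close> one has
  \<open>tk \<in> S\<close> iff \<open>k \<in> U\<close>. So on elements of degree in \<open>T\<close> the actions of \<open>A\<close> and of \<open>B\<close> agree as
  far as \<open>\<Phi>\<close> can see, and \<open>\<Phi>(M)\<close> is generated in degrees \<open>H'\<close> as soon as \<open>M\<close> is generated in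
  degrees \<open>T\<close>.

  \<open>\<Phi>\<close> is faithful because \<open>T \<subseteq> S\<close>, and full because the submodule of \<open>M \<times> N\<close> generated by the
  graph of a morphism in the degrees \<open>T\<close> is a graph: its failure to be one is a graded submodule
  of \<open>N\<close> with zero restriction to \<open>S\<close>. If \<open>M\<^sub>S\<close> is generated in degrees \<open>T\<close>, the submodule of \<open>M\<close>
  generated in degrees \<open>T\<close>, modulo its largest graded submodule without components in \<open>S\<close>, has
  the same image under \<open>\<Phi>\<close> and satisfies the conditions defining \<open>\<G>(S, U)\<close>.

  For \<open>V\<close> presented in degrees \<open>H'\<close>, the quotient \<open>M\<close> of a free \<open>A\<close>-module by the relations holding
  in \<open>V\<close> in degrees \<open>H'\<close> comes with a surjection \<open>\<Phi>(M) \<rightarrow> V\<close> that is bijective in these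
  degrees, and the presentation provides its inverse.
\<close>

section \<open>Gradings of abelian groups\<close>

text \<open>All modules live over a fixed universe type, so a construction that leaves it has to
  come back. The product used for fullness never does: only the function read off from a submodule
  of it survives. Quotients and free modules do come back, the latter because the universe is
  infinite and at least as large as \<open>A\<close>, so that finitely supported functions can be
  coded in it. Components are given by a definite description and the action on \<open>M_S\<close>
  by a double sum. Both are replaced early by usable forms: gradings are produced from systems of
  projections, which compute \<open>hpart\<close> at the same time, and the truncated action is
  described by its components. The set \<open>S\<close> is not stable under multiplication by
  \<open>U\<close>: a product \<open>su\<close> may leave \<open>S\<close> and \<open>suv\<close>
  may return to it. Right modularity is what makes the truncated action associative in spite of
  this, and degrees in the transporter are those from which leaving \<open>S\<close> depends on the
  coefficient alone.\<close>

lemma (in abelian_group) sub_abelian_group: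
  assumes "carrier N \<subseteq> carrier G" "add N = add G" "zero N = zero G"
    and "\<zero> \<in> carrier N" "\<And>x y. x \<in> carrier N \<Longrightarrow> y \<in> carrier N \<Longrightarrow> x \<oplus> y \<in> carrier N"
    and "\<And>x. x \<in> carrier N \<Longrightarrow> \<ominus> x \<in> carrier N"
  shows "abelian_group N"
proof (rule abelian_groupI)
  fix x assume "x \<in> carrier N"
  then show "\<exists>y\<in>carrier N. y \<oplus>\<^bsub>N\<^esub> x = \<zero>\<^bsub>N\<^esub>"
    using assms by (intro bexI[of _ "\<ominus> x"]) (auto simp: l_neg subset_iff)
qed (use assms in \<open>auto simp: subset_iff a_assoc intro: a_comm\<close>)

lemma (in abelian_group) additive_subgroupI:
  assumes "H \<subseteq> carrier G" "\<zero> \<in> H" "\<And>x y. x \<in> H \<Longrightarrow> y \<in> H \<Longrightarrow> x \<oplus> y \<in> H"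
    and "\<And>x. x \<in> H \<Longrightarrow> \<ominus> x \<in> H"
  shows "additive_subgroup H G"
  by (rule additive_subgroup.intro, unfold_locales) (use assms in \<open>auto simp: a_inv_def\<close>)

locale graded_group = abelian_group M for M (structure) +
  fixes I :: "'i set" and C :: "'i \<Rightarrow> 'a set"
  assumes direct_sum: "direct_sum_of M I C"
begin

abbreviation hp :: "'a \<Rightarrow> 'i \<Rightarrow> 'a" where "hp x i \<equiv> hpart M I C x i"

lemma C_subgroup: "i \<in> I \<Longrightarrow> additive_subgroup (C i) M"
  using direct_sum by (simp add: direct_sum_of_def)

lemma C_closed: "i \<in> I \<Longrightarrow> x \<in> C i \<Longrightarrow> x \<in> carrier M"
  by (rule additive_subgroup.a_Hcarr[OF C_subgroup])

lemma C_zero: "i \<in> I \<Longrightarrow> \<zero> \<in> C i"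
  by (rule additive_subgroup.zero_closed[OF C_subgroup])

lemma C_add: "i \<in> I \<Longrightarrow> x \<in> C i \<Longrightarrow> y \<in> C i \<Longrightarrow> x \<oplus> y \<in> C i"
  by (rule additive_subgroup.a_closed[OF C_subgroup])

lemma C_minus: "i \<in> I \<Longrightarrow> x \<in> C i \<Longrightarrow> \<ominus> x \<in> C i"
  using additive_subgroup.a_subgroup[OF C_subgroup] by (simp add: a_inv_def subgroup.m_inv_closed)

lemma decomposition_hpart:
  assumes "x \<in> carrier M" shows "decomposition M I C x (hpart M I C x)"
  using direct_sum assms unfolding direct_sum_of_def hpart_def by (metis theI')

lemma hpart_eqI: "x \<in> carrier M \<Longrightarrow> decomposition M I C x f \<Longrightarrow> hpart M I C x = f"
  using direct_sum decomposition_hpart unfolding direct_sum_of_def by metis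

lemma hpart_in: "x \<in> carrier M \<Longrightarrow> i \<in> I \<Longrightarrow> hp x i \<in> C i"
  using decomposition_hpart by (auto simp: decomposition_def)

lemma hpart_closed: "x \<in> carrier M \<Longrightarrow> i \<in> I \<Longrightarrow> hp x i \<in> carrier M"
  using hpart_in C_closed by blast

lemma finite_hsupp: "x \<in> carrier M \<Longrightarrow> finite (hsupp M I C x)"
  using decomposition_hpart by (auto simp: decomposition_def hsupp_def)

lemma hpart_sum: "x \<in> carrier M \<Longrightarrow> x = (\<Oplus>i\<in>hsupp M I C x. hp x i)"
  using decomposition_hpart by (auto simp: decomposition_def hsupp_def)

lemma hpart_sum_superset:
  assumes "x \<in> carrier M" "finite F" "F \<subseteq> I" "hsupp M I C x \<subseteq> F"
  shows "(\<Oplus>i\<in>F. hp x i) = x"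
proof -
  have "(\<Oplus>i\<in>hsupp M I C x. hp x i) = (\<Oplus>i\<in>F. hp x i)"
    using assms hpart_closed[OF assms(1)]
    by (intro add.finprod_mono_neutral_cong_left) (auto simp: hsupp_def)
  then show ?thesis using hpart_sum[OF assms(1)] by simp
qed

lemma decompositionI:
  assumes "f \<in> extensional I" "\<And>i. i \<in> I \<Longrightarrow> f i \<in> C i" "finite F" "F \<subseteq> I"
    and "\<And>i. i \<in> I - F \<Longrightarrow> f i = \<zero>"
  shows "decomposition M I C (\<Oplus>i\<in>F. f i) f"
proof -
  have "(\<Oplus>i\<in>{i \<in> I. f i \<noteq> \<zero>}. f i) = (\<Oplus>i\<in>F. f i)"
    using assms C_closed by (intro add.finprod_mono_neutral_cong_left) auto
  moreover have "{i \<in> I. f i \<noteq> \<zero>} \<subseteq> F" using assms(5) by auto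
  ultimately show ?thesis
    using assms finite_subset by (auto simp: decomposition_def PiE_def)
qed

lemma hpart_hom:
  assumes "i \<in> I" "x \<in> C i" "j \<in> I"
  shows "hp x j = (if j = i then x else \<zero>)"
proof -
  let ?f = "\<lambda>j\<in>I. if j = i then x else \<zero>"
  have "decomposition M I C (\<Oplus>j\<in>{i}. ?f j) ?f"
    using assms by (intro decompositionI restrict_extensional) (auto simp: C_zero)
  moreover have "(\<Oplus>j\<in>{i}. ?f j) = x" using assms C_closed by (subst finsum_insert) auto
  ultimately have "hpart M I C x = ?f" using hpart_eqI assms C_closed by simp
  then show ?thesis using assms by simp
qed

lemma hpart_add:
  assumes "x \<in> carrier M" "y \<in> carrier M" "j \<in> I"
  shows "hp (x \<oplus> y) j = hp x j \<oplus> hp y j"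
proof -
  let ?f = "\<lambda>j\<in>I. hp x j \<oplus> hp y j" and ?F = "hsupp M I C x \<union> hsupp M I C y"
  have "decomposition M I C (\<Oplus>j\<in>?F. ?f j) ?f"
    using assms finite_hsupp[of x] finite_hsupp[of y]
    by (intro decompositionI restrict_extensional) (auto simp: C_add hpart_in hsupp_def)
  moreover have "(\<Oplus>j\<in>?F. ?f j) = (\<Oplus>j\<in>?F. hp x j \<oplus> hp y j)"
    using assms by (intro add.finprod_cong') (auto simp: hsupp_def hpart_closed)
  moreover have "\<dots> = (\<Oplus>j\<in>?F. hp x j) \<oplus> (\<Oplus>j\<in>?F. hp y j)"
    using assms by (intro finsum_addf) (auto simp: hsupp_def hpart_closed)
  moreover have "(\<Oplus>j\<in>?F. hp x j) = x" "(\<Oplus>j\<in>?F. hp y j) = y"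
    using assms by (auto intro!: hpart_sum_superset simp: finite_hsupp) (auto simp: hsupp_def)
  ultimately have "hpart M I C (x \<oplus> y) = ?f" using hpart_eqI assms by simp
  then show ?thesis using assms by simp
qed

lemma hpart_zero: "j \<in> I \<Longrightarrow> hp \<zero> j = \<zero>"
  using hpart_hom[of j \<zero> j] C_zero by simp

lemma hpart_minus:
  assumes "x \<in> carrier M" "j \<in> I" shows "hp (\<ominus> x) j = \<ominus> hp x j"
proof -
  have "hp (\<ominus> x) j \<oplus> hp x j = \<zero>"
    using assms by (simp flip: hpart_add add: l_neg hpart_zero)
  then show ?thesis using assms by (metis hpart_closed a_inv_closed minus_equality)
qed

lemma hpart_inject:
  assumes "x \<in> carrier M" "y \<in> carrier M" "\<And>i. i \<in> I \<Longrightarrow> hp x i = hp y i"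
  shows "x = y"
proof -
  have "hsupp M I C x = hsupp M I C y" using assms by (auto simp: hsupp_def)
  then have "(\<Oplus>i\<in>hsupp M I C x. hp x i) = (\<Oplus>i\<in>hsupp M I C y. hp y i)"
    using assms by (intro add.finprod_cong') (auto simp: hsupp_def hpart_closed)
  then show ?thesis using hpart_sum assms by metis
qed

text \<open>An element is the finite sum of its nonzero components. Only these are tested, so the
  rule can exploit a restriction on the support.\<close>

lemma closed_of_hparts:
  assumes "x \<in> carrier M" "\<zero> \<in> N" "\<And>y z. y \<in> N \<Longrightarrow> z \<in> N \<Longrightarrow> y \<oplus> z \<in> N"
    and "\<And>i. i \<in> I \<Longrightarrow> hp x i \<noteq> \<zero> \<Longrightarrow> hp x i \<in> N"
  shows "x \<in> N"
proof -
  have "(\<Oplus>i\<in>F. hp x i) \<in> N" if "finite F" "F \<subseteq> hsupp M I C x" for F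
    using that
  proof (induction F)
    case (insert i F)
    then have "(\<Oplus>i\<in>insert i F. hp x i) = hp x i \<oplus> (\<Oplus>i\<in>F. hp x i)"
      using assms(1) by (intro finsum_insert) (auto simp: hsupp_def hpart_closed)
    then show ?case using insert assms by (auto simp: hsupp_def)
  qed (use assms in auto)
  from this[OF finite_hsupp[OF assms(1)] order_refl]
  show ?thesis using hpart_sum[OF assms(1)] by simp
qed

text \<open>Additive statements are reduced with this rule to homogeneous elements, where the
  truncated products have a closed form.\<close>

lemma hom_induct [consumes 1, case_names zero add hom]:
  assumes "x \<in> carrier M" "P \<zero>"
    and "\<And>x y. x \<in> carrier M \<Longrightarrow> y \<in> carrier M \<Longrightarrow> P x \<Longrightarrow> P y \<Longrightarrow> P (x \<oplus> y)"
    and "\<And>i x. i \<in> I \<Longrightarrow> x \<in> C i \<Longrightarrow> P x"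
  shows "P x"
proof -
  have "x \<in> {x \<in> carrier M. P x}"
    by (rule closed_of_hparts) (use assms hpart_in[OF assms(1)] hpart_closed[OF assms(1)] in simp_all)
  then show ?thesis by simp
qed

end

text \<open>Orthogonal idempotent additive maps that are pointwise finite and jointly injective
  split a group into their sets of fixed points. All gradings below (submodules, quotients,
  restrictions, regradings, products, free modules) arise from this criterion, and its second half
  spares them the definite description behind \<open>hpart\<close>.\<close>

lemma (in abelian_group) direct_sum_of_projections:
  assumes closed: "\<And>x i. x \<in> carrier G \<Longrightarrow> i \<in> I \<Longrightarrow> p x i \<in> carrier G"
    and add: "\<And>x y i. x \<in> carrier G \<Longrightarrow> y \<in> carrier G \<Longrightarrow> i \<in> I \<Longrightarrow> p (x \<oplus> y) i = p x i \<oplus> p y i"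
    and idem: "\<And>x i j. x \<in> carrier G \<Longrightarrow> i \<in> I \<Longrightarrow> j \<in> I \<Longrightarrow>
        p (p x i) j = (if i = j then p x i else \<zero>)"
    and fin: "\<And>x. x \<in> carrier G \<Longrightarrow> finite {i \<in> I. p x i \<noteq> \<zero>}"
    and inj: "\<And>x. x \<in> carrier G \<Longrightarrow> (\<And>i. i \<in> I \<Longrightarrow> p x i = \<zero>) \<Longrightarrow> x = \<zero>"
    and C: "\<And>i. i \<in> I \<Longrightarrow> C i = {x \<in> carrier G. p x i = x}"
  shows "direct_sum_of G I C \<and> (\<forall>x\<in>carrier G. \<forall>i\<in>I. hpart G I C x i = p x i)"
proof -
  have p0: "p \<zero> i = \<zero>" if "i \<in> I" for i
    using add[of \<zero> \<zero> i] closed[of \<zero> i] that by (metis add.l_cancel_one zero_closed l_zero)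
  have pm: "p (\<ominus> x) i = \<ominus> p x i" if "x \<in> carrier G" "i \<in> I" for x i
    using add[of "\<ominus> x" x i] closed that by (metis a_inv_closed l_neg minus_equality p0)
  have sub: "additive_subgroup (C i) G" if "i \<in> I" for i
    using that by (intro additive_subgroupI) (auto simp: C p0 pm add)
  \<comment> \<open>Projecting a sum of homogeneous terms returns the term of that degree; this
    forces the uniqueness of decompositions.\<close>
  have sum: "p (\<Oplus>i\<in>F. f i) j = (if j \<in> F then f j else \<zero>)"
    if "finite F" "F \<subseteq> I" "j \<in> I" "\<And>i. i \<in> I \<Longrightarrow> f i \<in> C i" for f F j
    using that(1,2)
  proof (induction F)
    case (insert i F)
    have "f i \<in> carrier G" "f \<in> F \<rightarrow> carrier G" "p (f i) i = f i"
      using insert.prems that(4) C by auto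
    moreover have "p (f i) j = (if i = j then f i else \<zero>)"
      using idem[of "f i" i j] calculation insert.prems that(3) by (cases "i = j") auto
    moreover have "f j \<in> carrier G" using that C by auto
    ultimately show ?case using insert that(3) by (cases "i = j") (auto simp: add finsum_closed)
  qed (use that p0 in auto)
  have uniq: "f = (\<lambda>i\<in>I. p x i)" if "decomposition G I C x f" for x f
  proof (rule extensionalityI)
    fix j assume j: "j \<in> I"
    have f: "\<And>i. i \<in> I \<Longrightarrow> f i \<in> C i" using that by (auto simp: decomposition_def)
    have "p x j = (if j \<in> {i \<in> I. f i \<noteq> \<zero>} then f j else \<zero>)"
      using that sum[of "{i \<in> I. f i \<noteq> \<zero>}" j f] f j
      unfolding decomposition_def by simp
    then show "f j = (\<lambda>i\<in>I. p x i) j" using j by (auto split: if_splits)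
  qed (use that in \<open>auto simp: decomposition_def PiE_def\<close>)
  have ex: "decomposition G I C x (\<lambda>i\<in>I. p x i)" if x: "x \<in> carrier G" for x
  proof -
    let ?f = "\<lambda>i\<in>I. p x i" and ?F = "{i \<in> I. p x i \<noteq> \<zero>}"
    have f: "\<And>i. i \<in> I \<Longrightarrow> ?f i \<in> C i" using x closed idem C by simp
    have F: "{i \<in> I. ?f i \<noteq> \<zero>} = ?F" by auto
    have s: "(\<Oplus>i\<in>?F. ?f i) \<in> carrier G" using x closed by (intro finsum_closed) auto
    \<comment> \<open>The difference between \<open>x\<close> and the sum of its projections is
      killed by every projection, so joint injectivity makes it zero.\<close>
    have "p (x \<oplus> \<ominus> (\<Oplus>i\<in>?F. ?f i)) j = \<zero>" if "j \<in> I" for j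
      using x s that f fin sum[of ?F j ?f] by (auto simp: add pm closed r_neg)
    then have "x \<oplus> \<ominus> (\<Oplus>i\<in>?F. ?f i) = \<zero>" using inj x s by simp
    then have "x = (\<Oplus>i\<in>?F. ?f i)" using x s by (metis add.inv_solve_right l_zero zero_closed)
    moreover have "?f \<in> (\<Pi>\<^sub>E i\<in>I. C i)" using f by (intro PiE_I) auto
    ultimately show ?thesis unfolding decomposition_def F using fin[OF x] by blast
  qed
  have ds: "direct_sum_of G I C"
    unfolding direct_sum_of_def using sub ex uniq by blast
  interpret D: graded_group G I C by unfold_locales fact
  have "hpart G I C x i = p x i" if "x \<in> carrier G" "i \<in> I" for x i
    using D.hpart_eqI[OF that(1) ex[OF that(1)]] that by simp
  with ds show ?thesis by blast
qed

section \<open>Graded rings and modules\<close>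

locale graded_ring = G: group G + A: ring A + Ag: graded_group A "carrier G" "agr A"
  for G :: "('g, 'y) monoid_scheme" and A :: "('k, 'a, 'g) gr_algebra" +
  assumes one_deg: "\<one>\<^bsub>A\<^esub> \<in> agr A \<one>\<^bsub>G\<^esub>"
    and mult_deg: "\<lbrakk>s \<in> carrier G; t \<in> carrier G; a \<in> agr A s; b \<in> agr A t\<rbrakk> \<Longrightarrow>
      a \<otimes>\<^bsub>A\<^esub> b \<in> agr A (s \<otimes>\<^bsub>G\<^esub> t)"

lemma graded_ring_of_algebra: "graded_algebra K G A \<Longrightarrow> graded_ring G A"
  unfolding graded_algebra_def
  by (intro graded_ring.intro graded_group.intro graded_group_axioms.intro
      graded_ring_axioms.intro ring.is_abelian_group) auto

locale right_mod = A: ring A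
  for A :: "('a, 'x) ring_scheme" and M :: "('a, 'm, 'i) gr_module" +
  assumes right_module: "right_module A M"
begin

sublocale M: abelian_group M using right_module by (simp add: right_module_def)

lemma act_closed [simp]: "x \<in> carrier M \<Longrightarrow> a \<in> carrier A \<Longrightarrow> x \<cdot>\<^bsub>M\<^esub> a \<in> carrier M"
  and act_add_left: "\<lbrakk>x \<in> carrier M; y \<in> carrier M; a \<in> carrier A\<rbrakk> \<Longrightarrow>
        (x \<oplus>\<^bsub>M\<^esub> y) \<cdot>\<^bsub>M\<^esub> a = (x \<cdot>\<^bsub>M\<^esub> a) \<oplus>\<^bsub>M\<^esub> (y \<cdot>\<^bsub>M\<^esub> a)"
  and act_add_right: "\<lbrakk>x \<in> carrier M; a \<in> carrier A; b \<in> carrier A\<rbrakk> \<Longrightarrow>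
        x \<cdot>\<^bsub>M\<^esub> (a \<oplus>\<^bsub>A\<^esub> b) = (x \<cdot>\<^bsub>M\<^esub> a) \<oplus>\<^bsub>M\<^esub> (x \<cdot>\<^bsub>M\<^esub> b)"
  and act_mult: "\<lbrakk>x \<in> carrier M; a \<in> carrier A; b \<in> carrier A\<rbrakk> \<Longrightarrow>
        x \<cdot>\<^bsub>M\<^esub> (a \<otimes>\<^bsub>A\<^esub> b) = (x \<cdot>\<^bsub>M\<^esub> a) \<cdot>\<^bsub>M\<^esub> b"
  and act_one [simp]: "x \<in> carrier M \<Longrightarrow> x \<cdot>\<^bsub>M\<^esub> \<one>\<^bsub>A\<^esub> = x"
  using right_module by (simp_all add: right_module_def)

lemma act_zero_left [simp]: "a \<in> carrier A \<Longrightarrow> \<zero>\<^bsub>M\<^esub> \<cdot>\<^bsub>M\<^esub> a = \<zero>\<^bsub>M\<^esub>"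
  using act_add_left[of "\<zero>\<^bsub>M\<^esub>" "\<zero>\<^bsub>M\<^esub>" a]
  by (metis act_closed M.add.l_cancel_one M.zero_closed M.l_zero)

lemma act_zero_right [simp]: "x \<in> carrier M \<Longrightarrow> x \<cdot>\<^bsub>M\<^esub> \<zero>\<^bsub>A\<^esub> = \<zero>\<^bsub>M\<^esub>"
  using act_add_right[of x "\<zero>\<^bsub>A\<^esub>" "\<zero>\<^bsub>A\<^esub>"]
  by (metis act_closed M.add.l_cancel_one A.zero_closed A.l_zero)

lemma act_minus_left: "\<lbrakk>x \<in> carrier M; a \<in> carrier A\<rbrakk> \<Longrightarrow>
    (\<ominus>\<^bsub>M\<^esub> x) \<cdot>\<^bsub>M\<^esub> a = \<ominus>\<^bsub>M\<^esub> (x \<cdot>\<^bsub>M\<^esub> a)"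
  using act_add_left[of "\<ominus>\<^bsub>M\<^esub> x" x a] by (simp add: M.l_neg M.minus_equality)

lemma act_minus_right: "\<lbrakk>x \<in> carrier M; a \<in> carrier A\<rbrakk> \<Longrightarrow>
    x \<cdot>\<^bsub>M\<^esub> (\<ominus>\<^bsub>A\<^esub> a) = \<ominus>\<^bsub>M\<^esub> (x \<cdot>\<^bsub>M\<^esub> a)"
  using act_add_right[of x "\<ominus>\<^bsub>A\<^esub> a" a] by (simp add: A.l_neg M.minus_equality)

lemma minus_eq_act: "x \<in> carrier M \<Longrightarrow> \<ominus>\<^bsub>M\<^esub> x = x \<cdot>\<^bsub>M\<^esub> (\<ominus>\<^bsub>A\<^esub> \<one>\<^bsub>A\<^esub>)"
  by (simp add: act_minus_right)

lemma right_module_sub: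
  assumes "carrier N \<subseteq> carrier M" "add N = add M" "zero N = zero M" "ract N = ract M"
    and "\<zero>\<^bsub>M\<^esub> \<in> carrier N"
    and "\<And>x y. x \<in> carrier N \<Longrightarrow> y \<in> carrier N \<Longrightarrow> x \<oplus>\<^bsub>M\<^esub> y \<in> carrier N"
    and "\<And>x a. x \<in> carrier N \<Longrightarrow> a \<in> carrier A \<Longrightarrow> x \<cdot>\<^bsub>M\<^esub> a \<in> carrier N"
  shows "right_module A N"
proof -
  have "\<ominus>\<^bsub>M\<^esub> x \<in> carrier N" if "x \<in> carrier N" for x
    using that assms(1) assms(7)[of x "\<ominus>\<^bsub>A\<^esub> \<one>\<^bsub>A\<^esub>"] by (auto simp: minus_eq_act)
  then have "abelian_group N" using assms by (intro M.sub_abelian_group) auto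
  then show ?thesis
    using assms unfolding right_module_def
    by (auto simp: subset_iff act_add_left act_add_right act_mult)
qed

end

text \<open>Negatives are absent because \<open>- x\<close> is the action of \<open>- 1\<close> on
  \<open>x\<close>. This elementwise form stands in for \<open>submodule_of\<close>, which speaks of
  the module axioms of a modified record.\<close>

definition submod :: "('a, 'x) ring_scheme \<Rightarrow> 'm set \<Rightarrow> ('a, 'm, 'i) gr_module \<Rightarrow> bool" where
  "submod A N M \<longleftrightarrow> N \<subseteq> carrier M \<and> \<zero>\<^bsub>M\<^esub> \<in> N \<and>
     (\<forall>x\<in>N. \<forall>y\<in>N. x \<oplus>\<^bsub>M\<^esub> y \<in> N) \<and> (\<forall>x\<in>N. \<forall>a\<in>carrier A. x \<cdot>\<^bsub>M\<^esub> a \<in> N)"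

lemma submodI:
  assumes "N \<subseteq> carrier M" "\<zero>\<^bsub>M\<^esub> \<in> N" "\<And>x y. x \<in> N \<Longrightarrow> y \<in> N \<Longrightarrow> x \<oplus>\<^bsub>M\<^esub> y \<in> N"
    and "\<And>x a. x \<in> N \<Longrightarrow> a \<in> carrier A \<Longrightarrow> x \<cdot>\<^bsub>M\<^esub> a \<in> N"
  shows "submod A N M"
  using assms by (auto simp: submod_def)

lemma submodD:
  assumes "submod A N M"
  shows "N \<subseteq> carrier M" "\<zero>\<^bsub>M\<^esub> \<in> N" "\<And>x y. x \<in> N \<Longrightarrow> y \<in> N \<Longrightarrow> x \<oplus>\<^bsub>M\<^esub> y \<in> N"
    and "\<And>x a. x \<in> N \<Longrightarrow> a \<in> carrier A \<Longrightarrow> x \<cdot>\<^bsub>M\<^esub> a \<in> N"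
  using assms by (auto simp: submod_def)

lemma (in right_mod) submod_minus: "submod A N M \<Longrightarrow> x \<in> N \<Longrightarrow> \<ominus>\<^bsub>M\<^esub> x \<in> N"
  using submodD[of A N M] minus_eq_act[of x] by auto

lemma submodule_of_iff:
  assumes "ring A" "right_module A M"
  shows "submodule_of A N M \<longleftrightarrow> submod A N M"
proof -
  interpret right_mod A M using assms by (simp add: right_mod_def right_mod_axioms_def)
  show ?thesis
  proof
    assume N: "submodule_of A N M"
    then interpret N: right_mod A "M\<lparr>carrier := N\<rparr>"
      by unfold_locales (simp add: submodule_of_def)
    show "submod A N M"
      using N N.M.zero_closed N.M.a_closed N.act_closed by (simp add: submodule_of_def submod_def)
  next
    assume "submod A N M"
    then show "submodule_of A N M"
      unfolding submodule_of_def submod_def by (auto intro!: right_module_sub)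
  qed
qed

lemma generated_in_iff:
  assumes "ring A" "right_module A M"
  shows "generated_in A D M \<longleftrightarrow>
    (\<forall>N. submod A N M \<longrightarrow> (\<forall>t\<in>D. mgr M t \<subseteq> N) \<longrightarrow> carrier M \<subseteq> N)"
  unfolding generated_in_def submodule_of_iff[OF assms] by (force dest: submodD(1))

locale graded_mod = graded_ring G A
  for G :: "('g, 'y) monoid_scheme" and A :: "('k, 'a, 'g) gr_algebra" +
  fixes M :: "('a, 'm, 'g) gr_module"
  assumes graded_module: "graded_module G A M"
begin

sublocale right_mod A M
  using graded_module by unfold_locales (simp add: graded_module_def)

sublocale Mg: graded_group M "carrier G" "mgr M"
  using graded_module by unfold_locales (simp add: graded_module_def)

lemma act_deg: "\<lbrakk>s \<in> carrier G; t \<in> carrier G; x \<in> mgr M s; a \<in> agr A t\<rbrakk> \<Longrightarrow>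
    x \<cdot>\<^bsub>M\<^esub> a \<in> mgr M (s \<otimes>\<^bsub>G\<^esub> t)"
  using graded_module by (simp add: graded_module_def)

lemma act_hom_closed:
  assumes "x \<in> carrier M" "N \<subseteq> carrier M" "\<zero>\<^bsub>M\<^esub> \<in> N"
    and "\<And>y z. y \<in> N \<Longrightarrow> z \<in> N \<Longrightarrow> y \<oplus>\<^bsub>M\<^esub> z \<in> N"
    and "\<And>k a. k \<in> carrier G \<Longrightarrow> a \<in> agr A k \<Longrightarrow> x \<cdot>\<^bsub>M\<^esub> a \<in> N"
    and "a \<in> carrier A"
  shows "x \<cdot>\<^bsub>M\<^esub> a \<in> N"
  using assms(6)
  by (induction rule: Ag.hom_induct) (use assms in \<open>auto simp: act_add_right\<close>)

end

text \<open>Gradedness is expressed by closure under the components taken in \<open>M\<close>, so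
  that no second grading has to be carried along; \<open>graded_submodule_iff\<close> links it to
  \<open>graded_submodule\<close>.\<close>

definition graded_submod ::
  "('g, 'y) monoid_scheme \<Rightarrow> ('k, 'a, 'g) gr_algebra \<Rightarrow> 'm set \<Rightarrow> ('a, 'm, 'g) gr_module \<Rightarrow> bool" where
  "graded_submod G A N M \<longleftrightarrow> submod A N M \<and>
     (\<forall>x\<in>N. \<forall>t\<in>carrier G. hpart M (carrier G) (mgr M) x t \<in> N)"

section \<open>Graded submodules and spans of homogeneous elements\<close>

context graded_mod
begin

lemma gr_sub_graded:
  assumes "graded_submod G A N M"
  shows "graded_module G A (gr_sub M N)"
    and "\<And>x t. x \<in> N \<Longrightarrow> t \<in> carrier G \<Longrightarrow>
      hpart (gr_sub M N) (carrier G) (mgr (gr_sub M N)) x t = Mg.hp x t"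
proof -
  let ?N = "gr_sub M N"
  have N: "submod A N M" and hN: "\<And>x t. x \<in> N \<Longrightarrow> t \<in> carrier G \<Longrightarrow> Mg.hp x t \<in> N"
    using assms by (auto simp: graded_submod_def)
  note NS = submodD[OF N]
  have rm: "right_module A ?N"
    using NS by (intro right_module_sub) (auto simp: gr_sub_def)
  then interpret N: abelian_group ?N by (simp add: right_module_def)
  have *: "\<And>x. x \<in> N \<Longrightarrow> x \<in> carrier M" using NS(1) by auto
  have C: "mgr ?N t = {x \<in> carrier ?N. Mg.hp x t = x}" if "t \<in> carrier G" for t
    using that NS(1) Mg.hpart_hom[OF that _ that] Mg.hpart_in[OF _ that]
    by (auto simp: gr_sub_def subset_iff) metis
  have fin: "finite {i \<in> carrier G. Mg.hp x i \<noteq> \<zero>\<^bsub>?N\<^esub>}" if "x \<in> carrier ?N" for x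
    using that * Mg.finite_hsupp[of x] by (simp add: gr_sub_def hsupp_def)
  have inj: "x = \<zero>\<^bsub>?N\<^esub>" if "x \<in> carrier ?N" "\<And>i. i \<in> carrier G \<Longrightarrow> Mg.hp x i = \<zero>\<^bsub>?N\<^esub>" for x
    using that * Mg.hpart_inject[of x "\<zero>\<^bsub>M\<^esub>"] by (simp add: gr_sub_def Mg.hpart_zero)
  have idem: "Mg.hp (Mg.hp x i) j = (if i = j then Mg.hp x i else \<zero>\<^bsub>?N\<^esub>)"
    if "x \<in> carrier ?N" "i \<in> carrier G" "j \<in> carrier G" for x i j
    using that * Mg.hpart_hom[of i "Mg.hp x i" j] Mg.hpart_in[of x i] by (auto simp: gr_sub_def)
  have cl: "Mg.hp x i \<in> carrier ?N" if "x \<in> carrier ?N" "i \<in> carrier G" for x i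
    using that hN by (simp add: gr_sub_def)
  have ad: "Mg.hp (x \<oplus>\<^bsub>?N\<^esub> y) i = Mg.hp x i \<oplus>\<^bsub>?N\<^esub> Mg.hp y i"
    if "x \<in> carrier ?N" "y \<in> carrier ?N" "i \<in> carrier G" for x y i
    using that * by (simp add: gr_sub_def Mg.hpart_add)
  have ds: "direct_sum_of ?N (carrier G) (mgr ?N) \<and>
      (\<forall>x\<in>carrier ?N. \<forall>i\<in>carrier G. hpart ?N (carrier G) (mgr ?N) x i = Mg.hp x i)"
    by (rule N.direct_sum_of_projections) (fact cl ad idem fin inj C)+
  show "graded_module G A ?N"
    unfolding graded_module_def
  proof (intro conjI ballI)
    show "x \<cdot>\<^bsub>?N\<^esub> a \<in> mgr ?N (s \<otimes>\<^bsub>G\<^esub> t)"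
      if "s \<in> carrier G" "t \<in> carrier G" "x \<in> mgr ?N s" "a \<in> agr A t" for s t x a
      using that act_deg NS(4)[of x a] Ag.C_closed by (simp add: gr_sub_def)
  qed (use rm ds in blast)+
  show "hpart ?N (carrier G) (mgr ?N) x t = Mg.hp x t" if "x \<in> N" "t \<in> carrier G" for x t
    using ds that by (simp add: gr_sub_def)
qed

lemma graded_submodule_iff: "graded_submodule G A N M \<longleftrightarrow> graded_submod G A N M"
proof
  assume gs: "graded_submodule G A N M"
  then interpret N: graded_mod G A "gr_sub M N"
    by unfold_locales (simp add: graded_submodule_def)
  have NM: "N \<subseteq> carrier M" using gs by (simp add: graded_submodule_def)
  have sub: "submod A N M"
    using NM N.M.zero_closed N.M.a_closed N.act_closed by (simp add: submod_def gr_sub_def)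
  have "Mg.hp x t \<in> N" if "x \<in> N" "t \<in> carrier G" for x t
  proof -
    have "x \<in> carrier (gr_sub M N)" using that by (simp add: gr_sub_def)
    \<comment> \<open>An element homogeneous inside \<open>N\<close> is homogeneous of the same
      degree in \<open>M\<close>, so its components in \<open>M\<close> are itself and zero.
      Membership in \<open>carrier M\<close> is carried along because additivity of the components
      of \<open>M\<close> requires it.\<close>
    then have "Mg.hp x t \<in> N \<and> x \<in> carrier M"
    proof (induction rule: N.Mg.hom_induct)
      case (add x y)
      then show ?case using submodD(3)[OF sub] that by (simp add: gr_sub_def Mg.hpart_add)
    next
      case (hom i x)
      then show ?case using that NM submodD(2)[OF sub] by (auto simp: gr_sub_def Mg.hpart_hom)
    qed (use that submodD(2)[OF sub] NM in \<open>auto simp: gr_sub_def Mg.hpart_zero\<close>)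
    then show ?thesis by simp
  qed
  then show "graded_submod G A N M" using sub by (simp add: graded_submod_def)
next
  assume "graded_submod G A N M"
  then show "graded_submodule G A N M"
    using gr_sub_graded(1) submodD(1)[of A N M] by (auto simp: graded_submodule_def graded_submod_def)
qed

text \<open>Summands \<open>t a\<close> with homogeneous coefficients are added one at a time, so
  that in each induction step the degree of the new summand is known once \<open>t\<close> is
  homogeneous. Closure under all of \<open>A\<close> is recovered in
  \<open>span_submod\<close>.\<close>

inductive_set span :: "'m set \<Rightarrow> 'm set" for T where
  zero: "\<zero>\<^bsub>M\<^esub> \<in> span T"
| step: "\<lbrakk>y \<in> span T; t \<in> T; k \<in> carrier G; a \<in> agr A k\<rbrakk> \<Longrightarrow> y \<oplus>\<^bsub>M\<^esub> t \<cdot>\<^bsub>M\<^esub> a \<in> span T"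

lemma span_subset: "submod A N M \<Longrightarrow> T \<subseteq> N \<Longrightarrow> span T \<subseteq> N"
proof
  fix x assume N: "submod A N M" "T \<subseteq> N" and "x \<in> span T"
  from this(3) show "x \<in> N"
    by induction (use N submodD[OF N(1)] Ag.C_closed in auto)
qed

lemma span_closed:
  assumes "T \<subseteq> carrier M" shows "span T \<subseteq> carrier M"
proof
  fix x assume "x \<in> span T"
  then show "x \<in> carrier M" by induction (use assms Ag.C_closed in auto)
qed

lemma span_add:
  assumes "T \<subseteq> carrier M" "x \<in> span T" "y \<in> span T" shows "x \<oplus>\<^bsub>M\<^esub> y \<in> span T"
  using assms(3)
proof induction
  case zero
  then show ?case using assms span_closed by (auto simp: subset_iff)
next
  case (step y t k a)
  have "x \<in> carrier M" "y \<in> carrier M" "t \<cdot>\<^bsub>M\<^esub> a \<in> carrier M"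
    using assms span_closed step Ag.C_closed by (auto simp: subset_iff)
  then have "x \<oplus>\<^bsub>M\<^esub> (y \<oplus>\<^bsub>M\<^esub> t \<cdot>\<^bsub>M\<^esub> a) = (x \<oplus>\<^bsub>M\<^esub> y) \<oplus>\<^bsub>M\<^esub> t \<cdot>\<^bsub>M\<^esub> a" by (simp add: M.a_assoc)
  then show ?case using span.step step by metis
qed

lemma span_submod:
  assumes "T \<subseteq> carrier M" shows "submod A (span T) M"
proof (rule submodI)
  fix x a assume x: "x \<in> span T" and a: "a \<in> carrier A"
  from x show "x \<cdot>\<^bsub>M\<^esub> a \<in> span T"
  proof induction
    case (step y t k b)
    note mem = step assms span_closed[OF assms] a Ag.C_closed[OF step(3,4)]
    \<comment> \<open>The coefficient \<open>a\<close> is split into homogeneous parts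
      \<open>c\<close>, because a step of \<open>span\<close> accepts only homogeneous coefficients
      and \<open>b c\<close> is one.\<close>
    have "t \<cdot>\<^bsub>M\<^esub> b \<cdot>\<^bsub>M\<^esub> a \<in> span T"
    proof (rule act_hom_closed)
      fix l c assume l: "l \<in> carrier G" "c \<in> agr A l"
      have "\<zero>\<^bsub>M\<^esub> \<oplus>\<^bsub>M\<^esub> t \<cdot>\<^bsub>M\<^esub> (b \<otimes>\<^bsub>A\<^esub> c) \<in> span T"
        by (rule span.step[OF span.zero step(2) _ mult_deg[OF step(3) l(1) step(4) l(2)]])
          (use step l in auto)
      then show "t \<cdot>\<^bsub>M\<^esub> b \<cdot>\<^bsub>M\<^esub> c \<in> span T" using mem l Ag.C_closed[OF l] by (auto simp: act_mult subset_iff)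
    qed (use mem span_add[OF assms] span.zero in auto)
    then have "y \<cdot>\<^bsub>M\<^esub> a \<oplus>\<^bsub>M\<^esub> t \<cdot>\<^bsub>M\<^esub> b \<cdot>\<^bsub>M\<^esub> a \<in> span T" using step span_add[OF assms] by simp
    then show ?case using mem by (auto simp: act_add_left subset_iff)
  qed (use a span.zero in auto)
qed (use span_add[OF assms] span_closed[OF assms] span.zero in auto)

lemma span_base: assumes "T \<subseteq> carrier M" shows "T \<subseteq> span T"
proof
  fix t assume "t \<in> T"
  then show "t \<in> span T"
    using span.step[OF span.zero _ G.one_closed one_deg, of t T] assms by (auto simp: subset_iff)
qed

text \<open>A summand \<open>t a\<close> of homogeneous factors is concentrated in one degree, so
  passing to a component keeps or drops each summand as a whole.\<close>

lemma span_graded: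
  assumes "\<And>t. t \<in> T \<Longrightarrow> \<exists>s\<in>carrier G. t \<in> mgr M s"
  shows "graded_submod G A (span T) M"
proof -
  have T: "T \<subseteq> carrier M" using assms Mg.C_closed by blast
  have "Mg.hp x s \<in> span T" if "x \<in> span T" "s \<in> carrier G" for x s
    using that(1)
  proof induction
    case zero
    then show ?case using that by (simp add: Mg.hpart_zero span.zero)
  next
    case (step y t k a)
    obtain r where r: "r \<in> carrier G" "t \<in> mgr M r" using assms step by blast
    have cl: "y \<in> carrier M" "t \<cdot>\<^bsub>M\<^esub> a \<in> carrier M"
      using step span_closed[OF T] T Ag.C_closed by (auto simp: subset_iff)
    have "Mg.hp (t \<cdot>\<^bsub>M\<^esub> a) s \<in> {\<zero>\<^bsub>M\<^esub>, t \<cdot>\<^bsub>M\<^esub> a}"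
      using Mg.hpart_hom[OF _ act_deg[OF r(1) step(3) r(2) step(4)] that(2)] r step by simp
    moreover have "Mg.hp y s \<oplus>\<^bsub>M\<^esub> t \<cdot>\<^bsub>M\<^esub> a \<in> span T"
      by (rule span.step) (use step in auto)
    moreover have "Mg.hp y s \<in> carrier M" using cl that Mg.hpart_closed by auto
    ultimately show ?case
      using step cl that by (auto simp: Mg.hpart_add)
  qed
  then show ?thesis using span_submod[OF T] by (simp add: graded_submod_def)
qed

lemma generated_in_span:
  assumes "D \<subseteq> carrier G"
  shows "generated_in A D M \<longleftrightarrow> carrier M \<subseteq> span (\<Union>t\<in>D. mgr M t)"
proof -
  let ?T = "\<Union>t\<in>D. mgr M t"
  have T: "?T \<subseteq> carrier M" using assms Mg.C_closed by blast
  show ?thesis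
    unfolding generated_in_iff[OF A.ring_axioms right_module]
    using span_submod[OF T] span_base[OF T] span_subset[of _ ?T] by blast
qed

end

section \<open>Morphisms, quotients and categories\<close>

text \<open>In contrast to \<open>gr_hom\<close>, the two carriers may have different types and the
  function is arbitrary off its domain. Maps out of a free module or onto a quotient in another type
  need this freedom.\<close>

definition ghom :: "('g, 'y) monoid_scheme \<Rightarrow> ('k, 'a, 'g) gr_algebra \<Rightarrow>
    ('a, 'm, 'g) gr_module \<Rightarrow> ('a, 'n, 'g) gr_module \<Rightarrow> ('m \<Rightarrow> 'n) \<Rightarrow> bool" where
  "ghom G A M N f \<longleftrightarrow> f \<in> carrier M \<rightarrow> carrier N \<and>
     (\<forall>x\<in>carrier M. \<forall>y\<in>carrier M. f (x \<oplus>\<^bsub>M\<^esub> y) = f x \<oplus>\<^bsub>N\<^esub> f y) \<and>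
     (\<forall>x\<in>carrier M. \<forall>a\<in>carrier A. f (x \<cdot>\<^bsub>M\<^esub> a) = f x \<cdot>\<^bsub>N\<^esub> a) \<and>
     (\<forall>t\<in>carrier G. f ` mgr M t \<subseteq> mgr N t)"

lemma gr_hom_iff: "f \<in> gr_hom G A M N \<longleftrightarrow> f \<in> extensional (carrier M) \<and> ghom G A M N f"
  by (auto simp: gr_hom_def ghom_def PiE_def)

lemma ghomD:
  assumes "ghom G A M N f"
  shows "x \<in> carrier M \<Longrightarrow> f x \<in> carrier N"
    and "x \<in> carrier M \<Longrightarrow> y \<in> carrier M \<Longrightarrow> f (x \<oplus>\<^bsub>M\<^esub> y) = f x \<oplus>\<^bsub>N\<^esub> f y"
    and "x \<in> carrier M \<Longrightarrow> a \<in> carrier A \<Longrightarrow> f (x \<cdot>\<^bsub>M\<^esub> a) = f x \<cdot>\<^bsub>N\<^esub> a"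
    and "t \<in> carrier G \<Longrightarrow> x \<in> mgr M t \<Longrightarrow> f x \<in> mgr N t"
  using assms unfolding ghom_def by blast+

lemma ghomI:
  assumes "\<And>x. x \<in> carrier M \<Longrightarrow> f x \<in> carrier N"
    and "\<And>x y. x \<in> carrier M \<Longrightarrow> y \<in> carrier M \<Longrightarrow> f (x \<oplus>\<^bsub>M\<^esub> y) = f x \<oplus>\<^bsub>N\<^esub> f y"
    and "\<And>x a. x \<in> carrier M \<Longrightarrow> a \<in> carrier A \<Longrightarrow> f (x \<cdot>\<^bsub>M\<^esub> a) = f x \<cdot>\<^bsub>N\<^esub> a"
    and "\<And>t x. t \<in> carrier G \<Longrightarrow> x \<in> mgr M t \<Longrightarrow> f x \<in> mgr N t"
  shows "ghom G A M N f"
  using assms by (auto simp: ghom_def)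

context graded_ring
begin

lemma ghom_zero:
  assumes "graded_module G A M" "graded_module G A N" "ghom G A M N f"
  shows "f \<zero>\<^bsub>M\<^esub> = \<zero>\<^bsub>N\<^esub>"
proof -
  interpret M: graded_mod G A M by unfold_locales fact
  interpret N: graded_mod G A N by unfold_locales fact
  have "f \<zero>\<^bsub>M\<^esub> \<oplus>\<^bsub>N\<^esub> f \<zero>\<^bsub>M\<^esub> = f \<zero>\<^bsub>M\<^esub>" using ghomD(2)[OF assms(3), of "\<zero>\<^bsub>M\<^esub>" "\<zero>\<^bsub>M\<^esub>"] by simp
  then show ?thesis using ghomD(1)[OF assms(3), of "\<zero>\<^bsub>M\<^esub>"] by (simp add: N.M.add.l_cancel_one)
qed

lemma ghom_minus:
  assumes "graded_module G A M" "graded_module G A N" "ghom G A M N f" "x \<in> carrier M"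
  shows "f (\<ominus>\<^bsub>M\<^esub> x) = \<ominus>\<^bsub>N\<^esub> f x"
proof -
  interpret M: graded_mod G A M by unfold_locales fact
  interpret N: graded_mod G A N by unfold_locales fact
  show ?thesis using assms(4) by (simp add: M.minus_eq_act N.minus_eq_act ghomD[OF assms(3)])
qed

lemma ghom_hpart:
  assumes "graded_module G A M" "graded_module G A N" "ghom G A M N f"
    and "x \<in> carrier M" "t \<in> carrier G"
  shows "hpart N (carrier G) (mgr N) (f x) t = f (hpart M (carrier G) (mgr M) x t)"
proof -
  interpret M: graded_mod G A M by unfold_locales fact
  interpret N: graded_mod G A N by unfold_locales fact
  note f = ghomD[OF assms(3)]
  from assms(4) show ?thesis
    by (induction rule: M.Mg.hom_induct)
      (use assms(5) in \<open>simp_all add: ghom_zero[OF assms(1-3)] f M.Mg.hpart_zero N.Mg.hpart_zero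
        M.Mg.hpart_add N.Mg.hpart_add M.Mg.hpart_closed M.Mg.hpart_hom N.Mg.hpart_hom\<close>)
qed

lemma ghom_image:
  assumes "graded_module G A M" "graded_module G A N" "ghom G A M N f"
  shows "graded_submod G A (f ` carrier M) N"
proof -
  interpret M: graded_mod G A M by unfold_locales fact
  interpret N: graded_mod G A N by unfold_locales fact
  note f = ghomD[OF assms(3)]
  have "\<zero>\<^bsub>N\<^esub> \<in> f ` carrier M" using ghom_zero[OF assms] M.M.zero_closed by (metis imageI)
  moreover have "f x \<oplus>\<^bsub>N\<^esub> f y \<in> f ` carrier M" if "x \<in> carrier M" "y \<in> carrier M" for x y
    using that f(2)[of x y] by (metis imageI M.M.a_closed)
  moreover have "f x \<cdot>\<^bsub>N\<^esub> a \<in> f ` carrier M" if "x \<in> carrier M" "a \<in> carrier A" for x a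
    using that f(3)[of x a] by (metis imageI M.act_closed)
  ultimately have "submod A (f ` carrier M) N" using f(1) by (intro submodI) auto
  then show ?thesis
    using ghom_hpart[OF assms] M.Mg.hpart_closed by (auto simp: graded_submod_def)
qed

text \<open>The equaliser of two morphisms is a submodule, hence everything once it contains the
  generating degrees.\<close>

lemma ghom_eq_of_generated:
  assumes "graded_module G A M" "graded_module G A N" "ghom G A M N f" "ghom G A M N f'"
    and "generated_in A D M" "\<And>t x. t \<in> D \<Longrightarrow> x \<in> mgr M t \<Longrightarrow> f x = f' x"
    and "D \<subseteq> carrier G" "x \<in> carrier M"
  shows "f x = f' x"
proof -
  interpret M: graded_mod G A M by unfold_locales fact
  interpret N: graded_mod G A N by unfold_locales fact
  have "submod A {x \<in> carrier M. f x = f' x} M"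
    by (rule submodI) (auto simp: ghomD[OF assms(3)] ghomD[OF assms(4)] ghom_zero[OF assms(1-3)]
        ghom_zero[OF assms(1,2,4)])
  moreover have "\<forall>t\<in>D. mgr M t \<subseteq> {x \<in> carrier M. f x = f' x}"
    using assms(6,7) M.Mg.C_closed by auto
  ultimately show ?thesis
    using assms(5,8) unfolding generated_in_iff[OF A.ring_axioms M.right_module] by blast
qed

text \<open>The preimage of a submodule containing the degrees \<open>D\<close> of \<open>N\<close>
  is a submodule containing the degrees \<open>D\<close> of \<open>M\<close>.\<close>

lemma generated_in_ghom_image:
  assumes "graded_module G A M" "graded_module G A N" "ghom G A M N f"
    and "f ` carrier M = carrier N" "generated_in A D M" "D \<subseteq> carrier G"
  shows "generated_in A D N"
proof -
  interpret M: graded_mod G A M by unfold_locales fact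
  interpret N: graded_mod G A N by unfold_locales fact
  note f = ghomD[OF assms(3)]
  show ?thesis
    unfolding generated_in_iff[OF A.ring_axioms N.right_module]
  proof (intro allI impI)
    fix N' assume N': "submod A N' N" "\<forall>t\<in>D. mgr N t \<subseteq> N'"
    have "submod A {x \<in> carrier M. f x \<in> N'} M"
      by (rule submodI) (auto simp: f ghom_zero[OF assms(1-3)] submodD[OF N'(1)])
    moreover have "\<forall>t\<in>D. mgr M t \<subseteq> {x \<in> carrier M. f x \<in> N'}"
      using N'(2) M.Mg.C_closed f(4) assms(6) by blast
    ultimately have "carrier M \<subseteq> {x \<in> carrier M. f x \<in> N'}"
      using assms(5) unfolding generated_in_iff[OF A.ring_axioms M.right_module] by blast
    then show "carrier N \<subseteq> N'" unfolding assms(4)[symmetric] by blast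
  qed
qed

lemma surj_of_generated:
  assumes "graded_module G A M" "graded_module G A N" "ghom G A M N f"
    and "generated_in A D N" "\<And>t. t \<in> D \<Longrightarrow> mgr N t \<subseteq> f ` carrier M"
  shows "f ` carrier M = carrier N"
proof -
  interpret N: graded_mod G A N by unfold_locales fact
  have "submod A (f ` carrier M) N" using ghom_image[OF assms(1-3)] by (simp add: graded_submod_def)
  then have "carrier N \<subseteq> f ` carrier M"
    using assms(4,5) unfolding generated_in_iff[OF A.ring_axioms N.right_module] by blast
  then show ?thesis using ghomD(1)[OF assms(3)] by auto
qed

end

text \<open>
  The quotient is carried by representatives of the cosets, so that it lives in every type
  into which the carrier embeds.
\<close>

lemma (in graded_mod) quotient_exists:
  assumes "graded_submod G A N M" "carrier M \<lesssim> (UNIV :: 'n set)"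
  obtains Y :: "('a, 'n, 'g) gr_module" and q
  where "graded_module G A Y" "ghom G A M Y q" "q ` carrier M = carrier Y"
    "\<And>x. x \<in> carrier M \<Longrightarrow> q x = \<zero>\<^bsub>Y\<^esub> \<longleftrightarrow> x \<in> N"
proof -
  obtain \<iota> :: "_ \<Rightarrow> 'n" where \<iota>: "inj_on \<iota> (carrier M)" using assms(2) by (auto simp: lepoll_def)
  have N: "submod A N M" and hN: "\<And>x t. x \<in> N \<Longrightarrow> t \<in> carrier G \<Longrightarrow> Mg.hp x t \<in> N"
    using assms(1) by (auto simp: graded_submod_def)
  note NS = submodD[OF N]
  have Nc: "x \<in> carrier M" if "x \<in> N" for x using that NS(1) by auto
  define E where "E x y \<longleftrightarrow> x \<oplus>\<^bsub>M\<^esub> \<ominus>\<^bsub>M\<^esub> y \<in> N" for x y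
  have E_refl: "E x x" if "x \<in> carrier M" for x using that NS(2) by (simp add: E_def M.r_neg)
  have E_sym: "E y x" if "E x y" "x \<in> carrier M" "y \<in> carrier M" for x y
    using submod_minus[OF N that(1)[unfolded E_def]] that
    by (simp add: E_def M.minus_add M.a_comm)
  have E_trans: "E x z" if "E x y" "E y z" "x \<in> carrier M" "y \<in> carrier M" "z \<in> carrier M" for x y z
  proof -
    have "(x \<oplus>\<^bsub>M\<^esub> \<ominus>\<^bsub>M\<^esub> y) \<oplus>\<^bsub>M\<^esub> (y \<oplus>\<^bsub>M\<^esub> \<ominus>\<^bsub>M\<^esub> z) = x \<oplus>\<^bsub>M\<^esub> \<ominus>\<^bsub>M\<^esub> z"
      using that(3-5) by (simp add: M.a_assoc M.r_neg1)
    then show ?thesis using that(1,2) NS(3)[of "x \<oplus>\<^bsub>M\<^esub> \<ominus>\<^bsub>M\<^esub> y" "y \<oplus>\<^bsub>M\<^esub> \<ominus>\<^bsub>M\<^esub> z"]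
      by (simp add: E_def)
  qed
  \<comment> \<open>On congruent elements the choice operator is applied to equivalent predicates,
    so \<open>rep\<close> is constant on cosets; composed with the injection \<iota> it gives a map
    \<open>q\<close> whose fibres are exactly the cosets.\<close>
  define rep where "rep x = (SOME y. y \<in> carrier M \<and> E x y)" for x
  have rep: "rep x \<in> carrier M \<and> E x (rep x)" if "x \<in> carrier M" for x
    unfolding rep_def by (rule someI[of _ x]) (use that E_refl in auto)
  define q where "q x = \<iota> (rep x)" for x
  have q_iff: "q x = q y \<longleftrightarrow> E x y" if "x \<in> carrier M" "y \<in> carrier M" for x y
  proof
    assume "q x = q y"
    then have "rep x = rep y" using \<iota> rep that by (simp add: q_def inj_on_def)
    then show "E x y" using rep that E_sym E_trans by metis
  next
    assume "E x y"
    then have "z \<in> carrier M \<and> E x z \<longleftrightarrow> z \<in> carrier M \<and> E y z" for z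
      using that E_sym[of x y] E_trans[of x y z] E_trans[of y x z] by blast
    then show "q x = q y" by (simp add: q_def rep_def)
  qed
  \<comment> \<open>The operations of the quotient are computed on arbitrary preimages chosen by
    \<open>s\<close>; \<open>add\<close> and \<open>act\<close> then show that the choice does not
    matter.\<close>
  define s where "s = inv_into (carrier M) q"
  have s: "s (q x) \<in> carrier M \<and> E (s (q x)) x" if "x \<in> carrier M" for x
    using that q_iff[of "s (q x)" x] by (simp add: s_def inv_into_into f_inv_into_f)
  define Y :: "('a, 'n, 'g) gr_module" where
    "Y = \<lparr>carrier = q ` carrier M, mult = undefined, one = undefined, zero = q \<zero>\<^bsub>M\<^esub>,
       add = (\<lambda>a b. q (s a \<oplus>\<^bsub>M\<^esub> s b)), ract = (\<lambda>a r. q (s a \<cdot>\<^bsub>M\<^esub> r)), mgr = (\<lambda>t. q ` mgr M t)\<rparr>"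
  have add: "q x \<oplus>\<^bsub>Y\<^esub> q y = q (x \<oplus>\<^bsub>M\<^esub> y)" if "x \<in> carrier M" "y \<in> carrier M" for x y
  proof -
    have "E (s (q x) \<oplus>\<^bsub>M\<^esub> s (q y)) (x \<oplus>\<^bsub>M\<^esub> y)"
      using s[OF that(1)] s[OF that(2)] that
        NS(3)[of "s (q x) \<oplus>\<^bsub>M\<^esub> \<ominus>\<^bsub>M\<^esub> x" "s (q y) \<oplus>\<^bsub>M\<^esub> \<ominus>\<^bsub>M\<^esub> y"]
      by (simp add: E_def M.minus_add) (simp add: M.a_ac)
    then show ?thesis using that s by (simp add: Y_def q_iff)
  qed
  have act: "q x \<cdot>\<^bsub>Y\<^esub> r = q (x \<cdot>\<^bsub>M\<^esub> r)" if "x \<in> carrier M" "r \<in> carrier A" for x r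
  proof -
    have "E (s (q x) \<cdot>\<^bsub>M\<^esub> r) (x \<cdot>\<^bsub>M\<^esub> r)"
      using s[OF that(1)] that NS(4)[of "s (q x) \<oplus>\<^bsub>M\<^esub> \<ominus>\<^bsub>M\<^esub> x" r]
      by (simp add: E_def act_add_left act_minus_left)
    then show ?thesis using that s by (simp add: Y_def q_iff)
  qed
  have Yc: "carrier Y = q ` carrier M" "\<zero>\<^bsub>Y\<^esub> = q \<zero>\<^bsub>M\<^esub>" "\<And>t. mgr Y t = q ` mgr M t"
    by (simp_all add: Y_def)
  interpret Y: abelian_group Y
  proof (rule abelian_groupI)
    fix x assume "x \<in> carrier Y"
    then obtain y where "y \<in> carrier M" "x = q y" by (auto simp: Yc)
    then show "\<exists>y\<in>carrier Y. y \<oplus>\<^bsub>Y\<^esub> x = \<zero>\<^bsub>Y\<^esub>"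
      by (intro bexI[of _ "q (\<ominus>\<^bsub>M\<^esub> y)"]) (auto simp: Yc add M.l_neg)
  qed (auto simp: Yc add M.a_ac)
  have rm: "right_module A Y"
    using Y.abelian_group_axioms unfolding right_module_def
    by (auto simp: Yc add act act_add_left act_add_right act_mult)
  \<comment> \<open>The component of a class is the class of the component of a preimage. This is
    well defined because \<open>N\<close> contains the components of its elements.\<close>
  define p where "p y t = q (Mg.hp (s y) t)" for y t
  have p: "p (q x) t = q (Mg.hp x t)" if "x \<in> carrier M" "t \<in> carrier G" for x t
  proof -
    have "E (Mg.hp (s (q x)) t) (Mg.hp x t)"
      using s[OF that(1)] that hN[of "s (q x) \<oplus>\<^bsub>M\<^esub> \<ominus>\<^bsub>M\<^esub> x" t]
      by (simp add: E_def Mg.hpart_add Mg.hpart_minus)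
    then show ?thesis using that s by (simp add: p_def q_iff Mg.hpart_closed)
  qed
  have q0: "q x = \<zero>\<^bsub>Y\<^esub> \<longleftrightarrow> x \<in> N" if "x \<in> carrier M" for x
    using that q_iff[of x "\<zero>\<^bsub>M\<^esub>"] M.minus_equality[of "\<zero>\<^bsub>M\<^esub>" "\<zero>\<^bsub>M\<^esub>"] by (simp add: Yc E_def)
  have ds: "direct_sum_of Y (carrier G) (mgr Y) \<and>
      (\<forall>x\<in>carrier Y. \<forall>i\<in>carrier G. hpart Y (carrier G) (mgr Y) x i = p x i)"
  proof (rule Y.direct_sum_of_projections)
    fix y i assume "y \<in> carrier Y" and i: "i \<in> carrier G"
    then obtain x where x: "x \<in> carrier M" "y = q x" by (auto simp: Yc)
    show "p y i \<in> carrier Y" using x i by (simp add: p Yc Mg.hpart_closed)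
    show "p (y \<oplus>\<^bsub>Y\<^esub> z) i = p y i \<oplus>\<^bsub>Y\<^esub> p z i" if "z \<in> carrier Y" for z
      using that x i by (auto simp: p Yc add Mg.hpart_add Mg.hpart_closed)
    show "p (p y i) j = (if i = j then p y i else \<zero>\<^bsub>Y\<^esub>)" if "j \<in> carrier G" for j
      using that x i Mg.hpart_hom[OF i Mg.hpart_in[OF x(1) i] that]
      by (simp add: p Mg.hpart_closed Yc)
  next
    fix y assume "y \<in> carrier Y"
    then obtain x where x: "x \<in> carrier M" "y = q x" by (auto simp: Yc)
    have "{i \<in> carrier G. p y i \<noteq> \<zero>\<^bsub>Y\<^esub>} \<subseteq> hsupp M (carrier G) (mgr M) x"
      using x by (auto simp: p hsupp_def Yc)
    then show "finite {i \<in> carrier G. p y i \<noteq> \<zero>\<^bsub>Y\<^esub>}"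
      using Mg.finite_hsupp[OF x(1)] finite_subset by blast
    show "y = \<zero>\<^bsub>Y\<^esub>" if "\<And>i. i \<in> carrier G \<Longrightarrow> p y i = \<zero>\<^bsub>Y\<^esub>"
    proof -
      have "x \<in> N"
        by (rule Mg.closed_of_hparts) (use that x NS p q0 Mg.hpart_closed in auto)
      then show ?thesis using x q0 by simp
    qed
  next
    fix i assume i: "i \<in> carrier G"
    show "mgr Y i = {y \<in> carrier Y. p y i = y}"
    proof (intro equalityI subsetI)
      fix y assume "y \<in> mgr Y i"
      then obtain x where "x \<in> mgr M i" "y = q x" by (auto simp: Yc)
      then show "y \<in> {y \<in> carrier Y. p y i = y}"
        using i Mg.hpart_hom[of i x i] Mg.C_closed[OF i] by (simp add: Yc p)
    next
      fix y assume "y \<in> {y \<in> carrier Y. p y i = y}"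
      then obtain x where "x \<in> carrier M" "y = q (Mg.hp x i)" using i by (auto simp: Yc p)
      then show "y \<in> mgr Y i" using i Mg.hpart_in by (simp add: Yc)
    qed
  qed
  show thesis
  proof
    show "graded_module G A Y"
      unfolding graded_module_def
    proof (intro conjI ballI)
      fix k l x a assume "k \<in> carrier G" "l \<in> carrier G" "x \<in> mgr Y k" "a \<in> agr A l"
      then show "x \<cdot>\<^bsub>Y\<^esub> a \<in> mgr Y (k \<otimes>\<^bsub>G\<^esub> l)"
        using act_deg Mg.C_closed Ag.C_closed by (force simp: Yc act)
    qed (use rm ds in blast)+
    show "ghom G A M Y q"
      by (rule ghomI) (auto simp: Yc add act)
    show "q ` carrier M = carrier Y" by (simp add: Yc)
  qed (rule q0)
qed

section \<open>Category laws and a criterion for equivalences\<close>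

locale category =
  fixes C :: "('o, 'h) cat"
  assumes id_hom: "X \<in> Ob C \<Longrightarrow> Idm C X \<in> Hom C X X"
    and comp_hom: "\<lbrakk>X \<in> Ob C; Y \<in> Ob C; Z \<in> Ob C; u \<in> Hom C X Y; v \<in> Hom C Y Z\<rbrakk> \<Longrightarrow>
      Cmp C X Y Z v u \<in> Hom C X Z"
    and id_right: "\<lbrakk>X \<in> Ob C; Y \<in> Ob C; u \<in> Hom C X Y\<rbrakk> \<Longrightarrow> Cmp C X X Y u (Idm C X) = u"
    and id_left: "\<lbrakk>X \<in> Ob C; Y \<in> Ob C; u \<in> Hom C X Y\<rbrakk> \<Longrightarrow> Cmp C X Y Y (Idm C Y) u = u"
    and assoc: "\<lbrakk>W \<in> Ob C; X \<in> Ob C; Y \<in> Ob C; Z \<in> Ob C;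
        u \<in> Hom C W X; v \<in> Hom C X Y; w \<in> Hom C Y Z\<rbrakk> \<Longrightarrow>
      Cmp C W X Z (Cmp C X Y Z w v) u = Cmp C W Y Z w (Cmp C W X Y v u)"

lemma category_full_subcat: "category C \<Longrightarrow> category (full_subcat C P)"
  unfolding category_def full_subcat_def by simp

lemma (in graded_ring) category_Gr: "category (Gr G A :: (('a, 'm, 'g) gr_module, 'm \<Rightarrow> 'm) cat)"
proof
  let ?C = "Gr G A :: (('a, 'm, 'g) gr_module, 'm \<Rightarrow> 'm) cat"
  fix X :: "('a, 'm, 'g) gr_module" assume "X \<in> Ob ?C"
  then interpret X: graded_mod G A X by unfold_locales (simp add: Gr_def)
  show "Idm ?C X \<in> Hom ?C X X"
    using X.Mg.C_closed by (auto simp: Gr_def gr_hom_iff ghom_def)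
  fix Y assume "Y \<in> Ob ?C"
  show "Cmp ?C X X Y u (Idm ?C X) = u" "Cmp ?C X Y Y (Idm ?C Y) u = u" if "u \<in> Hom ?C X Y" for u
    using that by (auto simp: Gr_def gr_hom_def compose_def PiE_def extensional_def intro!: ext)
  fix Z u v assume "Z \<in> Ob ?C" "u \<in> Hom ?C X Y" "v \<in> Hom ?C Y Z"
  then have u: "ghom G A X Y u" and v: "ghom G A Y Z v" by (simp_all add: Gr_def gr_hom_iff)
  show "Cmp ?C X Y Z v u \<in> Hom ?C X Z"
    using X.Mg.C_closed
    by (auto simp: Gr_def gr_hom_iff compose_def intro!: ghomI ghomD[OF u] ghomD[OF v])
      (auto simp: ghomD[OF u] ghomD[OF v])
next
  let ?C = "Gr G A :: (('a, 'm, 'g) gr_module, 'm \<Rightarrow> 'm) cat"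
  fix W X Y Z u v w
  assume "u \<in> Hom ?C W X" "v \<in> Hom ?C X Y" "w \<in> Hom ?C Y Z"
  then show "Cmp ?C W X Z (Cmp ?C X Y Z w v) u = Cmp ?C W Y Z w (Cmp ?C W X Y v u)"
    by (auto simp: Gr_def compose_def gr_hom_def intro!: ext)
qed

text \<open>A quasi-inverse is built by choice: \<open>K V\<close> is an object whose image is
  isomorphic to \<open>V\<close> by \<open>e V\<close>, with inverse \<open>e' V\<close>, and
  \<open>Km\<close> lifts through fullness the conjugate of a morphism by these isomorphisms.
  Faithfulness then reduces functoriality of \<open>K\<close> to identities in
  \<open>D\<close>.\<close>

lemma is_equivalence_of_full_faithful:
  assumes C: "category C" and D: "category D" and F: "is_functor C D F Fm"
    and full: "\<And>X Y w. \<lbrakk>X \<in> Ob C; Y \<in> Ob C; w \<in> Hom D (F X) (F Y)\<rbrakk> \<Longrightarrow>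
      \<exists>u\<in>Hom C X Y. Fm X Y u = w"
    and faithful: "\<And>X Y u v. \<lbrakk>X \<in> Ob C; Y \<in> Ob C; u \<in> Hom C X Y; v \<in> Hom C X Y;
      Fm X Y u = Fm X Y v\<rbrakk> \<Longrightarrow> u = v"
    and ess: "\<And>V. V \<in> Ob D \<Longrightarrow> \<exists>X\<in>Ob C. isomorphic D (F X) V"
  shows "is_equivalence C D F Fm"
proof -
  interpret C: category C by fact
  interpret D: category D by fact
  have FO: "F X \<in> Ob D" if "X \<in> Ob C" for X using F that by (simp add: is_functor_def)
  have FH: "Fm X Y u \<in> Hom D (F X) (F Y)" if "X \<in> Ob C" "Y \<in> Ob C" "u \<in> Hom C X Y" for X Y u
    using F that by (simp add: is_functor_def)
  have FI: "Fm X X (Idm C X) = Idm D (F X)" if "X \<in> Ob C" for X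
    using F that by (simp add: is_functor_def)
  have FC: "Fm X Z (Cmp C X Y Z v u) = Cmp D (F X) (F Y) (F Z) (Fm Y Z v) (Fm X Y u)"
    if "X \<in> Ob C" "Y \<in> Ob C" "Z \<in> Ob C" "u \<in> Hom C X Y" "v \<in> Hom C Y Z" for X Y Z u v
    using F that by (simp add: is_functor_def)
  have "\<exists>k e e'. k \<in> Ob C \<and> e \<in> Hom D (F k) V \<and> e' \<in> Hom D V (F k) \<and>
      Cmp D (F k) V (F k) e' e = Idm D (F k) \<and> Cmp D V (F k) V e e' = Idm D V"
    if "V \<in> Ob D" for V
    using ess[OF that] unfolding isomorphic_def is_iso_def by blast
  then obtain K e e' where
    K: "\<And>V. V \<in> Ob D \<Longrightarrow> K V \<in> Ob C" and
    e: "\<And>V. V \<in> Ob D \<Longrightarrow> e V \<in> Hom D (F (K V)) V" and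
    e': "\<And>V. V \<in> Ob D \<Longrightarrow> e' V \<in> Hom D V (F (K V))" and
    e'e: "\<And>V. V \<in> Ob D \<Longrightarrow> Cmp D (F (K V)) V (F (K V)) (e' V) (e V) = Idm D (F (K V))" and
    ee': "\<And>V. V \<in> Ob D \<Longrightarrow> Cmp D V (F (K V)) V (e V) (e' V) = Idm D V"
    by metis
  note FK = FO[OF K]
  define L where "L X Y w = (SOME u. u \<in> Hom C X Y \<and> Fm X Y u = w)" for X Y w
  have L: "L X Y w \<in> Hom C X Y \<and> Fm X Y (L X Y w) = w"
    if "X \<in> Ob C" "Y \<in> Ob C" "w \<in> Hom D (F X) (F Y)" for X Y w
    unfolding L_def by (rule someI_ex) (use full[OF that] in blast)
  define Km where "Km V W w =
      L (K V) (K W) (Cmp D (F (K V)) W (F (K W)) (e' W) (Cmp D (F (K V)) V W w (e V)))" for V W w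
  have Km: "Km V W w \<in> Hom C (K V) (K W) \<and> Fm (K V) (K W) (Km V W w) =
      Cmp D (F (K V)) W (F (K W)) (e' W) (Cmp D (F (K V)) V W w (e V))"
    if "V \<in> Ob D" "W \<in> Ob D" "w \<in> Hom D V W" for V W w
    unfolding Km_def using that by (intro L K D.comp_hom[of _ W] D.comp_hom[of _ V] FK e e') auto
  \<comment> \<open>\<open>e\<close> is natural by construction of \<open>Km\<close>; all other identities are checked after \<open>F\<close>\<close>
  have nat: "Cmp D (F (K V)) (F (K W)) W (e W) (Fm (K V) (K W) (Km V W w)) =
      Cmp D (F (K V)) V W w (e V)"
    if "V \<in> Ob D" "W \<in> Ob D" "w \<in> Hom D V W" for V W w
  proof -
    have h: "Cmp D (F (K V)) V W w (e V) \<in> Hom D (F (K V)) W"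
      using that by (intro D.comp_hom FK e) auto
    show ?thesis
      using that Km[OF that] h D.assoc[OF FK _ FK _ h e' e] ee' D.id_left[OF FK _ h]
      by simp
  qed
  \<comment> \<open>The inverses \<open>e'\<close> are natural as well; the unit needs this, since
    its image under \<open>F\<close> is \<open>e'\<close>.\<close>
  have nat': "Cmp D V (F (K V)) (F (K W)) (Fm (K V) (K W) (Km V W w)) (e' V) =
      Cmp D V W (F (K W)) (e' W) w"
    if "V \<in> Ob D" "W \<in> Ob D" "w \<in> Hom D V W" for V W w
  proof -
    have h: "Cmp D (F (K V)) V W w (e V) \<in> Hom D (F (K V)) W"
      using that by (intro D.comp_hom FK e) auto
    have "Cmp D V (F (K V)) (F (K W)) (Fm (K V) (K W) (Km V W w)) (e' V) =
        Cmp D V W (F (K W)) (e' W) (Cmp D V (F (K V)) W (Cmp D (F (K V)) V W w (e V)) (e' V))"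
      using that Km[OF that] D.assoc[OF _ FK _ FK e' h e'] by simp
    also have "Cmp D V (F (K V)) W (Cmp D (F (K V)) V W w (e V)) (e' V) = w"
      using that D.assoc[OF _ FK _ _ e' e that(3)] ee' D.id_right by simp
    finally show ?thesis .
  qed
  have KF: "is_functor D C K Km"
    unfolding is_functor_def
  proof (intro conjI ballI)
    show "K V \<in> Ob C" if "V \<in> Ob D" for V using K that .
    show "Km V W w \<in> Hom C (K V) (K W)" if "V \<in> Ob D" "W \<in> Ob D" "w \<in> Hom D V W" for V W w
      using Km that by blast
    show "Km V V (Idm D V) = Idm C (K V)" if V: "V \<in> Ob D" for V
      by (rule faithful[OF K[OF V] K[OF V]])
        (use V Km[OF V V D.id_hom[OF V]] e'e FI K D.id_left[OF FK V e] C.id_hom in simp_all)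
    fix V W X u w
    assume o: "V \<in> Ob D" "W \<in> Ob D" "X \<in> Ob D" and u: "u \<in> Hom D V W" and w: "w \<in> Hom D W X"
    note uw = D.comp_hom[OF o u w]
    have h: "Fm (K V) (K W) (Km V W u) \<in> Hom D (F (K V)) (F (K W))"
      using Km[OF o(1,2) u] FH K o by blast
    have hu: "Cmp D (F (K V)) V W u (e V) \<in> Hom D (F (K V)) W"
      using o u by (intro D.comp_hom FK e) auto
    have hw: "Cmp D (F (K W)) W X w (e W) \<in> Hom D (F (K W)) X"
      using o w by (intro D.comp_hom FK e) auto
    have "Fm (K V) (K X) (Km V X (Cmp D V W X w u)) =
        Cmp D (F (K V)) X (F (K X)) (e' X) (Cmp D (F (K V)) W X w (Cmp D (F (K V)) V W u (e V)))"
      using Km[OF o(1,3) uw] D.assoc[OF FK o(1-3) e u w] o by simp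
    \<comment> \<open>Naturality replaces \<open>u\<close> after \<open>e V\<close> by
      \<open>e W\<close> after the image of \<open>Km V W u\<close>; the factor \<open>w\<close>
      after \<open>e W\<close> that appears then completes, with \<open>e' X\<close>, the image of
      \<open>Km W X w\<close>.\<close>
    also have "\<dots> = Cmp D (F (K V)) X (F (K X)) (e' X)
        (Cmp D (F (K V)) (F (K W)) X (Cmp D (F (K W)) W X w (e W)) (Fm (K V) (K W) (Km V W u)))"
      using nat[OF o(1,2) u] D.assoc[OF FK FK o(2,3) h e w] o by simp
    also have "\<dots> = Cmp D (F (K V)) (F (K W)) (F (K X)) (Fm (K W) (K X) (Km W X w))
        (Fm (K V) (K W) (Km V W u))"
      using Km[OF o(2,3) w] D.assoc[OF FK FK o(3) FK h hw e'] o by simp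
    also have "\<dots> = Fm (K V) (K X) (Cmp C (K V) (K W) (K X) (Km W X w) (Km V W u))"
      using FC K Km o u w by simp
    finally show "Km V X (Cmp D V W X w u) = Cmp C (K V) (K W) (K X) (Km W X w) (Km V W u)"
      by (intro faithful[OF K[OF o(1)] K[OF o(3)]]) (use o Km uw u w K C.comp_hom in auto)
  qed
  have eps: "is_nat_iso D D (\<lambda>Y. F (K Y)) (\<lambda>X Y u. Fm (K X) (K Y) (Km X Y u))
      (\<lambda>Y. Y) (\<lambda>X Y u. u) e"
    unfolding is_nat_iso_def is_iso_def using e e' e'e ee' nat by blast
  \<comment> \<open>The unit lifts \<open>e'\<close> at \<open>F X\<close> through fullness, and its
    inverse lifts \<open>e\<close> at \<open>F X\<close>.\<close>
  let ?\<eta> = "\<lambda>X. L X (K (F X)) (e' (F X))" and ?\<eta>' = "\<lambda>X. L (K (F X)) X (e (F X))"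
  have h1: "?\<eta> X \<in> Hom C X (K (F X)) \<and> Fm X (K (F X)) (?\<eta> X) = e' (F X)" if "X \<in> Ob C" for X
    using that by (intro L K FO e')
  have h2: "?\<eta>' X \<in> Hom C (K (F X)) X \<and> Fm (K (F X)) X (?\<eta>' X) = e (F X)" if "X \<in> Ob C" for X
    using that by (intro L K FO e)
  have "is_nat_iso C C (\<lambda>X. X) (\<lambda>X Y u. u)
      (\<lambda>X. K (F X)) (\<lambda>X Y u. Km (F X) (F Y) (Fm X Y u)) ?\<eta>"
    unfolding is_nat_iso_def is_iso_def
  proof (intro conjI ballI)
    fix X assume X: "X \<in> Ob C"
    note KX = K[OF FO[OF X]]
    show "?\<eta> X \<in> Hom C X (K (F X))" using h1 X by blast
    have "Cmp C X (K (F X)) X (?\<eta>' X) (?\<eta> X) = Idm C X"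
      by (rule faithful[OF X X])
        (use X KX h1[OF X] h2[OF X] C.comp_hom C.id_hom FC FI ee' FO in auto)
    moreover have "Cmp C (K (F X)) X (K (F X)) (?\<eta> X) (?\<eta>' X) = Idm C (K (F X))"
      by (rule faithful[OF KX KX])
        (use X KX h1[OF X] h2[OF X] C.comp_hom C.id_hom FC FI e'e FO in auto)
    ultimately show "\<exists>v\<in>Hom C (K (F X)) X. Cmp C X (K (F X)) X v (?\<eta> X) = Idm C X \<and>
        Cmp C (K (F X)) X (K (F X)) (?\<eta> X) v = Idm C (K (F X))"
      using h2[OF X] by blast
    fix Y u assume Y: "Y \<in> Ob C" and u: "u \<in> Hom C X Y"
    note KY = K[OF FO[OF Y]] and Ku = Km[OF FO[OF X] FO[OF Y] FH[OF X Y u]]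
    show "Cmp C X Y (K (F Y)) (?\<eta> Y) u =
        Cmp C X (K (F X)) (K (F Y)) (Km (F X) (F Y) (Fm X Y u)) (?\<eta> X)"
    proof (rule faithful[OF X KY])
      show "Fm X (K (F Y)) (Cmp C X Y (K (F Y)) (?\<eta> Y) u) =
          Fm X (K (F Y)) (Cmp C X (K (F X)) (K (F Y)) (Km (F X) (F Y) (Fm X Y u)) (?\<eta> X))"
        using X Y u KX KY h1[OF X] h1[OF Y] Ku FC nat'[OF FO[OF X] FO[OF Y] FH[OF X Y u]] by simp
    qed (use X Y u KX KY h1[OF X] h1[OF Y] Ku C.comp_hom in auto)
  qed
  then show ?thesis unfolding is_equivalence_def using F KF eps by blast
qed

section \<open>Restriction to a subset of the group\<close>

lemma finsum_cong_record:
  assumes "carrier M = carrier N" "add M = add N" "zero M = zero N"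
  shows "finsum M f F = finsum N f F"
  using assms by (simp add: finsum_def finprod_def)

text \<open>Components involve only carrier, addition and zero. Thus they may be moved between
  \<open>A\<close> and its regular module, which are records of different types.\<close>

lemma hpart_cong_record:
  assumes "carrier M = carrier N" "add M = add N" "zero M = zero N"
  shows "hpart M I C x i = hpart N I C x i" "hsupp M I C x = hsupp N I C x"
proof -
  have "decomposition M I C = decomposition N I C"
    by (intro ext) (simp add: decomposition_def assms finsum_cong_record[OF assms])
  then have *: "hpart M I C = hpart N I C" by (simp add: hpart_def fun_eq_iff)
  show "hpart M I C x i = hpart N I C x i" by (simp add: *)
  show "hsupp M I C x = hsupp N I C x" by (simp add: hsupp_def * assms)
qed

context graded_mod
begin

text \<open>This is the action of \<open>mod_restrict\<close>, studied as a biadditive operation on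
  all of \<open>M\<close> and \<open>A\<close>. Applied to the regular module it is also the
  multiplication of \<open>A_U\<close>, so both truncated products are treated at once.\<close>

definition sact :: "'g set \<Rightarrow> 'm \<Rightarrow> 'a \<Rightarrow> 'm" where
  "sact S x a = finsum M (\<lambda>(s, u). Mg.hp x s \<cdot>\<^bsub>M\<^esub> Ag.hp a u)
     {(s, u). s \<in> hsupp M (carrier G) (mgr M) x \<and> u \<in> hsupp A (carrier G) (agr A) a \<and>
        s \<otimes>\<^bsub>G\<^esub> u \<in> S}"

text \<open>The index set in the definition varies with the supports of the arguments. Additivity
  compares three such sums, which are first padded with zero terms to a common index set.\<close>

lemma sact_superset:
  assumes "x \<in> carrier M" "a \<in> carrier A" "finite E" "finite F" "E \<subseteq> carrier G" "F \<subseteq> carrier G"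
    and "hsupp M (carrier G) (mgr M) x \<subseteq> E" "hsupp A (carrier G) (agr A) a \<subseteq> F"
  shows "sact S x a = finsum M (\<lambda>(s, u). Mg.hp x s \<cdot>\<^bsub>M\<^esub> Ag.hp a u) {(s, u) \<in> E \<times> F. s \<otimes>\<^bsub>G\<^esub> u \<in> S}"
  unfolding sact_def
proof (rule M.add.finprod_mono_neutral_cong_left)
  show "finite {(s, u) \<in> E \<times> F. s \<otimes>\<^bsub>G\<^esub> u \<in> S}"
    using assms(3,4) by (auto intro: finite_subset[of _ "E \<times> F"])
  show "(\<lambda>(s, u). Mg.hp x s \<cdot>\<^bsub>M\<^esub> Ag.hp a u) \<in> {(s, u) \<in> E \<times> F. s \<otimes>\<^bsub>G\<^esub> u \<in> S} \<rightarrow> carrier M"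
    using assms Mg.hpart_closed Ag.hpart_closed by (auto simp: subset_iff)
next
  fix i
  assume "i \<in> {(s, u) \<in> E \<times> F. s \<otimes>\<^bsub>G\<^esub> u \<in> S} - {(s, u). s \<in> hsupp M (carrier G) (mgr M) x \<and>
      u \<in> hsupp A (carrier G) (agr A) a \<and> s \<otimes>\<^bsub>G\<^esub> u \<in> S}"
  then obtain s u where i: "i = (s, u)" "s \<in> carrier G" "u \<in> carrier G"
      "Mg.hp x s = \<zero>\<^bsub>M\<^esub> \<or> Ag.hp a u = \<zero>\<^bsub>A\<^esub>"
    using assms(5,6) by (auto simp: hsupp_def)
  then show "(case i of (s, u) \<Rightarrow> Mg.hp x s \<cdot>\<^bsub>M\<^esub> Ag.hp a u) = \<zero>\<^bsub>M\<^esub>"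
    using Mg.hpart_closed[OF assms(1)] Ag.hpart_closed[OF assms(2)] by auto
qed (use assms in auto)

lemma sact_closed: "x \<in> carrier M \<Longrightarrow> a \<in> carrier A \<Longrightarrow> sact S x a \<in> carrier M"
  unfolding sact_def
  by (intro M.finsum_closed) (auto simp: hsupp_def Mg.hpart_closed Ag.hpart_closed)

lemma sact_add_left:
  assumes "x \<in> carrier M" "y \<in> carrier M" "a \<in> carrier A"
  shows "sact S (x \<oplus>\<^bsub>M\<^esub> y) a = sact S x a \<oplus>\<^bsub>M\<^esub> sact S y a"
proof -
  let ?E = "hsupp M (carrier G) (mgr M) x \<union> hsupp M (carrier G) (mgr M) y \<union>
    hsupp M (carrier G) (mgr M) (x \<oplus>\<^bsub>M\<^esub> y)"
  let ?F = "hsupp A (carrier G) (agr A) a"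
  let ?X = "{(s, u) \<in> ?E \<times> ?F. s \<otimes>\<^bsub>G\<^esub> u \<in> S}"
  have E: "finite ?E" "?E \<subseteq> carrier G" "finite ?F" "?F \<subseteq> carrier G"
    using Mg.finite_hsupp Ag.finite_hsupp assms by (auto simp: hsupp_def[of _ "carrier G"])
  have s: "sact S z a = finsum M (\<lambda>(s, u). Mg.hp z s \<cdot>\<^bsub>M\<^esub> Ag.hp a u) ?X"
    if "z \<in> {x, y, x \<oplus>\<^bsub>M\<^esub> y}" for z
    by (rule sact_superset) (use that assms E in auto)
  have "finsum M (\<lambda>(s, u). Mg.hp (x \<oplus>\<^bsub>M\<^esub> y) s \<cdot>\<^bsub>M\<^esub> Ag.hp a u) ?X =
      (\<Oplus>\<^bsub>M\<^esub>i \<in> ?X. (case i of (s, u) \<Rightarrow> Mg.hp x s \<cdot>\<^bsub>M\<^esub> Ag.hp a u) \<oplus>\<^bsub>M\<^esub>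
        (case i of (s, u) \<Rightarrow> Mg.hp y s \<cdot>\<^bsub>M\<^esub> Ag.hp a u))"
    using E assms by (intro M.add.finprod_cong')
      (auto simp: subset_iff Mg.hpart_add Mg.hpart_closed Ag.hpart_closed act_add_left)
  also have "\<dots> = finsum M (\<lambda>(s, u). Mg.hp x s \<cdot>\<^bsub>M\<^esub> Ag.hp a u) ?X \<oplus>\<^bsub>M\<^esub>
      finsum M (\<lambda>(s, u). Mg.hp y s \<cdot>\<^bsub>M\<^esub> Ag.hp a u) ?X"
    using E assms by (intro M.finsum_addf) (auto simp: subset_iff Mg.hpart_closed Ag.hpart_closed)
  finally show ?thesis by (simp add: s)
qed

lemma sact_add_right:
  assumes "x \<in> carrier M" "a \<in> carrier A" "b \<in> carrier A"
  shows "sact S x (a \<oplus>\<^bsub>A\<^esub> b) = sact S x a \<oplus>\<^bsub>M\<^esub> sact S x b"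
proof -
  let ?E = "hsupp M (carrier G) (mgr M) x"
  let ?F = "hsupp A (carrier G) (agr A) a \<union> hsupp A (carrier G) (agr A) b \<union>
    hsupp A (carrier G) (agr A) (a \<oplus>\<^bsub>A\<^esub> b)"
  let ?X = "{(s, u) \<in> ?E \<times> ?F. s \<otimes>\<^bsub>G\<^esub> u \<in> S}"
  have E: "finite ?E" "?E \<subseteq> carrier G" "finite ?F" "?F \<subseteq> carrier G"
    using Mg.finite_hsupp Ag.finite_hsupp assms by (auto simp: hsupp_def[of _ "carrier G"])
  have s: "sact S x c = finsum M (\<lambda>(s, u). Mg.hp x s \<cdot>\<^bsub>M\<^esub> Ag.hp c u) ?X"
    if "c \<in> {a, b, a \<oplus>\<^bsub>A\<^esub> b}" for c
    by (rule sact_superset) (use that assms E in auto)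
  have "finsum M (\<lambda>(s, u). Mg.hp x s \<cdot>\<^bsub>M\<^esub> Ag.hp (a \<oplus>\<^bsub>A\<^esub> b) u) ?X =
      (\<Oplus>\<^bsub>M\<^esub>i \<in> ?X. (case i of (s, u) \<Rightarrow> Mg.hp x s \<cdot>\<^bsub>M\<^esub> Ag.hp a u) \<oplus>\<^bsub>M\<^esub>
        (case i of (s, u) \<Rightarrow> Mg.hp x s \<cdot>\<^bsub>M\<^esub> Ag.hp b u))"
    using E assms by (intro M.add.finprod_cong')
      (auto simp: subset_iff Ag.hpart_add Mg.hpart_closed Ag.hpart_closed act_add_right)
  also have "\<dots> = finsum M (\<lambda>(s, u). Mg.hp x s \<cdot>\<^bsub>M\<^esub> Ag.hp a u) ?X \<oplus>\<^bsub>M\<^esub>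
      finsum M (\<lambda>(s, u). Mg.hp x s \<cdot>\<^bsub>M\<^esub> Ag.hp b u) ?X"
    using E assms by (intro M.finsum_addf) (auto simp: subset_iff Mg.hpart_closed Ag.hpart_closed)
  finally show ?thesis by (simp add: s)
qed

lemma sact_hom:
  assumes "s \<in> carrier G" "u \<in> carrier G" "x \<in> mgr M s" "a \<in> agr A u"
  shows "sact S x a = (if s \<otimes>\<^bsub>G\<^esub> u \<in> S then x \<cdot>\<^bsub>M\<^esub> a else \<zero>\<^bsub>M\<^esub>)"
proof -
  have c: "x \<in> carrier M" "a \<in> carrier A" using assms Mg.C_closed Ag.C_closed by auto
  have "sact S x a = finsum M (\<lambda>(t, v). Mg.hp x t \<cdot>\<^bsub>M\<^esub> Ag.hp a v)
      {(t, v) \<in> {s} \<times> {u}. t \<otimes>\<^bsub>G\<^esub> v \<in> S}"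
    using assms c by (intro sact_superset) (auto simp: hsupp_def Mg.hpart_hom Ag.hpart_hom split: if_splits)
  also have "{(t, v) \<in> {s} \<times> {u}. t \<otimes>\<^bsub>G\<^esub> v \<in> S} = (if s \<otimes>\<^bsub>G\<^esub> u \<in> S then {(s, u)} else {})"
    by auto
  finally show ?thesis
    using assms c M.finsum_insert[of "{}" "(s, u)" "\<lambda>(t, v). Mg.hp x t \<cdot>\<^bsub>M\<^esub> Ag.hp a v"]
    by (auto simp: Mg.hpart_hom Ag.hpart_hom)
qed

lemma sact_zero_left: "a \<in> carrier A \<Longrightarrow> sact S \<zero>\<^bsub>M\<^esub> a = \<zero>\<^bsub>M\<^esub>"
  using sact_add_left[of "\<zero>\<^bsub>M\<^esub>" "\<zero>\<^bsub>M\<^esub>" a S] sact_closed[of "\<zero>\<^bsub>M\<^esub>" a S]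
  by (simp add: M.add.l_cancel_one)

lemma sact_zero_right: "x \<in> carrier M \<Longrightarrow> sact S x \<zero>\<^bsub>A\<^esub> = \<zero>\<^bsub>M\<^esub>"
  using sact_add_right[of x "\<zero>\<^bsub>A\<^esub>" "\<zero>\<^bsub>A\<^esub>" S] sact_closed[of x "\<zero>\<^bsub>A\<^esub>" S]
  by (simp add: M.add.l_cancel_one)

end

context graded_group
begin

definition part :: "'i set \<Rightarrow> 'a set" where
  "part J = {x \<in> carrier M. hsupp M I C x \<subseteq> J}"

lemma part_iff: "x \<in> part J \<longleftrightarrow> x \<in> carrier M \<and> (\<forall>i\<in>I - J. hp x i = \<zero>)"
  by (auto simp: part_def hsupp_def)

lemma part_zero: "\<zero> \<in> part J"
  by (simp add: part_iff hpart_zero)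

lemma part_add: "x \<in> part J \<Longrightarrow> y \<in> part J \<Longrightarrow> x \<oplus> y \<in> part J"
  by (simp add: part_iff hpart_add)

lemma part_minus: "x \<in> part J \<Longrightarrow> \<ominus> x \<in> part J"
  using minus_equality[of \<zero> \<zero>] by (simp add: part_iff hpart_minus)

lemma part_closed: "x \<in> part J \<Longrightarrow> x \<in> carrier M"
  by (simp add: part_iff)

lemma part_hom: "i \<in> I \<Longrightarrow> i \<in> J \<Longrightarrow> x \<in> C i \<Longrightarrow> x \<in> part J"
  using C_closed hpart_hom by (auto simp: part_iff)

lemma part_hpart: "x \<in> part J \<Longrightarrow> i \<in> I \<Longrightarrow> hp x i \<in> part J"
  using part_hom[of i J "hp x i"] hpart_in[of x i] part_zero by (cases "i \<in> J") (auto simp: part_iff)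

lemma part_induct [consumes 1, case_names zero add hom]:
  assumes "x \<in> part J" "P \<zero>"
    and "\<And>x y. x \<in> part J \<Longrightarrow> y \<in> part J \<Longrightarrow> P x \<Longrightarrow> P y \<Longrightarrow> P (x \<oplus> y)"
    and "\<And>i x. i \<in> I \<Longrightarrow> i \<in> J \<Longrightarrow> x \<in> C i \<Longrightarrow> P x"
  shows "P x"
proof -
  have "x \<in> {x \<in> part J. P x}"
  proof (rule closed_of_hparts)
    fix i assume i: "i \<in> I" "hp x i \<noteq> \<zero>"
    then have "i \<in> J" using assms(1) by (auto simp: part_iff)
    then show "hp x i \<in> {x \<in> part J. P x}"
      using i assms(1,4) hpart_in part_closed part_hpart by simp
  qed (use assms part_zero part_add part_closed in auto)
  then show ?thesis by simp
qed

text \<open>Components of an element supported in \<open>J\<close> are supported in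
  \<open>J\<close>, so the old projections split the part as well. This grades \<open>A_U\<close>,
  \<open>M_S\<close> and, with \<open>J\<close> the whole index set, the regular module.\<close>

lemma direct_sum_of_part:
  assumes N: "abelian_group N" "carrier N = part J" "add N = add M" "zero N = zero M"
    and D: "\<And>i. i \<in> I \<Longrightarrow> D i = (if i \<in> J then C i else {\<zero>})"
  shows "direct_sum_of N I D \<and> (\<forall>x\<in>carrier N. \<forall>i\<in>I. hpart N I D x i = hp x i)"
proof -
  interpret N: abelian_group N by fact
  show ?thesis
  proof (rule N.direct_sum_of_projections)
    fix x i assume x: "x \<in> carrier N" and i: "i \<in> I"
    show "hp x i \<in> carrier N" using x i part_hpart by (simp add: N)
    show "hp (x \<oplus>\<^bsub>N\<^esub> y) i = hp x i \<oplus>\<^bsub>N\<^esub> hp y i" if "y \<in> carrier N" for y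
      using x i that part_closed by (simp add: N hpart_add)
    show "hp (hp x i) j = (if i = j then hp x i else \<zero>\<^bsub>N\<^esub>)" if "j \<in> I" for j
      using x i that part_closed hpart_hom[of i "hp x i" j] hpart_in[of x i] by (auto simp: N)
  next
    fix x assume x: "x \<in> carrier N"
    show "finite {i \<in> I. hp x i \<noteq> \<zero>\<^bsub>N\<^esub>}"
      using x finite_hsupp[of x] part_closed by (simp add: N hsupp_def)
    show "x = \<zero>\<^bsub>N\<^esub>" if "\<And>i. i \<in> I \<Longrightarrow> hp x i = \<zero>\<^bsub>N\<^esub>"
      using x that hpart_inject[of x \<zero>] part_closed by (simp add: N hpart_zero)
  next
    fix i assume i: "i \<in> I"
    show "D i = {x \<in> carrier N. hp x i = x}"
    proof (cases "i \<in> J")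
      case True
      then show ?thesis
        using i D part_hom part_closed hpart_hom[of i _ i] hpart_in[of _ i] by (force simp: N)
    next
      case False
      then show ?thesis using i D part_zero hpart_zero by (auto simp: N part_iff)
    qed
  qed
qed

end

text \<open>\<open>A\<close> as a right module over itself; the product of \<open>A_U\<close>
  becomes a truncated action, and what is proved for modules carries over to the algebra.\<close>

definition regular_module :: "('k, 'a, 'g) gr_algebra \<Rightarrow> ('a, 'a, 'g) gr_module" where
  "regular_module A = \<lparr>carrier = carrier A, mult = mult A, one = one A, zero = zero A, add = add A,
     ract = mult A, mgr = agr A\<rparr>"

lemma regular_module_simps [simp]:
  "carrier (regular_module A) = carrier A" "zero (regular_module A) = zero A"
  "add (regular_module A) = add A" "ract (regular_module A) = mult A" "mgr (regular_module A) = agr A"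
  by (simp_all add: regular_module_def)

lemma (in graded_ring) graded_regular_module: "graded_module G A (regular_module A)"
proof -
  have 1: "abelian_group (regular_module A)"
    by (rule A.sub_abelian_group) auto
  have "direct_sum_of (regular_module A) (carrier G) (mgr (regular_module A)) \<and>
    (\<forall>x\<in>carrier (regular_module A). \<forall>i\<in>carrier G.
      hpart (regular_module A) (carrier G) (mgr (regular_module A)) x i = Ag.hp x i)"
    by (rule Ag.direct_sum_of_part[OF 1, of "carrier G"]) (auto simp: Ag.part_iff)
  then show ?thesis
    using 1 mult_deg
    by (simp add: graded_module_def right_module_def A.l_distr A.r_distr A.m_assoc)
qed

lemma alg_restrict_simps:
  "zero (alg_restrict G U A) = zero A" "add (alg_restrict G U A) = add A"
  "one (alg_restrict G U A) = one A" "agr (alg_restrict G U A) u = (if u \<in> U then agr A u else {\<zero>\<^bsub>A\<^esub>})"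
  by (simp_all add: alg_restrict_def)

lemma mod_restrict_simps:
  "zero (mod_restrict G S A M) = zero M" "add (mod_restrict G S A M) = add M"
  "mgr (mod_restrict G S A M) t = (if t \<in> S then mgr M t else {\<zero>\<^bsub>M\<^esub>})"
  by (simp_all add: mod_restrict_def)

lemma (in graded_mod) mod_restrict_carrier: "carrier (mod_restrict G S A M) = Mg.part S"
  by (simp add: mod_restrict_def Mg.part_def)

lemma (in graded_mod) mod_restrict_ract: "ract (mod_restrict G S A M) = sact S"
  by (simp add: mod_restrict_def sact_def fun_eq_iff)

section \<open>The multiplication of the restricted algebra\<close>

context graded_ring
begin

interpretation R: graded_mod G A "regular_module A"
  using graded_regular_module by unfold_locales

abbreviation "restr U \<equiv> alg_restrict G U A"

lemma alg_restrict_carrier: "carrier (restr U) = Ag.part U"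
  by (simp add: alg_restrict_def Ag.part_def)

lemma alg_restrict_mult: "mult (restr U) = R.sact U"
proof -
  have eq: "carrier (regular_module A) = carrier A" "add (regular_module A) = add A"
    "zero (regular_module A) = zero A" by simp_all
  show ?thesis
    by (simp add: alg_restrict_def R.sact_def fun_eq_iff hpart_cong_record[OF eq]
        finsum_cong_record[OF eq])
qed

lemma alg_restrict_mult_closed: "a \<in> carrier A \<Longrightarrow> b \<in> carrier A \<Longrightarrow> a \<otimes>\<^bsub>restr U\<^esub> b \<in> carrier A"
  using R.sact_closed by (simp add: alg_restrict_mult)

lemma alg_restrict_mult_add_left: "\<lbrakk>a \<in> carrier A; b \<in> carrier A; c \<in> carrier A\<rbrakk> \<Longrightarrow>
    (a \<oplus>\<^bsub>A\<^esub> b) \<otimes>\<^bsub>restr U\<^esub> c = a \<otimes>\<^bsub>restr U\<^esub> c \<oplus>\<^bsub>A\<^esub> b \<otimes>\<^bsub>restr U\<^esub> c"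
  using R.sact_add_left by (simp add: alg_restrict_mult)

lemma alg_restrict_mult_add_right: "\<lbrakk>a \<in> carrier A; b \<in> carrier A; c \<in> carrier A\<rbrakk> \<Longrightarrow>
    a \<otimes>\<^bsub>restr U\<^esub> (b \<oplus>\<^bsub>A\<^esub> c) = a \<otimes>\<^bsub>restr U\<^esub> b \<oplus>\<^bsub>A\<^esub> a \<otimes>\<^bsub>restr U\<^esub> c"
  using R.sact_add_right by (simp add: alg_restrict_mult)

lemma alg_restrict_mult_hom: "\<lbrakk>u \<in> carrier G; v \<in> carrier G; a \<in> agr A u; b \<in> agr A v\<rbrakk> \<Longrightarrow>
    a \<otimes>\<^bsub>restr U\<^esub> b = (if u \<otimes>\<^bsub>G\<^esub> v \<in> U then a \<otimes>\<^bsub>A\<^esub> b else \<zero>\<^bsub>A\<^esub>)"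
  using R.sact_hom by (simp add: alg_restrict_mult)

lemma alg_restrict_mult_zero:
  "a \<in> carrier A \<Longrightarrow> a \<otimes>\<^bsub>restr U\<^esub> \<zero>\<^bsub>A\<^esub> = \<zero>\<^bsub>A\<^esub>" "a \<in> carrier A \<Longrightarrow> \<zero>\<^bsub>A\<^esub> \<otimes>\<^bsub>restr U\<^esub> a = \<zero>\<^bsub>A\<^esub>"
  using R.sact_zero_left R.sact_zero_right by (simp_all add: alg_restrict_mult)

end

section \<open>The module \<open>M_S\<close> over \<open>A_U\<close>\<close>

locale modular_mod = graded_mod G A M
  for G :: "('g, 'y) monoid_scheme" and A :: "('k, 'a, 'g) gr_algebra"
    and M :: "('a, 'm, 'g) gr_module" +
  fixes S U :: "'g set"
  assumes right_modular: "right_modular G S U"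
begin

lemma one_U: "\<one>\<^bsub>G\<^esub> \<in> U"
  using right_modular by (auto simp: right_modular_def ring_supporting_def)

lemma modular: "\<lbrakk>s \<in> S; u \<in> U; v \<in> U; s \<otimes>\<^bsub>G\<^esub> u \<otimes>\<^bsub>G\<^esub> v \<in> S\<rbrakk> \<Longrightarrow> s \<otimes>\<^bsub>G\<^esub> u \<in> S \<longleftrightarrow> u \<otimes>\<^bsub>G\<^esub> v \<in> U"
  using right_modular unfolding right_modular_def by blast

lemma sact_part:
  assumes "x \<in> carrier M" "a \<in> carrier A"
  shows "sact S x a \<in> Mg.part S"
  using assms(1)
proof (induction rule: Mg.hom_induct)
  case (hom s x)
  note x = hom
  have xc: "x \<in> carrier M" using x Mg.C_closed by blast
  from assms(2) show ?case
  proof (induction rule: Ag.hom_induct)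
    case (hom u a)
    then show ?case
      using x sact_hom[OF x(1) hom(1) x(2) hom(2)] act_deg[OF x(1) hom(1) x(2) hom(2)]
      by (auto intro: Mg.part_zero Mg.part_hom)
  qed (use xc in \<open>auto simp: sact_zero_right sact_add_right Mg.part_zero Mg.part_add\<close>)
qed (use assms in \<open>auto simp: sact_zero_left sact_add_left Mg.part_zero Mg.part_add\<close>)

text \<open>By additivity the arguments may be taken homogeneous of degrees \<open>s\<close>,
  \<open>u\<close>, \<open>v\<close>. If \<open>suv\<close> lies outside \<open>S\<close>, both
  sides vanish. Otherwise the left side survives when \<open>uv\<close> is in \<open>U\<close>, the
  right side when \<open>su\<close> is in \<open>S\<close>, and modularity says that these
  conditions agree.\<close>

lemma sact_assoc:
  assumes "x \<in> Mg.part S" "a \<in> Ag.part U" "b \<in> Ag.part U"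
  shows "sact S x (a \<otimes>\<^bsub>restr U\<^esub> b) = sact S (sact S x a) b"
  using assms(1)
proof (induction rule: Mg.part_induct)
  case zero
  then show ?case using assms(2,3)
    by (simp add: sact_zero_left Ag.part_closed alg_restrict_mult_closed)
next
  case (add x y)
  then show ?case using assms(2,3)
    by (simp add: sact_add_left sact_closed Ag.part_closed Mg.part_closed alg_restrict_mult_closed)
next
  case (hom s x)
  note x = hom
  have xc: "x \<in> carrier M" using x Mg.C_closed by blast
  from assms(2) show ?case
  proof (induction rule: Ag.part_induct)
    case zero
    then show ?case using xc assms(3)
      by (simp add: sact_zero_left sact_zero_right Ag.part_closed alg_restrict_mult_zero)
  next
    case (add a a')
    then show ?case using xc assms(3)
      by (simp add: sact_add_left sact_add_right sact_closed Ag.part_closed alg_restrict_mult_add_left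
          alg_restrict_mult_closed)
  next
    case (hom u a)
    note a = hom
    have ac: "a \<in> carrier A" using a Ag.C_closed by blast
    from assms(3) show ?case
    proof (induction rule: Ag.part_induct)
      case zero
      then show ?case using xc ac by (simp add: sact_zero_right alg_restrict_mult_zero sact_closed)
    next
      case (add b b')
      then show ?case using xc ac
        by (simp add: sact_add_right sact_closed Ag.part_closed alg_restrict_mult_add_right
            alg_restrict_mult_closed)
    next
      case (hom v b)
      note b = hom
      have bc: "b \<in> carrier A" using b Ag.C_closed by blast
      have su: "s \<otimes>\<^bsub>G\<^esub> u \<in> carrier G" and uv: "u \<otimes>\<^bsub>G\<^esub> v \<in> carrier G" using x a b by auto
      note xa = act_deg[OF x(1) a(1) x(3) a(3)] and ab = mult_deg[OF a(1) b(1) a(3) b(3)]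
      have "sact S x (a \<otimes>\<^bsub>restr U\<^esub> b) =
          (if u \<otimes>\<^bsub>G\<^esub> v \<in> U \<and> s \<otimes>\<^bsub>G\<^esub> u \<otimes>\<^bsub>G\<^esub> v \<in> S then x \<cdot>\<^bsub>M\<^esub> a \<cdot>\<^bsub>M\<^esub> b else \<zero>\<^bsub>M\<^esub>)"
        using sact_hom[OF x(1) uv x(3) ab] xc ac bc x(1) a(1) b(1)
        by (simp add: alg_restrict_mult_hom[OF a(1) b(1) a(3) b(3)] sact_zero_right act_mult G.m_assoc)
      moreover have "sact S (sact S x a) b =
          (if s \<otimes>\<^bsub>G\<^esub> u \<in> S \<and> s \<otimes>\<^bsub>G\<^esub> u \<otimes>\<^bsub>G\<^esub> v \<in> S then x \<cdot>\<^bsub>M\<^esub> a \<cdot>\<^bsub>M\<^esub> b else \<zero>\<^bsub>M\<^esub>)"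
        using sact_hom[OF su b(1) xa b(3)] bc
        by (simp add: sact_hom[OF x(1) a(1) x(3) a(3)] sact_zero_left)
      ultimately show ?case using modular[OF x(2) a(2) b(2)] by auto
    qed
  qed
qed

lemma sact_one:
  assumes "x \<in> Mg.part S" shows "sact S x \<one>\<^bsub>A\<^esub> = x"
  using assms
proof (induction rule: Mg.part_induct)
  case (hom s x)
  then show ?case using sact_hom[OF hom(1) G.one_closed hom(3) one_deg] Mg.C_closed by simp
qed (auto simp: sact_zero_left sact_add_left Mg.part_closed)

abbreviation "MS \<equiv> mod_restrict G S A M"

lemma MS_simps: "carrier MS = Mg.part S" "zero MS = zero M" "add MS = add M" "ract MS = sact S"
  by (simp_all add: mod_restrict_carrier mod_restrict_ract mod_restrict_simps)

lemma mod_restrict_right_module: "right_module (restr U) MS"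
proof -
  have "abelian_group MS"
    by (rule M.sub_abelian_group)
      (auto simp: MS_simps Mg.part_zero Mg.part_add Mg.part_minus Mg.part_closed)
  then show ?thesis
    by (simp add: right_module_def MS_simps alg_restrict_simps alg_restrict_carrier sact_part
        Mg.part_closed Ag.part_closed sact_add_left sact_add_right sact_assoc sact_one)
qed

lemma mod_restrict_graded_module: "graded_module G (restr U) MS"
  and mod_restrict_hpart: "\<And>x t. x \<in> Mg.part S \<Longrightarrow> t \<in> carrier G \<Longrightarrow>
    hpart MS (carrier G) (mgr MS) x t = Mg.hp x t"
proof -
  have ab: "abelian_group MS" using mod_restrict_right_module by (simp add: right_module_def)
  have ds: "direct_sum_of MS (carrier G) (mgr MS) \<and>
      (\<forall>x\<in>carrier MS. \<forall>i\<in>carrier G. hpart MS (carrier G) (mgr MS) x i = Mg.hp x i)"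
    by (rule Mg.direct_sum_of_part[OF ab]) (simp_all add: MS_simps mod_restrict_simps)
  show "hpart MS (carrier G) (mgr MS) x t = Mg.hp x t" if "x \<in> Mg.part S" "t \<in> carrier G" for x t
    using ds that by (simp add: MS_simps)
  have "x \<cdot>\<^bsub>MS\<^esub> a \<in> mgr MS (s \<otimes>\<^bsub>G\<^esub> u)"
    if st: "s \<in> carrier G" "u \<in> carrier G" and xa: "x \<in> mgr MS s" "a \<in> agr (restr U) u" for s u x a
  proof -
    have "x \<in> mgr M s" "a \<in> agr A u"
      using st xa Mg.C_zero Ag.C_zero by (auto simp: mod_restrict_simps alg_restrict_simps split: if_splits)
    then show ?thesis using sact_hom[OF st] act_deg[OF st]
      by (simp add: MS_simps mod_restrict_simps)
  qed
  then show "graded_module G (restr U) MS"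
    using ds mod_restrict_right_module by (simp add: graded_module_def)
qed

end

text \<open>A ring-supporting \<open>U\<close> makes \<open>(U, U)\<close> a right modular pair. The
  module axioms for the restricted regular module then supply closure, associativity and the right
  unit law; the left unit law is checked separately on homogeneous elements.\<close>

lemma (in graded_ring) graded_ring_alg_restrict:
  assumes U: "ring_supporting G U"
  shows "graded_ring G (restr U)"
proof -
  have "right_modular G U U" using U unfolding right_modular_def ring_supporting_def by blast
  then interpret R: modular_mod G A "regular_module A" U U
    using graded_regular_module by unfold_locales
  have p: "R.Mg.part U = Ag.part U"
    using hpart_cong_record(2)[of "regular_module A" A "carrier G" "agr A"]
    unfolding R.Mg.part_def Ag.part_def by simp
  note c = alg_restrict_carrier
  have s: "R.sact U a b = a \<otimes>\<^bsub>restr U\<^esub> b" for a b by (simp add: alg_restrict_mult)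
  have one: "\<one>\<^bsub>A\<^esub> \<in> Ag.part U" using Ag.part_hom[OF _ R.one_U one_deg] by simp
  have lone: "\<one>\<^bsub>A\<^esub> \<otimes>\<^bsub>restr U\<^esub> a = a" if "a \<in> Ag.part U" for a
    using that
  proof (induction rule: Ag.part_induct)
    case (hom u a)
    then show ?case
      using alg_restrict_mult_hom[OF G.one_closed hom(1) one_deg hom(3)] Ag.C_closed by simp
  qed (auto simp: alg_restrict_mult_zero alg_restrict_mult_add_right Ag.part_closed)
  have ab: "abelian_group (restr U)"
    by (rule A.sub_abelian_group)
      (auto simp: c alg_restrict_simps Ag.part_zero Ag.part_add Ag.part_minus Ag.part_closed)
  have ring: "ring (restr U)"
  proof (rule ringI)
    show "monoid (restr U)"
      by (rule monoidI) (use one lone R.sact_part[unfolded p s] R.sact_assoc[unfolded p s] R.sact_one[unfolded p s] in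
          \<open>auto simp: c alg_restrict_simps Ag.part_closed\<close>)
  qed (use ab in \<open>auto simp: c alg_restrict_simps alg_restrict_mult_add_left
      alg_restrict_mult_add_right Ag.part_closed\<close>)
  have ds: "direct_sum_of (restr U) (carrier G) (agr (restr U)) \<and>
    (\<forall>x\<in>carrier (restr U). \<forall>i\<in>carrier G.
      hpart (restr U) (carrier G) (agr (restr U)) x i = Ag.hp x i)"
    by (rule Ag.direct_sum_of_part[OF ab c]) (simp_all add: alg_restrict_simps)
  show ?thesis
  proof (intro graded_ring.intro graded_group.intro graded_group_axioms.intro graded_ring_axioms.intro)
    show "\<one>\<^bsub>restr U\<^esub> \<in> agr (restr U) \<one>\<^bsub>G\<^esub>" using R.one_U one_deg by (simp add: alg_restrict_simps)
    fix s t a b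
    assume st: "s \<in> carrier G" "t \<in> carrier G" and "a \<in> agr (restr U) s" "b \<in> agr (restr U) t"
    then have ab: "a \<in> agr A s" "b \<in> agr A t"
      using Ag.C_zero by (auto simp: alg_restrict_simps split: if_splits)
    show "a \<otimes>\<^bsub>restr U\<^esub> b \<in> agr (restr U) (s \<otimes>\<^bsub>G\<^esub> t)"
      using alg_restrict_mult_hom[OF st ab] mult_deg[OF st ab] by (simp add: alg_restrict_simps)
  qed (use ab ring ds G.is_group in auto)
qed

section \<open>Change of grading along a pseudomorphism\<close>

text \<open>Right multiplication by \<open>l\<close> is a bijection of \<open>G\<close>, so the
  component of degree \<open>t\<close> of \<open>x b\<close> has only one source.\<close>

lemma (in graded_mod) hpart_act:
  assumes "x \<in> carrier M" "l \<in> carrier G" "b \<in> agr A l" "t \<in> carrier G"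
  shows "Mg.hp (x \<cdot>\<^bsub>M\<^esub> b) t = Mg.hp x (t \<otimes>\<^bsub>G\<^esub> inv\<^bsub>G\<^esub> l) \<cdot>\<^bsub>M\<^esub> b"
  using assms(1)
proof (induction rule: Mg.hom_induct)
  case (hom s x)
  have "t = s \<otimes>\<^bsub>G\<^esub> l \<longleftrightarrow> t \<otimes>\<^bsub>G\<^esub> inv\<^bsub>G\<^esub> l = s"
    using assms hom by (auto simp: G.m_assoc)
  then show ?case
    using assms hom Ag.C_closed[of l b]
      Mg.hpart_hom[OF _ act_deg[OF hom(1) assms(2) hom(2) assms(3)] assms(4)]
      Mg.hpart_hom[OF hom, of "t \<otimes>\<^bsub>G\<^esub> inv\<^bsub>G\<^esub> l"]
    by auto
qed (use assms Ag.C_closed[of l b] in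
    \<open>simp_all add: Mg.hpart_zero Mg.hpart_add act_add_left Mg.hpart_closed\<close>)

text \<open>Truncation is the original action followed by the projection onto the degrees in
  \<open>S\<close>. In this form the action on \<open>M_S\<close> can be compared component by
  component, without its double sum.\<close>

lemma (in graded_mod) sact_hpart:
  assumes "x \<in> carrier M" "a \<in> carrier A" "t \<in> carrier G"
  shows "Mg.hp (sact S x a) t = (if t \<in> S then Mg.hp (x \<cdot>\<^bsub>M\<^esub> a) t else \<zero>\<^bsub>M\<^esub>)"
  using assms(1)
proof (induction rule: Mg.hom_induct)
  case (hom s x)
  note x = hom
  have xc: "x \<in> carrier M" using x Mg.C_closed by blast
  from assms(2) show ?case
  proof (induction rule: Ag.hom_induct)
    case (hom u a)
    then show ?case
      using x assms(3) Mg.hpart_hom[OF _ act_deg[OF x(1) hom(1) x(2) hom(2)] assms(3)]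
        sact_hom[OF x(1) hom(1) x(2) hom(2)]
      by (auto simp: Mg.hpart_zero)
  qed (use xc assms(3) in \<open>simp_all add: sact_zero_right sact_add_right sact_closed Mg.hpart_zero
      Mg.hpart_add act_add_right\<close>)
qed (use assms in \<open>simp_all add: sact_zero_left sact_add_left sact_closed Mg.hpart_zero
      Mg.hpart_add act_add_left\<close>)

section \<open>Isomorphisms of graded modules\<close>

lemma isomorphic_GrI:
  assumes "ghom G A X Y u" "ghom G A Y X v"
    and "\<And>x. x \<in> carrier X \<Longrightarrow> v (u x) = x" "\<And>y. y \<in> carrier Y \<Longrightarrow> u (v y) = y"
    and "graded_ring G A" "graded_module G A X" "graded_module G A Y"
  shows "isomorphic (Gr G A) X Y"
proof -
  interpret graded_ring G A by fact
  interpret X: graded_mod G A X by unfold_locales fact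
  interpret Y: graded_mod G A Y by unfold_locales fact
  note u = ghomD[OF assms(1)] and v = ghomD[OF assms(2)]
  have "restrict u (carrier X) \<in> gr_hom G A X Y" "restrict v (carrier Y) \<in> gr_hom G A Y X"
    using u v X.Mg.C_closed Y.Mg.C_closed by (auto simp: gr_hom_iff intro!: ghomI)
  then show ?thesis
    unfolding isomorphic_def is_iso_def Gr_def
    by (intro exI[of _ "restrict u (carrier X)"]) (auto simp: compose_def assms(3,4) u v intro!: ext
        bexI[of _ "restrict v (carrier Y)"])
qed

lemma isomorphic_GrE:
  assumes "isomorphic (Gr G A) X Y"
  obtains u v where "ghom G A X Y u" "ghom G A Y X v"
    "\<And>x. x \<in> carrier X \<Longrightarrow> v (u x) = x" "\<And>y. y \<in> carrier Y \<Longrightarrow> u (v y) = y"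
proof -
  obtain u v where uv: "u \<in> gr_hom G A X Y" "v \<in> gr_hom G A Y X"
    "compose (carrier X) v u = (\<lambda>x\<in>carrier X. x)" "compose (carrier Y) u v = (\<lambda>y\<in>carrier Y. y)"
    using assms by (auto simp: isomorphic_def is_iso_def Gr_def)
  have "v (u x) = x" if "x \<in> carrier X" for x
    using fun_cong[OF uv(3), of x] that by (simp add: compose_def)
  moreover have "u (v y) = y" if "y \<in> carrier Y" for y
    using fun_cong[OF uv(4), of y] that by (simp add: compose_def)
  moreover have "ghom G A X Y u" "ghom G A Y X v" using uv(1,2) by (simp_all add: gr_hom_iff)
  ultimately show thesis using that by metis
qed

lemma ghom_comp:
  assumes "ghom G A X Y u" "ghom G A Y Z v" shows "ghom G A X Z (\<lambda>x. v (u x))"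
  by (rule ghomI) (simp_all add: ghomD[OF assms(1)] ghomD[OF assms(2)])

context graded_ring
begin

lemma isomorphic_Gr_of_bij:
  assumes "graded_module G A X" "graded_module G A Y" "ghom G A X Y u"
    and "inj_on u (carrier X)" "u ` carrier X = carrier Y"
  shows "isomorphic (Gr G A) X Y"
proof -
  interpret X: graded_mod G A X by unfold_locales fact
  interpret Y: graded_mod G A Y by unfold_locales fact
  note u = ghomD[OF assms(3)]
  define v where "v = inv_into (carrier X) u"
  have vu: "v (u x) = x" if "x \<in> carrier X" for x
    using that assms(4) by (simp add: v_def)
  have surj: "\<exists>x\<in>carrier X. y = u x" if "y \<in> carrier Y" for y
    using that assms(5) by blast
  have "ghom G A Y X v"
  proof (rule ghomI)
    show "v x \<in> carrier X" if "x \<in> carrier Y" for x using surj[OF that] vu by auto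
    show "v (x \<oplus>\<^bsub>Y\<^esub> y) = v x \<oplus>\<^bsub>X\<^esub> v y" if "x \<in> carrier Y" "y \<in> carrier Y" for x y
    proof -
      obtain x' y' where "x' \<in> carrier X" "x = u x'" "y' \<in> carrier X" "y = u y'"
        using surj[of x] surj[of y] \<open>x \<in> carrier Y\<close> \<open>y \<in> carrier Y\<close> by blast
      then show ?thesis using vu[of "x' \<oplus>\<^bsub>X\<^esub> y'"] by (simp add: vu u)
    qed
    show "v (x \<cdot>\<^bsub>Y\<^esub> a) = v x \<cdot>\<^bsub>X\<^esub> a" if "x \<in> carrier Y" "a \<in> carrier A" for x a
    proof -
      obtain x' where "x' \<in> carrier X" "x = u x'" using surj[of x] \<open>x \<in> carrier Y\<close> by blast
      then show ?thesis using vu[of "x' \<cdot>\<^bsub>X\<^esub> a"] that by (simp add: vu u)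
    qed
    fix t x assume t: "t \<in> carrier G" "x \<in> mgr Y t"
    then obtain x' where x': "x' \<in> carrier X" "x = u x'" using surj[OF Y.Mg.C_closed[OF t]] by blast
    \<comment> \<open>A homogeneous element is its own component, hence the image of a component of
      its preimage; so the inverse map preserves degrees.\<close>
    have "x = u (X.Mg.hp x' t)"
      using t x' ghom_hpart[OF assms(1-3) x'(1) t(1)] Y.Mg.hpart_hom[OF t t(1)] by simp
    then show "v x \<in> mgr X t" using vu X.Mg.hpart_in[OF x'(1) t(1)] X.Mg.hpart_closed[OF x'(1) t(1)] by simp
  qed
  moreover have "u (v y) = y" if "y \<in> carrier Y" for y using surj[OF that] vu by auto
  ultimately show ?thesis
    by (intro isomorphic_GrI[OF assms(3) _ vu _ graded_ring_axioms assms(1,2)])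
qed

lemma isomorphic_Gr_refl: "graded_module G A X \<Longrightarrow> isomorphic (Gr G A) X X"
  by (rule isomorphic_Gr_of_bij[where u = "\<lambda>x. x"]) (simp_all add: ghom_def)

lemma isomorphic_Gr_sym:
  assumes "isomorphic (Gr G A) X Y" "graded_module G A X" "graded_module G A Y"
  shows "isomorphic (Gr G A) Y X"
  using assms(1) by (rule isomorphic_GrE) (auto intro: isomorphic_GrI assms graded_ring_axioms)

lemma isomorphic_Gr_trans:
  assumes "isomorphic (Gr G A) X Y" "isomorphic (Gr G A) Y Z"
    and "graded_module G A X" "graded_module G A Z"
  shows "isomorphic (Gr G A) X Z"
proof -
  obtain u v where u: "ghom G A X Y u" "ghom G A Y X v"
    "\<And>x. x \<in> carrier X \<Longrightarrow> v (u x) = x" "\<And>y. y \<in> carrier Y \<Longrightarrow> u (v y) = y"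
    using isomorphic_GrE[OF assms(1)] by metis
  obtain u' v' where u': "ghom G A Y Z u'" "ghom G A Z Y v'"
    "\<And>x. x \<in> carrier Y \<Longrightarrow> v' (u' x) = x" "\<And>y. y \<in> carrier Z \<Longrightarrow> u' (v' y) = y"
    using isomorphic_GrE[OF assms(2)] by metis
  show ?thesis
    by (rule isomorphic_GrI[OF ghom_comp[OF u(1) u'(1)] ghom_comp[OF u'(2) u(2)]])
      (use u(3,4) u'(3,4) ghomD(1)[OF u(1)] ghomD(1)[OF u'(2)] assms graded_ring_axioms in auto)
qed

end

section \<open>The setting of the theorem and its degrees\<close>

locale pseudo_graded = graded_ring G A + G': group G'
  for G :: "('g, 'y) monoid_scheme" and A :: "('k, 'a, 'g) gr_algebra"
    and G' :: "('h, 'z) monoid_scheme" +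
  fixes \<phi> :: "'h \<Rightarrow> 'g" and U S :: "'g set" and g :: 'g
  assumes pseudo: "pseudomorphism G' G \<phi>" and U_image: "U = \<phi> ` carrier G'"
    and ring_supp: "ring_supporting G U" and right_modular: "right_modular G S U"
    and g_transporter: "g \<in> transporter G S U"
begin

abbreviation "T \<equiv> transporter G S U"
abbreviation "H' \<equiv> {\<sigma> \<in> carrier G'. \<phi> \<sigma> \<in> transporter G U U}"
abbreviation "B \<equiv> alg_restrict G U A"
abbreviation "Bt \<equiv> alg_tilde \<phi> B"
abbreviation hc :: "('a, 'm, 'g) gr_module \<Rightarrow> 'm \<Rightarrow> 'g \<Rightarrow> 'm" where
  "hc M x t \<equiv> hpart M (carrier G) (mgr M) x t"

lemma S_carrier: "S \<subseteq> carrier G" and U_carrier: "U \<subseteq> carrier G" and one_U: "\<one>\<^bsub>G\<^esub> \<in> U"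
  using right_modular by (auto simp: right_modular_def ring_supporting_def)

text \<open>Left translation by \<open>h\<close> is injective on \<open>G\<close>, so the equality
  of sets defining the transporter turns into an equivalence of memberships. With its converse
  \<open>transporterI\<close> this is the form in which transporters are handled below.\<close>

lemma transporterD:
  assumes "h \<in> transporter G S' U"
  shows "h \<in> carrier G" "\<And>k. k \<in> carrier G \<Longrightarrow> h \<otimes>\<^bsub>G\<^esub> k \<in> S' \<longleftrightarrow> k \<in> U" "h \<in> S'"
proof -
  show h: "h \<in> carrier G" using assms by (simp add: transporter_def)
  have S': "S' = (\<lambda>u. h \<otimes>\<^bsub>G\<^esub> u) ` U" using assms by (auto simp: transporter_def l_coset_def)
  show iff: "h \<otimes>\<^bsub>G\<^esub> k \<in> S' \<longleftrightarrow> k \<in> U" if "k \<in> carrier G" for k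
    using h that U_carrier by (auto simp: S' subset_iff)
  show "h \<in> S'" using iff[of "\<one>\<^bsub>G\<^esub>"] h one_U by simp
qed

lemma transporterI:
  assumes "h \<in> carrier G" "S' \<subseteq> carrier G" "\<And>k. k \<in> carrier G \<Longrightarrow> h \<otimes>\<^bsub>G\<^esub> k \<in> S' \<longleftrightarrow> k \<in> U"
  shows "h \<in> transporter G S' U"
proof -
  have "s \<in> (\<lambda>u. h \<otimes>\<^bsub>G\<^esub> u) ` U" if "s \<in> S'" for s
  proof -
    have s: "s \<in> carrier G" using that assms(2) by auto
    then have "h \<otimes>\<^bsub>G\<^esub> (inv\<^bsub>G\<^esub> h \<otimes>\<^bsub>G\<^esub> s) = s" using assms(1) by (simp flip: G.m_assoc)
    then show ?thesis using that assms(1) s assms(3)[of "inv\<^bsub>G\<^esub> h \<otimes>\<^bsub>G\<^esub> s"] by (metis G.inv_closed G.m_closed imageI)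
  qed
  then show ?thesis using assms U_carrier by (auto simp: transporter_def l_coset_def)
qed

lemma g_carrier: "g \<in> carrier G" and g_mult: "\<And>k. k \<in> carrier G \<Longrightarrow> g \<otimes>\<^bsub>G\<^esub> k \<in> S \<longleftrightarrow> k \<in> U"
  using transporterD[OF g_transporter] by auto

lemma phi_U: "\<sigma> \<in> carrier G' \<Longrightarrow> \<phi> \<sigma> \<in> U" by (simp add: U_image)

lemma phi_closed: "\<sigma> \<in> carrier G' \<Longrightarrow> \<phi> \<sigma> \<in> carrier G" using phi_U U_carrier by blast

lemma phi_inj: "\<sigma> \<in> carrier G' \<Longrightarrow> \<tau> \<in> carrier G' \<Longrightarrow> \<phi> \<sigma> = \<phi> \<tau> \<longleftrightarrow> \<sigma> = \<tau>"
  using pseudo by (auto simp: pseudomorphism_def inj_on_def)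

lemma phi_one: "\<phi> \<one>\<^bsub>G'\<^esub> = \<one>\<^bsub>G\<^esub>" using pseudo by (simp add: pseudomorphism_def)

lemma phi_mult: "\<lbrakk>\<sigma> \<in> carrier G'; \<tau> \<in> carrier G'; \<phi> \<sigma> \<otimes>\<^bsub>G\<^esub> \<phi> \<tau> \<in> U\<rbrakk> \<Longrightarrow>
    \<phi> (\<sigma> \<otimes>\<^bsub>G'\<^esub> \<tau>) = \<phi> \<sigma> \<otimes>\<^bsub>G\<^esub> \<phi> \<tau>"
  using pseudo by (simp add: pseudomorphism_def U_image)

text \<open>The degree in \<open>G\<close> that is relabelled by \<sigma> in
  \<open>mod_tilde\<close>. The map is a bijection from \<open>G'\<close> onto \<open>S\<close> and
  takes \<open>H'\<close> onto \<open>T\<close>.\<close>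

definition shift :: "'h \<Rightarrow> 'g" where "shift \<sigma> = g \<otimes>\<^bsub>G\<^esub> \<phi> \<sigma>"

lemma shift_S: "\<sigma> \<in> carrier G' \<Longrightarrow> shift \<sigma> \<in> S"
  using g_mult phi_U phi_closed by (simp add: shift_def)

lemma shift_closed: "\<sigma> \<in> carrier G' \<Longrightarrow> shift \<sigma> \<in> carrier G"
  using shift_S S_carrier by blast

lemma shift_inj: "\<sigma> \<in> carrier G' \<Longrightarrow> \<tau> \<in> carrier G' \<Longrightarrow> shift \<sigma> = shift \<tau> \<longleftrightarrow> \<sigma> = \<tau>"
  using phi_inj phi_closed g_carrier by (simp add: shift_def)

lemma shift_surj: "s \<in> S \<Longrightarrow> \<exists>\<sigma>\<in>carrier G'. s = shift \<sigma>"
proof -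
  assume s: "s \<in> S"
  then have sc: "s \<in> carrier G" using S_carrier by blast
  have eq: "g \<otimes>\<^bsub>G\<^esub> (inv\<^bsub>G\<^esub> g \<otimes>\<^bsub>G\<^esub> s) = s" using g_carrier sc by (simp flip: G.m_assoc)
  then have "inv\<^bsub>G\<^esub> g \<otimes>\<^bsub>G\<^esub> s \<in> U" using g_mult[of "inv\<^bsub>G\<^esub> g \<otimes>\<^bsub>G\<^esub> s"] s sc g_carrier by simp
  then obtain \<sigma> where "\<sigma> \<in> carrier G'" "inv\<^bsub>G\<^esub> g \<otimes>\<^bsub>G\<^esub> s = \<phi> \<sigma>" by (auto simp: U_image)
  then show ?thesis using eq by (auto simp: shift_def intro!: bexI[of _ \<sigma>])
qed

text \<open>The set \<open>(U : U)\<close> is the stabiliser of \<open>U\<close> under left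
  translation, hence a subgroup of \<open>G\<close>, and it lies in \<open>U\<close> because
  \<open>1\<close> does. So products and inverses of its elements stay in \<open>U\<close>, the
  image of \<phi>, where \<phi> is multiplicative.\<close>

lemma H'_subgroup: "subgroup H' G'"
proof (rule G'.subgroupI)
  show "H' \<noteq> {}" using phi_one transporterI[of "\<one>\<^bsub>G\<^esub>" U] U_carrier by auto
next
  fix \<sigma> assume "\<sigma> \<in> H'"
  then have s: "\<sigma> \<in> carrier G'" and t: "\<phi> \<sigma> \<in> transporter G U U" by auto
  note T = transporterD[OF t]
  \<comment> \<open>Since translation by \<open>\<phi> \<sigma>\<close> takes the inverse of
    \<open>\<phi> \<sigma>\<close> to \<open>1\<close>, which is in \<open>U\<close>, the inverse is
    in \<open>U\<close> too. Its preimage \<rho> turns out to be the inverse of \<sigma>.\<close>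
  have i: "inv\<^bsub>G\<^esub> (\<phi> \<sigma>) \<in> U" using T(2)[of "inv\<^bsub>G\<^esub> (\<phi> \<sigma>)"] T(1) one_U by simp
  then obtain \<rho> where r: "\<rho> \<in> carrier G'" "\<phi> \<rho> = inv\<^bsub>G\<^esub> (\<phi> \<sigma>)" by (auto simp: U_image)
  have "\<phi> (\<sigma> \<otimes>\<^bsub>G'\<^esub> \<rho>) = \<phi> \<one>\<^bsub>G'\<^esub>" using phi_mult[OF s r(1)] r T(1) one_U by (simp add: phi_one)
  then have "\<sigma> \<otimes>\<^bsub>G'\<^esub> \<rho> = \<one>\<^bsub>G'\<^esub>" using phi_inj s r(1) by simp
  then have inv: "inv\<^bsub>G'\<^esub> \<sigma> = \<rho>" using s r(1) G'.inv_equality G'.inv_comm by blast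
  have "inv\<^bsub>G\<^esub> (\<phi> \<sigma>) \<in> transporter G U U"
  proof (rule transporterI)
    show "inv\<^bsub>G\<^esub> (\<phi> \<sigma>) \<otimes>\<^bsub>G\<^esub> k \<in> U \<longleftrightarrow> k \<in> U" if "k \<in> carrier G" for k
      using T(1) T(2)[of "inv\<^bsub>G\<^esub> (\<phi> \<sigma>) \<otimes>\<^bsub>G\<^esub> k"] that by (simp flip: G.m_assoc)
  qed (use T(1) U_carrier in auto)
  then show "inv\<^bsub>G'\<^esub> \<sigma> \<in> H'" using r by (simp add: inv)
next
  fix \<sigma> \<tau> assume "\<sigma> \<in> H'" "\<tau> \<in> H'"
  then have s: "\<sigma> \<in> carrier G'" "\<phi> \<sigma> \<in> transporter G U U"
    and t: "\<tau> \<in> carrier G'" "\<phi> \<tau> \<in> transporter G U U" by auto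
  note T1 = transporterD[OF s(2)] and T2 = transporterD[OF t(2)]
  have "\<phi> \<sigma> \<otimes>\<^bsub>G\<^esub> \<phi> \<tau> \<in> transporter G U U"
  proof (rule transporterI)
    show "\<phi> \<sigma> \<otimes>\<^bsub>G\<^esub> \<phi> \<tau> \<otimes>\<^bsub>G\<^esub> k \<in> U \<longleftrightarrow> k \<in> U" if "k \<in> carrier G" for k
      using that T1(1,2) T2(1,2) by (simp add: G.m_assoc)
  qed (use T1 T2 U_carrier in auto)
  moreover have "\<phi> (\<sigma> \<otimes>\<^bsub>G'\<^esub> \<tau>) = \<phi> \<sigma> \<otimes>\<^bsub>G\<^esub> \<phi> \<tau>" using phi_mult s(1) t(1) T1(2) T2(1,3) by simp
  ultimately show "\<sigma> \<otimes>\<^bsub>G'\<^esub> \<tau> \<in> H'" using s t by simp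
qed auto

lemma H'_carrier: "H' \<subseteq> carrier G'" by auto

lemma T_carrier: "T \<subseteq> carrier G" by (auto simp: transporter_def)

lemma T_S: "T \<subseteq> S" using transporterD(3) by blast

lemma T_shift: "T = shift ` H'"
proof (intro equalityI subsetI)
  fix t assume t: "t \<in> T"
  then obtain \<sigma> where s: "\<sigma> \<in> carrier G'" "t = shift \<sigma>" using shift_surj T_S by blast
  have "\<phi> \<sigma> \<in> transporter G U U"
  proof (rule transporterI)
    show "\<phi> \<sigma> \<otimes>\<^bsub>G\<^esub> k \<in> U \<longleftrightarrow> k \<in> U" if "k \<in> carrier G" for k
      using transporterD(2)[OF t that] g_mult[of "\<phi> \<sigma> \<otimes>\<^bsub>G\<^esub> k"] g_carrier phi_closed s that
      by (simp add: shift_def G.m_assoc)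
  qed (use s phi_closed U_carrier in auto)
  then show "t \<in> shift ` H'" using s by auto
next
  fix t assume "t \<in> shift ` H'"
  then obtain \<sigma> where s: "\<sigma> \<in> carrier G'" "t = shift \<sigma>" "\<phi> \<sigma> \<in> transporter G U U" by auto
  show "t \<in> T"
  proof (rule transporterI)
    show "t \<otimes>\<^bsub>G\<^esub> k \<in> S \<longleftrightarrow> k \<in> U" if "k \<in> carrier G" for k
      using transporterD(2)[OF s(3) that] g_mult[of "\<phi> \<sigma> \<otimes>\<^bsub>G\<^esub> k"] g_carrier phi_closed s that
      by (simp add: shift_def G.m_assoc)
  qed (use s shift_closed S_carrier in auto)
qed

sublocale Bs: graded_ring G B
  by (rule graded_ring_alg_restrict) (rule ring_supp)

lemma alg_tilde_simps:
  "carrier Bt = carrier B" "mult Bt = mult B" "one Bt = one B" "zero Bt = zero B"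
  "add Bt = add B" "agr Bt \<sigma> = agr B (\<phi> \<sigma>)"
  by (simp_all add: alg_tilde_def)

lemma mod_tilde_simps:
  "carrier (mod_tilde G g \<phi> X) = carrier X" "zero (mod_tilde G g \<phi> X) = zero X"
  "add (mod_tilde G g \<phi> X) = add X" "ract (mod_tilde G g \<phi> X) = ract X"
  "mgr (mod_tilde G g \<phi> X) \<sigma> = mgr X (shift \<sigma>)"
  by (simp_all add: mod_tilde_def shift_def)

text \<open>Serves the algebra with \<open>\<phi>\<close> and the modules with \<open>shift\<close>.
  An injective relabelling keeps the projections orthogonal; the support condition keeps them
  jointly injective, as the degrees outside the image carry nothing.\<close>

lemma direct_sum_of_reindex:
  fixes M :: "('m, 'x) ring_scheme" and N :: "('m, 'w) ring_scheme"
  assumes "graded_group M (carrier G) C" "abelian_group N"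
    and N: "carrier N = carrier M" "add N = add M" "zero N = zero M"
    and f: "\<And>\<sigma>. \<sigma> \<in> carrier G' \<Longrightarrow> f \<sigma> \<in> carrier G" "inj_on f (carrier G')"
    and D: "\<And>\<sigma>. \<sigma> \<in> carrier G' \<Longrightarrow> D \<sigma> = C (f \<sigma>)"
    and supp: "\<And>t. t \<in> carrier G - f ` carrier G' \<Longrightarrow> C t \<subseteq> {\<zero>\<^bsub>M\<^esub>}"
  shows "direct_sum_of N (carrier G') D \<and>
    (\<forall>x\<in>carrier N. \<forall>\<sigma>\<in>carrier G'. hpart N (carrier G') D x \<sigma> = hpart M (carrier G) C x (f \<sigma>))"
proof -
  interpret M: graded_group M "carrier G" C by fact
  interpret N: abelian_group N by fact
  show ?thesis
  proof (rule N.direct_sum_of_projections)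
    fix x \<sigma> assume x: "x \<in> carrier N" and s: "\<sigma> \<in> carrier G'"
    show "M.hp x (f \<sigma>) \<in> carrier N" using x s M.hpart_closed f by (simp add: N)
    show "M.hp (x \<oplus>\<^bsub>N\<^esub> y) (f \<sigma>) = M.hp x (f \<sigma>) \<oplus>\<^bsub>N\<^esub> M.hp y (f \<sigma>)" if "y \<in> carrier N" for y
      using x s that M.hpart_add f by (simp add: N)
    show "M.hp (M.hp x (f \<sigma>)) (f \<tau>) = (if \<sigma> = \<tau> then M.hp x (f \<sigma>) else \<zero>\<^bsub>N\<^esub>)"
      if "\<tau> \<in> carrier G'" for \<tau>
      using x s that f M.hpart_hom[OF f(1)[OF s] M.hpart_in f(1)[OF that], of x] inj_onD[OF f(2)]
      by (auto simp: N)
  next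
    fix x assume x: "x \<in> carrier N"
    have "f ` {\<sigma> \<in> carrier G'. M.hp x (f \<sigma>) \<noteq> \<zero>\<^bsub>N\<^esub>} \<subseteq> hsupp M (carrier G) C x"
      using f by (auto simp: N hsupp_def)
    then have "finite (f ` {\<sigma> \<in> carrier G'. M.hp x (f \<sigma>) \<noteq> \<zero>\<^bsub>N\<^esub>})"
      using x by (auto simp: N dest: finite_subset[OF _ M.finite_hsupp])
    moreover have "inj_on f {\<sigma> \<in> carrier G'. M.hp x (f \<sigma>) \<noteq> \<zero>\<^bsub>N\<^esub>}"
      using f(2) by (rule inj_on_subset) auto
    ultimately show "finite {\<sigma> \<in> carrier G'. M.hp x (f \<sigma>) \<noteq> \<zero>\<^bsub>N\<^esub>}"
      using finite_imageD by blast
    show "x = \<zero>\<^bsub>N\<^esub>" if x0: "\<And>\<sigma>. \<sigma> \<in> carrier G' \<Longrightarrow> M.hp x (f \<sigma>) = \<zero>\<^bsub>N\<^esub>"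
    proof -
      have "M.hp x t = \<zero>\<^bsub>M\<^esub>" if t: "t \<in> carrier G" for t
        using t supp[of t] M.hpart_in[OF _ t, of x] x x0
        by (cases "t \<in> f ` carrier G'") (auto simp: N)
      then show ?thesis using M.hpart_inject[of x "\<zero>\<^bsub>M\<^esub>"] x by (simp add: N M.hpart_zero)
    qed
  next
    fix \<sigma> assume s: "\<sigma> \<in> carrier G'"
    show "D \<sigma> = {x \<in> carrier N. M.hp x (f \<sigma>) = x}"
      using D[OF s] M.hpart_hom[OF f(1)[OF s] _ f(1)[OF s]] M.hpart_in[OF _ f(1)[OF s]]
        M.C_closed[OF f(1)[OF s]] by (auto simp: N) metis
  qed
qed

sublocale Bt: graded_ring G' Bt
proof -
  have ring: "ring Bt"
  proof (rule ringI)
    show "abelian_group Bt"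
      by (rule Bs.A.sub_abelian_group) (auto simp: alg_tilde_simps)
    show "monoid Bt"
      by (rule monoidI) (auto simp: alg_tilde_simps Bs.A.m_assoc)
  qed (auto simp: alg_tilde_simps Bs.A.l_distr Bs.A.r_distr)
  have ds: "direct_sum_of Bt (carrier G') (agr Bt) \<and> (\<forall>x\<in>carrier Bt. \<forall>\<sigma>\<in>carrier G'.
      hpart Bt (carrier G') (agr Bt) x \<sigma> = hpart B (carrier G) (agr B) x (\<phi> \<sigma>))"
    by (rule direct_sum_of_reindex[OF Bs.Ag.graded_group_axioms ring.is_abelian_group[OF ring]])
      (auto simp: alg_tilde_simps phi_closed alg_restrict_simps inj_on_def phi_inj simp flip: U_image)
  show "graded_ring G' Bt"
  proof (intro graded_ring.intro graded_group.intro graded_group_axioms.intro graded_ring_axioms.intro)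
    show "\<one>\<^bsub>Bt\<^esub> \<in> agr Bt \<one>\<^bsub>G'\<^esub>" using Bs.one_deg by (simp add: alg_tilde_simps phi_one)
    fix s t a b
    assume st: "s \<in> carrier G'" "t \<in> carrier G'" and ab: "a \<in> agr Bt s" "b \<in> agr Bt t"
    have m: "a \<otimes>\<^bsub>B\<^esub> b \<in> agr B (\<phi> s \<otimes>\<^bsub>G\<^esub> \<phi> t)"
      using Bs.mult_deg[OF phi_closed[OF st(1)] phi_closed[OF st(2)]] ab by (simp add: alg_tilde_simps)
    show "a \<otimes>\<^bsub>Bt\<^esub> b \<in> agr Bt (s \<otimes>\<^bsub>G'\<^esub> t)"
    \<comment> \<open>Where \<phi> may fail to be multiplicative, the product in \<open>G\<close>
      leaves \<open>U\<close> and lies in a component that \<open>B\<close> has set to zero; zero is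
      homogeneous of every degree.\<close>
    proof (cases "\<phi> s \<otimes>\<^bsub>G\<^esub> \<phi> t \<in> U")
      case True
      then show ?thesis using m phi_mult[OF st] by (simp add: alg_tilde_simps)
    next
      case False
      then have "a \<otimes>\<^bsub>B\<^esub> b = \<zero>\<^bsub>B\<^esub>" using m by (simp add: alg_restrict_simps)
      then show ?thesis using Bs.Ag.C_zero[OF phi_closed, of "s \<otimes>\<^bsub>G'\<^esub> t"] st by (simp add: alg_tilde_simps)
    qed
  qed (use ring ds ring.is_abelian_group[OF ring] G'.is_group in auto)
qed

lemma mod_tilde_graded_module:
  assumes "graded_module G B X" "\<And>t. t \<in> carrier G - S \<Longrightarrow> mgr X t \<subseteq> {\<zero>\<^bsub>X\<^esub>}"
  shows "graded_module G' Bt (mod_tilde G g \<phi> X)"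
    and "\<And>x \<sigma>. x \<in> carrier X \<Longrightarrow> \<sigma> \<in> carrier G' \<Longrightarrow>
      hpart (mod_tilde G g \<phi> X) (carrier G') (mgr (mod_tilde G g \<phi> X)) x \<sigma> = hc X x (shift \<sigma>)"
proof -
  interpret X: graded_mod G B X by unfold_locales fact
  let ?X = "mod_tilde G g \<phi> X"
  have ab: "abelian_group ?X"
    by (rule X.M.sub_abelian_group) (auto simp: mod_tilde_simps)
  then have rm: "right_module Bt ?X"
    by (simp add: right_module_def mod_tilde_simps alg_tilde_simps X.act_add_left X.act_add_right X.act_mult)
  have sur: "S = shift ` carrier G'" using shift_surj shift_S by auto
  have ds: "direct_sum_of ?X (carrier G') (mgr ?X) \<and> (\<forall>x\<in>carrier ?X. \<forall>\<sigma>\<in>carrier G'.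
      hpart ?X (carrier G') (mgr ?X) x \<sigma> = hc X x (shift \<sigma>))"
    by (rule direct_sum_of_reindex[OF X.Mg.graded_group_axioms ab])
      (use assms(2) in \<open>auto simp: mod_tilde_simps shift_closed inj_on_def shift_inj sur\<close>)
  show "hpart ?X (carrier G') (mgr ?X) x \<sigma> = hc X x (shift \<sigma>)"
    if "x \<in> carrier X" "\<sigma> \<in> carrier G'" for x \<sigma> using ds that by (simp add: mod_tilde_simps)
  have "x \<cdot>\<^bsub>?X\<^esub> a \<in> mgr ?X (s \<otimes>\<^bsub>G'\<^esub> t)"
    if st: "s \<in> carrier G'" "t \<in> carrier G'" and xa: "x \<in> mgr ?X s" "a \<in> agr Bt t" for s t x a
  proof -
    have m: "x \<cdot>\<^bsub>X\<^esub> a \<in> mgr X (shift s \<otimes>\<^bsub>G\<^esub> \<phi> t)"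
      using X.act_deg[OF shift_closed[OF st(1)] phi_closed[OF st(2)]] xa
      by (simp add: mod_tilde_simps alg_tilde_simps)
    have eq: "shift s \<otimes>\<^bsub>G\<^esub> \<phi> t = g \<otimes>\<^bsub>G\<^esub> (\<phi> s \<otimes>\<^bsub>G\<^esub> \<phi> t)"
      using st g_carrier phi_closed by (simp add: shift_def G.m_assoc)
    show ?thesis
    \<comment> \<open>The same alternative for modules: since \<open>S = gU\<close>, a product whose
      degree leaves \<open>U\<close> after removing \<open>g\<close> leaves the support of
      \<open>X\<close> and vanishes.\<close>
    proof (cases "\<phi> s \<otimes>\<^bsub>G\<^esub> \<phi> t \<in> U")
      case True
      then show ?thesis using m phi_mult[OF st] eq by (simp add: mod_tilde_simps shift_def)
    next
      case False
      then have "shift s \<otimes>\<^bsub>G\<^esub> \<phi> t \<in> carrier G - S"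
        using eq g_mult[of "\<phi> s \<otimes>\<^bsub>G\<^esub> \<phi> t"] st phi_closed g_carrier by simp
      then have "x \<cdot>\<^bsub>X\<^esub> a = \<zero>\<^bsub>X\<^esub>" using m assms(2) by blast
      then show ?thesis using X.Mg.C_zero[OF shift_closed, of "s \<otimes>\<^bsub>G'\<^esub> t"] st by (simp add: mod_tilde_simps)
    qed
  qed
  then show "graded_module G' Bt ?X" using rm ds by (simp add: graded_module_def)
qed

lemma generated_in_tilde:
  assumes "graded_module G B X" "\<And>t. t \<in> carrier G - S \<Longrightarrow> mgr X t \<subseteq> {\<zero>\<^bsub>X\<^esub>}"
    and "generated_in B T X"
  shows "generated_in Bt H' (mod_tilde G g \<phi> X)"
proof -
  have "right_module B X" "right_module Bt (mod_tilde G g \<phi> X)"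
    using assms(1) mod_tilde_graded_module[OF assms(1,2)] by (auto simp: graded_module_def)
  moreover have "submod Bt N (mod_tilde G g \<phi> X) \<longleftrightarrow> submod B N X" for N
    by (simp add: submod_def mod_tilde_simps alg_tilde_simps)
  ultimately show ?thesis
    using assms(3) by (simp add: generated_in_iff Bs.A.ring_axioms Bt.A.ring_axioms T_shift mod_tilde_simps)
qed

lemma ghom_tilde:
  assumes "ghom G B X Y u" shows "ghom G' Bt (mod_tilde G g \<phi> X) (mod_tilde G g \<phi> Y) u"
  using assms by (auto simp: ghom_def mod_tilde_simps alg_tilde_simps shift_closed)

end

section \<open>Equivalence\<close>

text \<open>Its type of elements is a product type outside the universe, which suffices for an
  ambient module in which a morphism is constructed as a graph.\<close>

definition prod_module :: "('a, 'm, 'g) gr_module \<Rightarrow> ('a, 'n, 'g) gr_module \<Rightarrow> ('a, 'm \<times> 'n, 'g) gr_module" where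
  "prod_module M N = \<lparr>carrier = carrier M \<times> carrier N, mult = undefined, one = undefined,
     zero = (\<zero>\<^bsub>M\<^esub>, \<zero>\<^bsub>N\<^esub>), add = (\<lambda>x y. (fst x \<oplus>\<^bsub>M\<^esub> fst y, snd x \<oplus>\<^bsub>N\<^esub> snd y)),
     ract = (\<lambda>x a. (fst x \<cdot>\<^bsub>M\<^esub> a, snd x \<cdot>\<^bsub>N\<^esub> a)), mgr = (\<lambda>t. mgr M t \<times> mgr N t)\<rparr>"

lemma prod_module_simps:
  "carrier (prod_module M N) = carrier M \<times> carrier N" "zero (prod_module M N) = (\<zero>\<^bsub>M\<^esub>, \<zero>\<^bsub>N\<^esub>)"
  "x \<oplus>\<^bsub>prod_module M N\<^esub> y = (fst x \<oplus>\<^bsub>M\<^esub> fst y, snd x \<oplus>\<^bsub>N\<^esub> snd y)"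
  "x \<cdot>\<^bsub>prod_module M N\<^esub> a = (fst x \<cdot>\<^bsub>M\<^esub> a, snd x \<cdot>\<^bsub>N\<^esub> a)"
  "mgr (prod_module M N) t = mgr M t \<times> mgr N t"
  by (simp_all add: prod_module_def)

lemma (in graded_ring) prod_module_graded:
  assumes "graded_module G A M" "graded_module G A N"
  shows "graded_module G A (prod_module M N)"
    and "\<And>x t. x \<in> carrier M \<times> carrier N \<Longrightarrow> t \<in> carrier G \<Longrightarrow>
      hpart (prod_module M N) (carrier G) (mgr (prod_module M N)) x t =
        (hpart M (carrier G) (mgr M) (fst x) t, hpart N (carrier G) (mgr N) (snd x) t)"
proof -
  interpret M: graded_mod G A M by unfold_locales fact
  interpret N: graded_mod G A N by unfold_locales fact
  let ?P = "prod_module M N" and ?p = "\<lambda>x t. (M.Mg.hp (fst x) t, N.Mg.hp (snd x) t)"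
  interpret P: abelian_group ?P
  proof (rule abelian_groupI)
    fix x assume "x \<in> carrier ?P"
    then show "\<exists>y\<in>carrier ?P. y \<oplus>\<^bsub>?P\<^esub> x = \<zero>\<^bsub>?P\<^esub>"
      by (intro bexI[of _ "(\<ominus>\<^bsub>M\<^esub> fst x, \<ominus>\<^bsub>N\<^esub> snd x)"]) (auto simp: prod_module_simps M.M.l_neg N.M.l_neg)
  qed (auto simp: prod_module_simps M.M.a_assoc N.M.a_assoc intro: M.M.a_comm N.M.a_comm)
  have ds: "direct_sum_of ?P (carrier G) (mgr ?P) \<and>
      (\<forall>x\<in>carrier ?P. \<forall>t\<in>carrier G. hpart ?P (carrier G) (mgr ?P) x t = ?p x t)"
  proof (rule P.direct_sum_of_projections)
    fix x t assume x: "x \<in> carrier ?P" and t: "t \<in> carrier G"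
    show "?p x t \<in> carrier ?P"
      using x t M.Mg.hpart_closed N.Mg.hpart_closed by (auto simp: prod_module_simps)
    show "?p (x \<oplus>\<^bsub>?P\<^esub> y) t = ?p x t \<oplus>\<^bsub>?P\<^esub> ?p y t" if "y \<in> carrier ?P" for y
      using x t that M.Mg.hpart_add N.Mg.hpart_add by (auto simp: prod_module_simps)
    show "?p (?p x t) r = (if t = r then ?p x t else \<zero>\<^bsub>?P\<^esub>)" if "r \<in> carrier G" for r
      using x t that M.Mg.hpart_hom[OF t M.Mg.hpart_in that] N.Mg.hpart_hom[OF t N.Mg.hpart_in that]
      by (auto simp: prod_module_simps)
  next
    fix x assume x: "x \<in> carrier ?P"
    have "{t \<in> carrier G. ?p x t \<noteq> \<zero>\<^bsub>?P\<^esub>} \<subseteq>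
        hsupp M (carrier G) (mgr M) (fst x) \<union> hsupp N (carrier G) (mgr N) (snd x)"
      by (auto simp: hsupp_def prod_module_simps)
    then show "finite {t \<in> carrier G. ?p x t \<noteq> \<zero>\<^bsub>?P\<^esub>}"
      using x by (elim finite_subset) (auto simp: prod_module_simps M.Mg.finite_hsupp N.Mg.finite_hsupp)
    show "x = \<zero>\<^bsub>?P\<^esub>" if "\<And>t. t \<in> carrier G \<Longrightarrow> ?p x t = \<zero>\<^bsub>?P\<^esub>"
      using x that M.Mg.hpart_inject[of "fst x" "\<zero>\<^bsub>M\<^esub>"] N.Mg.hpart_inject[of "snd x" "\<zero>\<^bsub>N\<^esub>"]
      by (auto simp: prod_module_simps M.Mg.hpart_zero N.Mg.hpart_zero)
  next
    fix t assume t: "t \<in> carrier G"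
    have "x \<in> mgr M t \<longleftrightarrow> x \<in> carrier M \<and> M.Mg.hp x t = x" for x
      using M.Mg.hpart_hom[OF t _ t] M.Mg.hpart_in[OF _ t] M.Mg.C_closed[OF t] by metis
    moreover have "x \<in> mgr N t \<longleftrightarrow> x \<in> carrier N \<and> N.Mg.hp x t = x" for x
      using N.Mg.hpart_hom[OF t _ t] N.Mg.hpart_in[OF _ t] N.Mg.C_closed[OF t] by metis
    ultimately show "mgr ?P t = {x \<in> carrier ?P. ?p x t = x}"
      by (auto simp: prod_module_simps)
  qed
  then show "hpart ?P (carrier G) (mgr ?P) x t = ?p x t" if "x \<in> carrier M \<times> carrier N" "t \<in> carrier G"
    for x t using that unfolding prod_module_simps(1) by blast
  have "right_module A ?P"
    using P.abelian_group_axioms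
    by (auto simp: right_module_def prod_module_simps M.act_add_left N.act_add_left
        M.act_add_right N.act_add_right M.act_mult N.act_mult)
  then show "graded_module G A ?P"
    using ds M.act_deg N.act_deg by (auto simp: graded_module_def prod_module_simps)
qed

section \<open>The functor: morphisms, generation and fullness\<close>

context pseudo_graded
begin

lemma modular_modI: "graded_module G A M \<Longrightarrow> modular_mod G A M S U"
  using right_modular by unfold_locales

abbreviation \<Phi> :: "('a, 'm, 'g) gr_module \<Rightarrow> ('a, 'm, 'h) gr_module" where
  "\<Phi> \<equiv> Phi_ob G A \<phi> g S"

abbreviation MS :: "('a, 'm, 'g) gr_module \<Rightarrow> ('a, 'm, 'g) gr_module" where
  "MS \<equiv> mod_restrict G S A"

abbreviation part :: "('a, 'm, 'g) gr_module \<Rightarrow> 'm set" where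
  "part M \<equiv> carrier (MS M)"

lemma part_iff:
  assumes "graded_module G A M"
  shows "x \<in> part M \<longleftrightarrow> x \<in> carrier M \<and> (\<forall>t\<in>carrier G - S. hc M x t = \<zero>\<^bsub>M\<^esub>)"
proof -
  interpret M: modular_mod G A M S U using assms by (rule modular_modI)
  show ?thesis by (simp add: M.MS_simps M.Mg.part_iff)
qed

lemma MS_graded: "graded_module G A M \<Longrightarrow> graded_module G B (MS M)"
  using modular_modI modular_mod.mod_restrict_graded_module by blast

lemma MS_support: "t \<in> carrier G - S \<Longrightarrow> mgr (MS M) t \<subseteq> {\<zero>\<^bsub>MS M\<^esub>}"
  by (simp add: mod_restrict_simps)

lemma Phi_graded: "graded_module G A M \<Longrightarrow> graded_module G' Bt (\<Phi> M)"
  unfolding Phi_ob_def by (rule mod_tilde_graded_module(1)[OF MS_graded MS_support])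

lemma Phi_simps:
  "carrier (\<Phi> M) = part M" "zero (\<Phi> M) = zero M" "add (\<Phi> M) = add M" "ract (\<Phi> M) = ract (MS M)"
  "\<sigma> \<in> carrier G' \<Longrightarrow> mgr (\<Phi> M) \<sigma> = mgr M (shift \<sigma>)"
  by (simp_all add: Phi_ob_def mod_tilde_simps mod_restrict_simps shift_S)

lemma Phi_hpart:
  assumes "graded_module G A M" "x \<in> part M" "\<sigma> \<in> carrier G'"
  shows "hpart (\<Phi> M) (carrier G') (mgr (\<Phi> M)) x \<sigma> = hc M x (shift \<sigma>)"
proof -
  interpret M: modular_mod G A M S U by (rule modular_modI) fact
  show ?thesis
    using mod_tilde_graded_module(2)[OF MS_graded[OF assms(1)] MS_support assms(2,3)]
      M.mod_restrict_hpart[of x "shift \<sigma>"] assms shift_closed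
    by (simp add: Phi_ob_def M.MS_simps)
qed

lemma ract_hpart:
  assumes "graded_module G A M" "x \<in> carrier M" "a \<in> carrier A" "t \<in> carrier G"
  shows "hc M (x \<cdot>\<^bsub>MS M\<^esub> a) t = (if t \<in> S then hc M (x \<cdot>\<^bsub>M\<^esub> a) t else \<zero>\<^bsub>M\<^esub>)"
proof -
  interpret M: modular_mod G A M S U by (rule modular_modI) fact
  show ?thesis using M.sact_hpart assms by (simp add: M.MS_simps)
qed

lemma ract_closed:
  assumes "graded_module G A M" "x \<in> carrier M" "a \<in> carrier A"
  shows "x \<cdot>\<^bsub>MS M\<^esub> a \<in> part M"
proof -
  interpret M: modular_mod G A M S U by (rule modular_modI) fact
  show ?thesis using M.sact_part assms by (simp add: M.MS_simps)
qed

lemma ract_hom: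
  assumes "graded_module G A M" "t \<in> T" "k \<in> carrier G" "x \<in> mgr M t" "a \<in> agr A k"
  shows "x \<cdot>\<^bsub>MS M\<^esub> a = (if k \<in> U then x \<cdot>\<^bsub>M\<^esub> a else \<zero>\<^bsub>M\<^esub>)"
proof -
  interpret M: modular_mod G A M S U by (rule modular_modI) fact
  show ?thesis
    using M.sact_hom[of t k x a S] transporterD(1,2)[OF assms(2)] assms by (simp add: M.MS_simps)
qed

lemma part_hom: "graded_module G A M \<Longrightarrow> s \<in> S \<Longrightarrow> x \<in> mgr M s \<Longrightarrow> x \<in> part M"
proof -
  assume M: "graded_module G A M" and s: "s \<in> S" "x \<in> mgr M s"
  interpret M: modular_mod G A M S U by (rule modular_modI) fact
  show ?thesis using s S_carrier M.Mg.part_hom[of s S x] by (auto simp: M.MS_simps)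
qed

lemma B_carrier: "a \<in> carrier B \<Longrightarrow> a \<in> carrier A"
  by (simp add: alg_restrict_carrier Ag.part_closed)

lemma B_hom: "k \<in> U \<Longrightarrow> a \<in> agr A k \<Longrightarrow> a \<in> carrier B"
  using U_carrier Ag.part_hom[of k U a] by (auto simp: alg_restrict_carrier)

lemma ghom_Phi:
  assumes "graded_module G A M" "graded_module G A N" "ghom G A M N f"
  shows "ghom G' Bt (\<Phi> M) (\<Phi> N) f"
proof (rule ghomI)
  interpret M: graded_mod G A M by unfold_locales fact
  interpret N: graded_mod G A N by unfold_locales fact
  note f = ghomD[OF assms(3)] and fh = ghom_hpart[OF assms] and f0 = ghom_zero[OF assms]
  show "f x \<in> carrier (\<Phi> N)" if "x \<in> carrier (\<Phi> M)" for x
    using that f by (auto simp: Phi_simps part_iff assms fh f0)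
  show "f (x \<oplus>\<^bsub>\<Phi> M\<^esub> y) = f x \<oplus>\<^bsub>\<Phi> N\<^esub> f y" if "x \<in> carrier (\<Phi> M)" "y \<in> carrier (\<Phi> M)" for x y
    using that f by (simp add: Phi_simps part_iff assms)
  show "f (x \<cdot>\<^bsub>\<Phi> M\<^esub> a) = f x \<cdot>\<^bsub>\<Phi> N\<^esub> a" if "x \<in> carrier (\<Phi> M)" "a \<in> carrier Bt" for x a
  proof -
    have xa: "x \<in> carrier M" "a \<in> carrier A"
      using that B_carrier by (auto simp: Phi_simps part_iff assms alg_tilde_simps)
    have c: "x \<cdot>\<^bsub>MS M\<^esub> a \<in> carrier M" "f x \<cdot>\<^bsub>MS N\<^esub> a \<in> carrier N"
      using ract_closed[OF assms(1) xa] ract_closed[OF assms(2) f(1)[OF xa(1)] xa(2)]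
      by (simp_all add: part_iff assms)
    \<comment> \<open>Both truncations are the projection onto the degrees in \<open>S\<close>, and
      a graded morphism commutes with components.\<close>
    have "f (x \<cdot>\<^bsub>MS M\<^esub> a) = f x \<cdot>\<^bsub>MS N\<^esub> a"
    proof (rule N.Mg.hpart_inject)
      fix t assume "t \<in> carrier G"
      then show "hc N (f (x \<cdot>\<^bsub>MS M\<^esub> a)) t = hc N (f x \<cdot>\<^bsub>MS N\<^esub> a) t"
        using xa c f(1) by (simp add: fh ract_hpart assms f0 flip: f(3))
    qed (use c f in auto)
    then show ?thesis by (simp add: Phi_simps)
  qed
  show "f x \<in> mgr (\<Phi> N) \<sigma>" if "\<sigma> \<in> carrier G'" "x \<in> mgr (\<Phi> M) \<sigma>" for \<sigma> x
    using that f(4) shift_closed by (simp add: Phi_simps)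
qed

text \<open>Write an element as a sum of terms \<open>z a\<close> with \<open>z\<close> of degree
  \<open>t\<close> in \<open>T\<close> and \<open>a\<close> of degree \<open>k\<close>. A term
  contributes to the degrees in \<open>S\<close> only if \<open>k\<close> is in \<open>U\<close>,
  and then \<open>z a\<close> is also the product over \<open>B\<close>.\<close>

lemma MS_generated:
  assumes "graded_module G A M" "generated_in A T M"
  shows "generated_in B T (MS M)"
proof -
  interpret M: modular_mod G A M S U by (rule modular_modI) fact
  interpret X: graded_mod G B "MS M" using MS_graded[OF assms(1)] by unfold_locales
  show ?thesis
    unfolding generated_in_iff[OF Bs.A.ring_axioms X.right_module]
  proof (intro allI impI subsetI)
    fix N x assume N: "submod B N (MS M)" "\<forall>t\<in>T. mgr (MS M) t \<subseteq> N" and x: "x \<in> part M"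
    note NS = submodD[OF N(1), unfolded mod_restrict_simps]
    have gen: "mgr M t \<subseteq> N" if "t \<in> T" for t
      using bspec[OF N(2) that] subsetD[OF T_S that] by (simp add: mod_restrict_simps)
    have "x \<in> M.span (\<Union>t\<in>T. mgr M t)"
      using assms(2) x M.generated_in_span[OF T_carrier] assms(1) by (auto simp: part_iff)
    \<comment> \<open>The claim concerns the components in \<open>S\<close> of arbitrary elements of
      the span, because the partial sums met in the induction need not be supported in
      \<open>S\<close>.\<close>
    then have "\<forall>s\<in>S. hc M x s \<in> N"
    proof induction
      case zero
      then show ?case using NS(2) S_carrier M.Mg.hpart_zero by (auto simp: subset_iff)
    next
      case (step y z k a)
      then obtain t where t: "t \<in> T" "z \<in> mgr M t" by blast
      have tc: "t \<in> carrier G" using t T_carrier by blast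
      have "T \<subseteq> carrier G" by (rule T_carrier)
      then have sc: "M.span (\<Union>t\<in>T. mgr M t) \<subseteq> carrier M"
        by (intro M.span_closed) (auto intro: M.Mg.C_closed)
      have c: "y \<in> carrier M" "z \<cdot>\<^bsub>M\<^esub> a \<in> carrier M"
        using step(1,3,4) t tc Ag.C_closed M.Mg.C_closed sc by auto
      show ?case
      proof
        fix s assume s: "s \<in> S"
        then have sG: "s \<in> carrier G" using S_carrier by blast
        have "hc M (z \<cdot>\<^bsub>M\<^esub> a) s \<in> N"
        proof (cases "s = t \<otimes>\<^bsub>G\<^esub> k")
          case True
          then have k: "k \<in> U" using transporterD(2)[OF t(1) step(3)] s by simp
          have "hc M (z \<cdot>\<^bsub>M\<^esub> a) s = z \<cdot>\<^bsub>MS M\<^esub> a"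
            using M.Mg.hpart_hom[OF _ M.act_deg[OF tc step(3) t(2) step(4)] sG] True k sG
            by (simp add: ract_hom[OF assms(1) t(1) step(3) t(2) step(4)])
          then show ?thesis using NS(4) gen t B_hom[OF k step(4)] by auto
        next
          case False
          then show ?thesis
            using M.Mg.hpart_hom[OF _ M.act_deg[OF tc step(3) t(2) step(4)] sG] NS(2) tc step(3) by simp
        qed
        then show "hc M (y \<oplus>\<^bsub>M\<^esub> z \<cdot>\<^bsub>M\<^esub> a) s \<in> N"
          using NS(3) step s sG c by (simp add: M.Mg.hpart_add)
      qed
    qed
    moreover have "x \<in> carrier M" "\<And>i. i \<in> carrier G \<Longrightarrow> hc M x i \<noteq> \<zero>\<^bsub>M\<^esub> \<Longrightarrow> i \<in> S"
      using x by (auto simp: part_iff assms(1))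
    ultimately show "x \<in> N"
      by (intro M.Mg.closed_of_hparts[of x N]) (simp_all add: NS(2,3))
  qed
qed

lemma Phi_in_L:
  fixes M :: "('a, 'm, 'g) gr_module"
  assumes "graded_module G A M" "generated_in A T M"
  shows "\<Phi> M \<in> Ob (cat_L_tilde G' G A \<phi> g S U)"
    and "generated_in Bt H' (\<Phi> M)"
proof -
  have "isomorphic (Gr G B) (MS M) (MS M)" "isomorphic (Gr G' Bt) (\<Phi> M) (\<Phi> M)"
    using MS_graded Phi_graded assms Bs.isomorphic_Gr_refl Bt.isomorphic_Gr_refl by blast+
  then have "MS M \<in> Ob (cat_L G A S U)" "isomorphic (Gr G' Bt) (\<Phi> M) (mod_tilde G g \<phi> (MS M))"
    using MS_graded MS_generated assms unfolding Phi_ob_def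
    by (auto simp: cat_L_def full_subcat_def Gr_def)
  then show "\<Phi> M \<in> Ob (cat_L_tilde G' G A \<phi> g S U)"
    using Phi_graded assms by (auto simp: cat_L_tilde_def full_subcat_def Let_def Gr_def)
  show "generated_in Bt H' (\<Phi> M)"
    unfolding Phi_ob_def
    by (rule generated_in_tilde[OF MS_graded MS_support MS_generated]) (use assms in auto)
qed

text \<open>
  A morphism \<open>w\<close> of the restrictions extends to \<open>M\<close>: the submodule of \<open>M \<times> N\<close> generated by the
  graph of \<open>w\<close> in the degrees of the transporter is again a graph, because the submodule of \<open>N\<close>
  measuring its failure to be one vanishes in the degrees of \<open>S\<close>.
\<close>

lemma Phi_full:
  fixes M N :: "('a, 'm, 'g) gr_module"
  assumes M: "graded_module G A M" "generated_in A T M" and N: "graded_module G A N"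
    and torsionfree: "\<And>N'. graded_submod G A N' N \<Longrightarrow>
      (\<And>x s. x \<in> N' \<Longrightarrow> s \<in> S \<Longrightarrow> hc N x s = \<zero>\<^bsub>N\<^esub>) \<Longrightarrow> N' \<subseteq> {\<zero>\<^bsub>N\<^esub>}"
    and w: "ghom G' Bt (\<Phi> M) (\<Phi> N) w"
  obtains F where "ghom G A M N F" "\<And>x. x \<in> part M \<Longrightarrow> F x = w x"
proof -
  interpret M: modular_mod G A M S U by (rule modular_modI) fact
  interpret N: modular_mod G A N S U by (rule modular_modI) fact
  let ?P = "prod_module M N"
  interpret P: graded_mod G A ?P using prod_module_graded(1)[OF M(1) N] by unfold_locales
  have w_part: "w x \<in> part N" if "x \<in> part M" for x
    using ghomD(1)[OF w] that by (simp add: Phi_simps)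
  have w_carrier: "w x \<in> carrier N" if "x \<in> part M" for x
    using w_part[OF that] by (simp add: part_iff N)
  have w_act: "w (x \<cdot>\<^bsub>MS M\<^esub> a) = w x \<cdot>\<^bsub>MS N\<^esub> a" if "x \<in> part M" "a \<in> carrier B" for x a
    using ghomD(3)[OF w] that by (simp add: Phi_simps alg_tilde_simps)
  have w_add: "w (x \<oplus>\<^bsub>M\<^esub> y) = w x \<oplus>\<^bsub>N\<^esub> w y" if "x \<in> part M" "y \<in> part M" for x y
    using ghomD(2)[OF w] that by (simp add: Phi_simps)
  have w0: "w \<zero>\<^bsub>M\<^esub> = \<zero>\<^bsub>N\<^esub>"
    using Bt.ghom_zero[OF Phi_graded[OF M(1)] Phi_graded[OF N] w] by (simp add: Phi_simps)
  have w_deg: "w x \<in> mgr N s" if "s \<in> S" "x \<in> mgr M s" for s x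
    using ghomD(4)[OF w] that shift_surj[OF that(1)] by (auto simp: Phi_simps)
  have w_hp: "hc N (w x) s = w (hc M x s)" if "x \<in> part M" "s \<in> S" for x s
  proof -
    obtain \<sigma> where \<sigma>: "\<sigma> \<in> carrier G'" "s = shift \<sigma>" using shift_surj[of s] \<open>s \<in> S\<close> by blast
    then show ?thesis
      using Bt.ghom_hpart[OF Phi_graded[OF M(1)] Phi_graded[OF N] w, of x \<sigma>] that(1)
        Phi_hpart[OF M(1) that(1) \<sigma>(1)] Phi_hpart[OF N w_part[OF that(1)] \<sigma>(1)]
      by (simp add: Phi_simps)
  qed
  define D where "D = (\<Union>t\<in>T. (\<lambda>x. (x, w x)) ` mgr M t)"
  have D_hom: "\<exists>s\<in>carrier G. d \<in> mgr ?P s" if "d \<in> D" for d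
    using that T_S T_carrier w_deg by (force simp: D_def prod_module_simps)
  then have D_carrier: "D \<subseteq> carrier ?P" using P.Mg.C_closed by blast
  define \<Gamma> where "\<Gamma> = P.span D"
  have gr: "graded_submod G A \<Gamma> ?P" unfolding \<Gamma>_def by (rule P.span_graded[OF D_hom])
  then have sub: "submod A \<Gamma> ?P" and hp_closed: "\<And>x t. x \<in> \<Gamma> \<Longrightarrow> t \<in> carrier G \<Longrightarrow> P.Mg.hp x t \<in> \<Gamma>"
    by (auto simp: graded_submod_def)
  note \<Gamma> = submodD[OF sub, unfolded prod_module_simps]
  have \<Gamma>_hp: "(hc M x t, hc N y t) \<in> \<Gamma>" if "(x, y) \<in> \<Gamma>" "t \<in> carrier G" for x y t
    using hp_closed[OF that] that \<Gamma>(1) prod_module_graded(2)[OF M(1) N, of "(x, y)" t] by auto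
  \<comment> \<open>On \<Gamma> the components in \<open>S\<close> of the second coordinate are
    determined by those of the first. A multiple \<open>(x, w x) a\<close> of a generator reaches
    \<open>S\<close> only if the degree of \<open>a\<close> is in \<open>U\<close>, and for such
    \<open>a\<close> the map \<open>w\<close> is linear.\<close>
  have \<Gamma>_w: "\<forall>s\<in>S. hc N (snd z) s = w (hc M (fst z) s)" if "z \<in> \<Gamma>" for z
    using that unfolding \<Gamma>_def
  proof induction
    case zero
    show ?case using S_carrier M.Mg.hpart_zero N.Mg.hpart_zero w0 by (auto simp: prod_module_simps)
  next
    case (step y d k a)
    then obtain t x where t: "t \<in> T" "x \<in> mgr M t" "d = (x, w x)" by (auto simp: D_def)
    have tc: "t \<in> carrier G" and tS: "t \<in> S" using t T_carrier T_S by auto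
    note wx = w_deg[OF tS t(2)]
    have xp: "x \<in> part M" using part_hom[OF M(1) tS t(2)] .
    have ac: "a \<in> carrier A" using step Ag.C_closed by blast
    have yc: "fst y \<in> carrier M" "snd y \<in> carrier N"
      using step(1) \<Gamma>(1) by (auto simp: \<Gamma>_def)
    have xc: "x \<in> carrier M" "w x \<in> carrier N" using xp w_carrier by (auto simp: part_iff M(1))
    show ?case
    proof
      fix s assume s: "s \<in> S"
      then have sG: "s \<in> carrier G" using S_carrier by blast
      have "hc N (w x \<cdot>\<^bsub>N\<^esub> a) s = w (hc M (x \<cdot>\<^bsub>M\<^esub> a) s)"
      proof (cases "s = t \<otimes>\<^bsub>G\<^esub> k")
        case True
        then have k: "k \<in> U" using transporterD(2)[OF t(1) step(3)] s by simp
        show ?thesis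
          using M.Mg.hpart_hom[OF _ M.act_deg[OF tc step(3) t(2) step(4)] sG]
            N.Mg.hpart_hom[OF _ N.act_deg[OF tc step(3) wx step(4)] sG] True sG k
            w_act[OF xp B_hom[OF k step(4)]] ract_hom[OF M(1) t(1) step(3) t(2) step(4)]
            ract_hom[OF N t(1) step(3) wx step(4)]
          by simp
      next
        case False
        then show ?thesis
          using M.Mg.hpart_hom[OF _ M.act_deg[OF tc step(3) t(2) step(4)] sG]
            N.Mg.hpart_hom[OF _ N.act_deg[OF tc step(3) wx step(4)] sG] tc step(3) w0 by simp
      qed
      moreover have "hc M (fst y) s \<in> part M" "hc M (x \<cdot>\<^bsub>M\<^esub> a) s \<in> part M"
        using part_hom[OF M(1) s] M.Mg.hpart_in[OF _ sG] yc xc ac by auto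
      ultimately show "hc N (snd (y \<oplus>\<^bsub>?P\<^esub> d \<cdot>\<^bsub>?P\<^esub> a)) s = w (hc M (fst (y \<oplus>\<^bsub>?P\<^esub> d \<cdot>\<^bsub>?P\<^esub> a)) s)"
        using step.IH s sG yc xc ac
        by (simp add: prod_module_simps t(3) M.Mg.hpart_add N.Mg.hpart_add w_add)
    qed
  qed
  have "{y. (\<zero>\<^bsub>M\<^esub>, y) \<in> \<Gamma>} \<subseteq> {\<zero>\<^bsub>N\<^esub>}"
  proof (rule torsionfree)
    show "graded_submod G A {y. (\<zero>\<^bsub>M\<^esub>, y) \<in> \<Gamma>} N"
      unfolding graded_submod_def
    proof (intro conjI submodI ballI)
      show "hc N y t \<in> {y. (\<zero>\<^bsub>M\<^esub>, y) \<in> \<Gamma>}" if "y \<in> {y. (\<zero>\<^bsub>M\<^esub>, y) \<in> \<Gamma>}" "t \<in> carrier G" for y t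
        using \<Gamma>_hp[of "\<zero>\<^bsub>M\<^esub>" y t] that by (simp add: M.Mg.hpart_zero)
      show "x \<oplus>\<^bsub>N\<^esub> y \<in> {y. (\<zero>\<^bsub>M\<^esub>, y) \<in> \<Gamma>}"
        if "x \<in> {y. (\<zero>\<^bsub>M\<^esub>, y) \<in> \<Gamma>}" "y \<in> {y. (\<zero>\<^bsub>M\<^esub>, y) \<in> \<Gamma>}" for x y
        using \<Gamma>(3)[of "(\<zero>\<^bsub>M\<^esub>, x)" "(\<zero>\<^bsub>M\<^esub>, y)"] that by simp
      show "x \<cdot>\<^bsub>N\<^esub> a \<in> {y. (\<zero>\<^bsub>M\<^esub>, y) \<in> \<Gamma>}" if "x \<in> {y. (\<zero>\<^bsub>M\<^esub>, y) \<in> \<Gamma>}" "a \<in> carrier A" for x a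
        using \<Gamma>(4)[of "(\<zero>\<^bsub>M\<^esub>, x)" a] that by simp
    qed (use \<Gamma>(1,2) in auto)
    show "hc N y s = \<zero>\<^bsub>N\<^esub>" if "y \<in> {y. (\<zero>\<^bsub>M\<^esub>, y) \<in> \<Gamma>}" "s \<in> S" for y s
      using \<Gamma>_w[of "(\<zero>\<^bsub>M\<^esub>, y)"] that S_carrier M.Mg.hpart_zero w0 by auto
  qed
  then have uniq0: "y = \<zero>\<^bsub>N\<^esub>" if "(\<zero>\<^bsub>M\<^esub>, y) \<in> \<Gamma>" for y using that by blast
  have uniq: "y = y'" if "(x, y) \<in> \<Gamma>" "(x, y') \<in> \<Gamma>" for x y y'
  proof -
    have c: "x \<in> carrier M" "y \<in> carrier N" "y' \<in> carrier N" using that \<Gamma>(1) by auto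
    have "(x \<cdot>\<^bsub>M\<^esub> (\<ominus>\<^bsub>A\<^esub> \<one>\<^bsub>A\<^esub>), y' \<cdot>\<^bsub>N\<^esub> (\<ominus>\<^bsub>A\<^esub> \<one>\<^bsub>A\<^esub>)) \<in> \<Gamma>"
      using \<Gamma>(4)[OF that(2), of "\<ominus>\<^bsub>A\<^esub> \<one>\<^bsub>A\<^esub>"] by simp
    then have "y \<oplus>\<^bsub>N\<^esub> \<ominus>\<^bsub>N\<^esub> y' = \<zero>\<^bsub>N\<^esub>"
      using \<Gamma>(3)[OF that(1)] uniq0 c
      by (simp add: M.M.r_neg flip: M.minus_eq_act N.minus_eq_act) (metis M.M.r_neg fst_conv snd_conv)
    then show ?thesis using c by (metis N.M.minus_equality N.M.minus_minus N.M.a_inv_closed)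
  qed
  \<comment> \<open>The first projection of \<Gamma> is a submodule containing the degrees in
    \<open>T\<close>, which generate \<open>M\<close>.\<close>
  have total: "\<exists>y. (x, y) \<in> \<Gamma>" if "x \<in> carrier M" for x
  proof -
    have "submod A (fst ` \<Gamma>) M"
    proof (rule submodI)
      show "\<zero>\<^bsub>M\<^esub> \<in> fst ` \<Gamma>" using \<Gamma>(2) by force
      show "x \<oplus>\<^bsub>M\<^esub> y \<in> fst ` \<Gamma>" if "x \<in> fst ` \<Gamma>" "y \<in> fst ` \<Gamma>" for x y
        using that \<Gamma>(3) by force
      show "x \<cdot>\<^bsub>M\<^esub> a \<in> fst ` \<Gamma>" if "x \<in> fst ` \<Gamma>" "a \<in> carrier A" for x a
        using that \<Gamma>(4) by force
    qed (use \<Gamma>(1) in auto)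
    moreover have "\<forall>t\<in>T. mgr M t \<subseteq> fst ` \<Gamma>"
      using P.span_base[OF D_carrier] by (force simp: D_def \<Gamma>_def)
    ultimately have "carrier M \<subseteq> fst ` \<Gamma>"
      using M(2) unfolding generated_in_iff[OF A.ring_axioms M.right_module] by blast
    then show ?thesis using that by force
  qed
  define F where "F x = (THE y. (x, y) \<in> \<Gamma>)" for x
  have F_eq: "F x = y" if "(x, y) \<in> \<Gamma>" for x y
    unfolding F_def using that uniq by blast
  have F: "(x, F x) \<in> \<Gamma>" if "x \<in> carrier M" for x
    using total[OF that] F_eq by blast
  have ghom: "ghom G A M N F"
  proof (rule ghomI)
    show "F x \<in> carrier N" if "x \<in> carrier M" for x using F[OF that] \<Gamma>(1) by auto
    show "F (x \<oplus>\<^bsub>M\<^esub> y) = F x \<oplus>\<^bsub>N\<^esub> F y" if "x \<in> carrier M" "y \<in> carrier M" for x y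
      using \<Gamma>(3)[OF F[OF that(1)] F[OF that(2)]] by (simp add: F_eq)
    show "F (x \<cdot>\<^bsub>M\<^esub> a) = F x \<cdot>\<^bsub>N\<^esub> a" if "x \<in> carrier M" "a \<in> carrier A" for x a
      using \<Gamma>(4)[OF F[OF that(1)] that(2)] by (simp add: F_eq)
    show "F x \<in> mgr N t" if "t \<in> carrier G" "x \<in> mgr M t" for t x
    proof -
      have x: "x \<in> carrier M" using that M.Mg.C_closed by blast
      have "(x, hc N (F x) t) \<in> \<Gamma>"
        using \<Gamma>_hp[OF F[OF x] that(1)] M.Mg.hpart_hom[OF that that(1)] by simp
      moreover have "F x \<in> carrier N" using F[OF x] \<Gamma>(1) by auto
      ultimately show ?thesis using F_eq N.Mg.hpart_in[OF _ that(1)] by metis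
    qed
  qed
  \<comment> \<open>In degrees of \<open>S\<close> the invariant \<open>\<Gamma>_w\<close> decides;
    in the others both sides vanish, as \<open>x\<close> and \<open>w x\<close> are supported in
    \<open>S\<close> and \<open>F\<close> preserves degrees.\<close>
  moreover have "F x = w x" if x: "x \<in> part M" for x
  proof (rule N.Mg.hpart_inject)
    have xc: "x \<in> carrier M" using x by (simp add: part_iff M(1))
    show "F x \<in> carrier N" using ghomD(1)[OF ghom xc] .
    show "w x \<in> carrier N" using x by (rule w_carrier)
    fix t assume t: "t \<in> carrier G"
    show "hc N (F x) t = hc N (w x) t"
    proof (cases "t \<in> S")
      case True
      then show ?thesis using \<Gamma>_w[OF F[OF xc]] w_hp[OF x] by simp
    next
      case False
      then have "hc M x t = \<zero>\<^bsub>M\<^esub>" "hc N (w x) t = \<zero>\<^bsub>N\<^esub>"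
        using x w_part[OF x] t by (auto simp: part_iff M(1) N)
      then show ?thesis using ghom_hpart[OF M(1) N ghom xc t] ghom_zero[OF M(1) N ghom] by simp
    qed
  qed
  ultimately show thesis using that by blast
qed

lemma Phi_surj:
  assumes "graded_module G A M" "graded_module G A N" "ghom G A M N f"
    and "\<And>s. s \<in> S \<Longrightarrow> mgr N s \<subseteq> f ` carrier M"
  shows "f ` carrier (\<Phi> M) = carrier (\<Phi> N)"
proof -
  interpret M: modular_mod G A M S U by (rule modular_modI) fact
  interpret N: modular_mod G A N S U by (rule modular_modI) fact
  note gM = Phi_graded[OF assms(1)] and gN = Phi_graded[OF assms(2)] and gf = ghom_Phi[OF assms(1-3)]
  have im: "submod Bt (f ` carrier (\<Phi> M)) (\<Phi> N)"
    using Bt.ghom_image[OF gM gN gf] by (simp add: graded_submod_def)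
  have "mgr N s \<subseteq> f ` carrier (\<Phi> M)" if "s \<in> S" for s
  proof
    fix y assume y: "y \<in> mgr N s"
    have sG: "s \<in> carrier G" using that S_carrier by blast
    obtain x where x: "x \<in> carrier M" "y = f x" using assms(4)[of s] \<open>s \<in> S\<close> y by blast
    have "y = f (hc M x s)"
      using ghom_hpart[OF assms(1-3) x(1) sG] N.Mg.hpart_hom[OF sG y sG] x by simp
    then show "y \<in> f ` carrier (\<Phi> M)"
      using part_hom[OF assms(1) that M.Mg.hpart_in[OF x(1) sG]] by (auto simp: Phi_simps)
  qed
  then have "y \<in> f ` carrier (\<Phi> M)" if "y \<in> carrier (\<Phi> N)" for y
  proof -
    have y: "y \<in> carrier N" "\<And>i. i \<in> carrier G \<Longrightarrow> hc N y i \<noteq> \<zero>\<^bsub>N\<^esub> \<Longrightarrow> i \<in> S"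
      using that by (auto simp: Phi_simps part_iff assms(2))
    show ?thesis
    proof (rule N.Mg.closed_of_hparts[OF y(1)])
      show "hc N y i \<in> f ` carrier (\<Phi> M)" if "i \<in> carrier G" "hc N y i \<noteq> \<zero>\<^bsub>N\<^esub>" for i
        using that \<open>\<And>s. s \<in> S \<Longrightarrow> mgr N s \<subseteq> f ` carrier (\<Phi> M)\<close> y N.Mg.hpart_in[OF y(1), of i] by blast
    qed (use submodD(2,3)[OF im] in \<open>simp_all add: Phi_simps\<close>)
  qed
  then show ?thesis using ghomD(1)[OF gf] by blast
qed

text \<open>What happens outside the degrees in \<open>S\<close> is invisible to \<Phi>, so
  \<open>f\<close> itself can be far from an isomorphism. Applied to the inclusion of a submodule
  and to a quotient map.\<close>

lemma Phi_isomorphic: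
  assumes "graded_module G A M" "graded_module G A N" "ghom G A M N f"
    and "\<And>x. x \<in> part M \<Longrightarrow> f x = \<zero>\<^bsub>N\<^esub> \<Longrightarrow> x = \<zero>\<^bsub>M\<^esub>"
    and "\<And>s. s \<in> S \<Longrightarrow> mgr N s \<subseteq> f ` carrier M"
  shows "isomorphic (Gr G' Bt) (\<Phi> M) (\<Phi> N)"
proof -
  interpret M: modular_mod G A M S U by (rule modular_modI) fact
  interpret N: modular_mod G A N S U by (rule modular_modI) fact
  note gM = Phi_graded[OF assms(1)] and gN = Phi_graded[OF assms(2)] and gf = ghom_Phi[OF assms(1-3)]
  have "inj_on f (carrier (\<Phi> M))"
  proof (rule inj_onI)
    fix x y assume xy: "x \<in> carrier (\<Phi> M)" "y \<in> carrier (\<Phi> M)" "f x = f y"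
    then have p: "x \<in> M.Mg.part S" "y \<in> M.Mg.part S" by (simp_all add: Phi_simps M.MS_simps)
    note c = M.Mg.part_closed[OF p(1)] M.Mg.part_closed[OF p(2)]
    have "f (x \<oplus>\<^bsub>M\<^esub> \<ominus>\<^bsub>M\<^esub> y) = \<zero>\<^bsub>N\<^esub>"
      using c xy(3) ghomD(1,2)[OF assms(3)] ghom_minus[OF assms(1-3)] by (simp add: N.M.r_neg)
    then have "x \<oplus>\<^bsub>M\<^esub> \<ominus>\<^bsub>M\<^esub> y = \<zero>\<^bsub>M\<^esub>"
      using assms(4) M.Mg.part_add[OF p(1) M.Mg.part_minus[OF p(2)]] by (simp add: M.MS_simps)
    then show "x = y" using c by (metis M.M.minus_equality M.M.minus_minus M.M.a_inv_closed)
  qed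
  moreover have "f ` carrier (\<Phi> M) = carrier (\<Phi> N)"
    using Phi_surj assms(1-3,5) .
  ultimately show ?thesis by (rule Bt.isomorphic_Gr_of_bij[OF gM gN gf])
qed

end

section \<open>Essential surjectivity and the equivalence\<close>

context pseudo_graded
begin

text \<open>For a graded submodule, the part supported in \<open>S\<close> contains all components
  with degree in \<open>S\<close>, so it vanishes exactly when these do. The form with components
  avoids restricting a subrecord.\<close>

lemma torsionfree_iff:
  fixes M :: "('a, 'm, 'g) gr_module"
  assumes "graded_module G A M"
  shows "(\<forall>N. graded_submodule G A N M \<and> N \<noteq> {\<zero>\<^bsub>M\<^esub>} \<longrightarrow> part (gr_sub M N) \<noteq> {\<zero>\<^bsub>M\<^esub>}) \<longleftrightarrow>
    (\<forall>N. graded_submod G A N M \<longrightarrow> (\<forall>x\<in>N. \<forall>s\<in>S. hc M x s = \<zero>\<^bsub>M\<^esub>) \<longrightarrow> N \<subseteq> {\<zero>\<^bsub>M\<^esub>})"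
proof -
  interpret M: modular_mod G A M S U by (rule modular_modI) fact
  have *: "(part (gr_sub M N) = {\<zero>\<^bsub>M\<^esub>}) = (\<forall>x\<in>N. \<forall>s\<in>S. hc M x s = \<zero>\<^bsub>M\<^esub>)"
    "(N = {\<zero>\<^bsub>M\<^esub>}) = (N \<subseteq> {\<zero>\<^bsub>M\<^esub>})" if N: "graded_submod G A N M" for N
  proof -
    have NS: "submod A N M" and hN: "\<And>x t. x \<in> N \<Longrightarrow> t \<in> carrier G \<Longrightarrow> hc M x t \<in> N"
      using N by (auto simp: graded_submod_def)
    note NS = submodD[OF NS]
    have NM: "x \<in> carrier M" if "x \<in> N" for x using that NS(1) by blast
    have p: "part (gr_sub M N) = {x \<in> N. x \<in> part M}"
      using part_iff[OF M.gr_sub_graded(1)[OF N]] M.gr_sub_graded(2)[OF N] NM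
      by (auto simp: part_iff assms gr_sub_def)
    show "(N = {\<zero>\<^bsub>M\<^esub>}) = (N \<subseteq> {\<zero>\<^bsub>M\<^esub>})" using NS(2) by auto
    show "(part (gr_sub M N) = {\<zero>\<^bsub>M\<^esub>}) = (\<forall>x\<in>N. \<forall>s\<in>S. hc M x s = \<zero>\<^bsub>M\<^esub>)"
    proof
      assume L: "part (gr_sub M N) = {\<zero>\<^bsub>M\<^esub>}"
      show "\<forall>x\<in>N. \<forall>s\<in>S. hc M x s = \<zero>\<^bsub>M\<^esub>"
      proof (intro ballI)
        fix x s assume x: "x \<in> N" and s: "s \<in> S"
        then have sG: "s \<in> carrier G" using S_carrier by blast
        have "hc M x s \<in> part (gr_sub M N)"
          using part_hom[OF assms s M.Mg.hpart_in[OF NM[OF x] sG]] hN[OF x sG] by (simp add: p)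
        then show "hc M x s = \<zero>\<^bsub>M\<^esub>" using L by blast
      qed
    next
      assume R: "\<forall>x\<in>N. \<forall>s\<in>S. hc M x s = \<zero>\<^bsub>M\<^esub>"
      have "x = \<zero>\<^bsub>M\<^esub>" if "x \<in> N" "x \<in> part M" for x
        using that R M.Mg.hpart_inject[of x "\<zero>\<^bsub>M\<^esub>"] NM by (auto simp: part_iff assms M.Mg.hpart_zero)
      moreover have "\<zero>\<^bsub>M\<^esub> \<in> part M" using M.Mg.part_zero by (simp add: M.MS_simps)
      ultimately show "part (gr_sub M N) = {\<zero>\<^bsub>M\<^esub>}" using NS(2) unfolding p by blast
    qed
  qed
  show ?thesis
    unfolding M.graded_submodule_iff
  proof (rule iff_allI)
    fix N
    show "(graded_submod G A N M \<and> N \<noteq> {\<zero>\<^bsub>M\<^esub>} \<longrightarrow> part (gr_sub M N) \<noteq> {\<zero>\<^bsub>M\<^esub>}) \<longleftrightarrow>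
        (graded_submod G A N M \<longrightarrow> (\<forall>x\<in>N. \<forall>s\<in>S. hc M x s = \<zero>\<^bsub>M\<^esub>) \<longrightarrow> N \<subseteq> {\<zero>\<^bsub>M\<^esub>})"
      using *[of N] by argo
  qed
qed

lemma cat_G_iff:
  fixes M :: "('a, 'm, 'g) gr_module"
  shows "M \<in> Ob (cat_G G A S U) \<longleftrightarrow> graded_module G A M \<and> generated_in A T M \<and>
    (\<forall>N. graded_submod G A N M \<longrightarrow> (\<forall>x\<in>N. \<forall>s\<in>S. hc M x s = \<zero>\<^bsub>M\<^esub>) \<longrightarrow> N \<subseteq> {\<zero>\<^bsub>M\<^esub>})"
  using torsionfree_iff[of M] by (auto simp: cat_G_def full_subcat_def Gr_def)

lemma gr_sub_span_generated:
  assumes "graded_mod G A M" and M': "M' = gr_sub M (graded_mod.span G A M (\<Union>t\<in>T. mgr M t))"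
  shows "graded_module G A M'" "generated_in A T M'" "\<And>t. t \<in> T \<Longrightarrow> mgr M' t = mgr M t"
proof -
  interpret M: graded_mod G A M by fact
  let ?D = "\<Union>t\<in>T. mgr M t"
  have D: "?D \<subseteq> carrier M" "\<And>d. d \<in> ?D \<Longrightarrow> \<exists>s\<in>carrier G. d \<in> mgr M s"
    using T_carrier M.Mg.C_closed by blast+
  show g: "graded_module G A M'" unfolding M' by (rule M.gr_sub_graded(1)[OF M.span_graded[OF D(2)]])
  interpret M': graded_mod G A M' using g by unfold_locales
  show eq: "mgr M' t = mgr M t" if "t \<in> T" for t
    using that M.span_base[OF D(1)] by (auto simp: M' gr_sub_def)
  show "generated_in A T M'"
    unfolding generated_in_iff[OF A.ring_axioms M'.right_module]
  proof (intro allI impI)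
    fix N assume N: "submod A N M'" "\<forall>t\<in>T. mgr M' t \<subseteq> N"
    have "submod A N M"
      using N(1) M.span_closed[OF D(1)] by (auto simp: submod_def M' gr_sub_def)
    then have "M.span ?D \<subseteq> N" by (rule M.span_subset) (use N(2) eq in auto)
    then show "carrier M' \<subseteq> N" by (simp add: M' gr_sub_def)
  qed
qed

lemma ghom_gr_sub:
  assumes "submod A N M" shows "ghom G A (gr_sub M N) M (\<lambda>x. x)"
  using submodD(1)[OF assms] by (auto simp: ghom_def gr_sub_def)

text \<open>Two changes make \<open>M\<close> an object of \<open>cat_G\<close> without affecting
  its image. Passing to the span \<open>W\<close> is harmless because \<open>W\<close> already
  contains everything supported in \<open>S\<close>; dividing by \<open>N\<close> is harmless
  because no nonzero element supported in \<open>S\<close> lies in \<open>N\<close>.\<close>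

lemma Phi_reflect:
  fixes M :: "('a, 'm, 'g) gr_module"
  assumes M: "graded_module G A M" and gen: "generated_in B T (MS M)"
  obtains Q :: "('a, 'm, 'g) gr_module"
  where "Q \<in> Ob (cat_G G A S U)" "isomorphic (Gr G' Bt) (\<Phi> Q) (\<Phi> M)"
proof -
  interpret M: modular_mod G A M S U using M by (rule modular_modI)
  let ?D = "\<Union>t\<in>T. mgr M t"
  have D: "?D \<subseteq> carrier M" "\<And>d. d \<in> ?D \<Longrightarrow> \<exists>s\<in>carrier G. d \<in> mgr M s"
    using T_carrier M.Mg.C_closed by blast+
  define W where "W = M.span ?D"
  have gW: "graded_submod G A W M" unfolding W_def by (rule M.span_graded[OF D(2)])
  then have sW: "submod A W M" and hW: "\<And>x t. x \<in> W \<Longrightarrow> t \<in> carrier G \<Longrightarrow> hc M x t \<in> W"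
    by (auto simp: graded_submod_def)
  note WS = submodD[OF sW]
  have WM: "x \<in> carrier M" if "x \<in> W" for x using that WS(1) by blast
  \<comment> \<open>The components of a truncated product are zero or components of the product over
    \<open>A\<close>, so the elements of \<open>W\<close> supported in \<open>S\<close> form a
    submodule over \<open>B\<close>. It contains the degrees in \<open>T\<close>, which generate
    \<open>M_S\<close> by assumption.\<close>
  have part_W: "part M \<subseteq> W"
  proof -
    interpret X: graded_mod G B "MS M" using MS_graded[OF M] by unfold_locales
    have "submod B (part M \<inter> W) (MS M)"
    proof (rule submodI)
      fix x a assume x: "x \<in> part M \<inter> W" and a: "a \<in> carrier B"
      have c: "x \<in> carrier M" "a \<in> carrier A" using x a WM B_carrier by auto
      have "x \<cdot>\<^bsub>MS M\<^esub> a \<in> W"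
      proof (rule M.Mg.closed_of_hparts)
        show "x \<cdot>\<^bsub>MS M\<^esub> a \<in> carrier M" using ract_closed[OF M c] by (simp add: part_iff M)
        show "hc M (x \<cdot>\<^bsub>MS M\<^esub> a) t \<in> W" if "t \<in> carrier G" for t
          using that c ract_hpart[OF M c that] hW WS(2) WS(4)[of x a] x by auto
      qed (use WS in auto)
      then show "x \<cdot>\<^bsub>MS M\<^esub> a \<in> part M \<inter> W" using ract_closed[OF M c] by simp
    qed (use WS X.M.zero_closed X.M.a_closed in \<open>auto simp: mod_restrict_simps\<close>)
    moreover have "\<forall>t\<in>T. mgr (MS M) t \<subseteq> part M \<inter> W"
      using T_S M.span_base[OF D(1)] part_hom[OF M] by (auto simp: mod_restrict_simps W_def)
    ultimately show ?thesis
      using gen unfolding generated_in_iff[OF Bs.A.ring_axioms X.right_module] by blast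
  qed
  define M1 where "M1 = gr_sub M W"
  note M1g = gr_sub_span_generated[OF M.graded_mod_axioms M1_def[unfolded W_def]]
  interpret M1: modular_mod G A M1 S U using M1g(1) by (rule modular_modI)
  have M1s: "carrier M1 = W" "zero M1 = zero M" "add M1 = add M" "ract M1 = ract M"
    "\<And>t. mgr M1 t = mgr M t \<inter> W" by (simp_all add: M1_def gr_sub_def)
  have M1h: "hc M1 x t = hc M x t" if "x \<in> W" "t \<in> carrier G" for x t
    using M.gr_sub_graded(2)[OF gW that] by (simp add: M1_def)
  \<comment> \<open>the largest graded submodule without components in \<open>S\<close>\<close>
  define N where "N = {x \<in> W. \<forall>t\<in>carrier G. \<forall>k\<in>carrier G. \<forall>a\<in>agr A k.
      t \<otimes>\<^bsub>G\<^esub> k \<in> S \<longrightarrow> hc M1 x t \<cdot>\<^bsub>M\<^esub> a = \<zero>\<^bsub>M\<^esub>}"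
  have NI: "x \<in> N" if "x \<in> W"
    "\<And>t k a. t \<in> carrier G \<Longrightarrow> k \<in> carrier G \<Longrightarrow> a \<in> agr A k \<Longrightarrow> t \<otimes>\<^bsub>G\<^esub> k \<in> S \<Longrightarrow>
      hc M1 x t \<cdot>\<^bsub>M\<^esub> a = \<zero>\<^bsub>M\<^esub>" for x
    using that by (simp add: N_def)
  have ND: "x \<in> W" "\<And>t k a. t \<in> carrier G \<Longrightarrow> k \<in> carrier G \<Longrightarrow> a \<in> agr A k \<Longrightarrow> t \<otimes>\<^bsub>G\<^esub> k \<in> S \<Longrightarrow>
      hc M1 x t \<cdot>\<^bsub>M\<^esub> a = \<zero>\<^bsub>M\<^esub>" if "x \<in> N" for x
    using that by (auto simp: N_def)
  have hc1: "hc M1 x t \<in> W" if "x \<in> W" "t \<in> carrier G" for x t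
    using M1.Mg.hpart_closed that by (simp add: M1s)
  have N_zero: "\<zero>\<^bsub>M\<^esub> \<in> N"
  proof (rule NI)
    fix t k a assume "t \<in> carrier G" "k \<in> carrier G" "a \<in> agr A k"
    then show "hc M1 \<zero>\<^bsub>M\<^esub> t \<cdot>\<^bsub>M\<^esub> a = \<zero>\<^bsub>M\<^esub>"
      using M1.Mg.hpart_zero[of t] Ag.C_closed by (simp add: M1s)
  qed (rule WS(2))
  have N_add: "x \<oplus>\<^bsub>M\<^esub> y \<in> N" if xy: "x \<in> N" "y \<in> N" for x y
  proof (rule NI)
    fix t k a assume k: "t \<in> carrier G" "k \<in> carrier G" "a \<in> agr A k" "t \<otimes>\<^bsub>G\<^esub> k \<in> S"
    have "hc M1 (x \<oplus>\<^bsub>M\<^esub> y) t = hc M1 x t \<oplus>\<^bsub>M\<^esub> hc M1 y t"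
      using M1.Mg.hpart_add[of x y t] ND(1) xy k by (simp add: M1s)
    then show "hc M1 (x \<oplus>\<^bsub>M\<^esub> y) t \<cdot>\<^bsub>M\<^esub> a = \<zero>\<^bsub>M\<^esub>"
      using ND(2)[OF xy(1) k] ND(2)[OF xy(2) k] hc1[OF ND(1)] xy k Ag.C_closed[OF k(2,3)]
      by (simp add: M.act_add_left WM)
  qed (use WS(3) ND(1) xy in blast)
  \<comment> \<open>Here the quantification over all coefficients in \<open>N\<close> pays off: with
    \<open>r\<close> the degree \<open>t\<close> times the inverse of \<open>l\<close>, the
    component of \<open>x b\<close> in degree \<open>t\<close> is \<open>x_r b\<close>, and
    \<open>(x_r b) a = x_r (b a)\<close> has degree \<open>r(lk) = tk\<close>, again in
    \<open>S\<close>.\<close>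
  have N_act_hom: "x \<cdot>\<^bsub>M\<^esub> b \<in> N" if x: "x \<in> N" and b: "l \<in> carrier G" "b \<in> agr A l" for x b l
  proof (rule NI)
    fix t k a assume k: "t \<in> carrier G" "k \<in> carrier G" "a \<in> agr A k" "t \<otimes>\<^bsub>G\<^esub> k \<in> S"
    have tl: "t \<otimes>\<^bsub>G\<^esub> inv\<^bsub>G\<^esub> l \<in> carrier G" "l \<otimes>\<^bsub>G\<^esub> k \<in> carrier G" using k b by auto
    have eq: "t \<otimes>\<^bsub>G\<^esub> inv\<^bsub>G\<^esub> l \<otimes>\<^bsub>G\<^esub> (l \<otimes>\<^bsub>G\<^esub> k) = t \<otimes>\<^bsub>G\<^esub> k"
      using k b by (metis G.inv_closed G.inv_solve_right G.m_assoc G.m_closed)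
    have "hc M1 (x \<cdot>\<^bsub>M\<^esub> b) t = hc M1 x (t \<otimes>\<^bsub>G\<^esub> inv\<^bsub>G\<^esub> l) \<cdot>\<^bsub>M\<^esub> b"
      using M1.hpart_act[of x l b t] ND(1)[OF x] b k by (simp add: M1s)
    then show "hc M1 (x \<cdot>\<^bsub>M\<^esub> b) t \<cdot>\<^bsub>M\<^esub> a = \<zero>\<^bsub>M\<^esub>"
      using ND(2)[OF x tl mult_deg[OF b(1) k(2) b(2) k(3)]] eq k(4) hc1[OF ND(1)[OF x] tl(1)]
        Ag.C_closed[OF k(2,3)] Ag.C_closed[OF b] by (simp add: M.act_mult WM)
  qed (use WS(4) ND(1)[OF x] Ag.C_closed[OF b] in blast)
  have N_act: "x \<cdot>\<^bsub>M\<^esub> a \<in> N" if "x \<in> N" "a \<in> carrier A" for x a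
    by (rule M.act_hom_closed[of x N])
      (use that ND(1) WM N_zero N_add N_act_hom in auto)
  have gN: "graded_submod G A N M1"
    unfolding graded_submod_def
  proof (intro conjI ballI submodI)
    fix x t assume x: "x \<in> N" and t: "t \<in> carrier G"
    have x1: "x \<in> carrier M1" using ND(1)[OF x] by (simp add: M1s)
    show "hc M1 x t \<in> N"
    proof (rule NI)
      fix r k a assume k: "r \<in> carrier G" "k \<in> carrier G" "a \<in> agr A k" "r \<otimes>\<^bsub>G\<^esub> k \<in> S"
      show "hc M1 (hc M1 x t) r \<cdot>\<^bsub>M\<^esub> a = \<zero>\<^bsub>M\<^esub>"
        using M1.Mg.hpart_hom[OF t M1.Mg.hpart_in[OF x1 t] k(1)] ND(2)[OF x k]
          Ag.C_closed[OF k(2,3)] by (auto simp: M1s)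
    qed (use hc1 ND(1) x t in blast)
  qed (use N_zero N_add N_act ND(1) in \<open>auto simp: M1s\<close>)
  have "carrier M1 \<lesssim> (UNIV :: 'm set)" by (rule subset_imp_lepoll) simp
  then obtain Q :: "('a, 'm, 'g) gr_module" and q where Q: "graded_module G A Q" "ghom G A M1 Q q"
    "q ` carrier M1 = carrier Q" "\<And>x. x \<in> carrier M1 \<Longrightarrow> q x = \<zero>\<^bsub>Q\<^esub> \<longleftrightarrow> x \<in> N"
    by (rule M1.quotient_exists[OF gN]) (rule that)
  interpret Q: graded_mod G A Q using Q(1) by unfold_locales
  note q = ghomD[OF Q(2)] and q0 = ghom_zero[OF M1g(1) Q(1,2)] and qh = ghom_hpart[OF M1g(1) Q(1,2)]
  have "Q \<in> Ob (cat_G G A S U)"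
    unfolding cat_G_iff
  proof (intro conjI allI impI)
    show "generated_in A T Q"
      by (rule generated_in_ghom_image[OF M1g(1) Q(1-3) M1g(2) T_carrier])
    fix N' assume N': "graded_submod G A N' Q" "\<forall>x\<in>N'. \<forall>s\<in>S. hc Q x s = \<zero>\<^bsub>Q\<^esub>"
    have N'S: "submod A N' Q" and N'h: "\<And>x t. x \<in> N' \<Longrightarrow> t \<in> carrier G \<Longrightarrow> hc Q x t \<in> N'"
      using N'(1) by (auto simp: graded_submod_def)
    note N'S = submodD[OF N'S]
    show "N' \<subseteq> {\<zero>\<^bsub>Q\<^esub>}"
    proof
      fix y assume y: "y \<in> N'"
      then obtain x where x: "x \<in> carrier M1" "y = q x" using N'S(1) Q(3) by blast
      have "x \<in> N"
      proof (rule NI)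
        fix t k a assume k: "t \<in> carrier G" "k \<in> carrier G" "a \<in> agr A k" "t \<otimes>\<^bsub>G\<^esub> k \<in> S"
        have ac: "a \<in> carrier A" using k Ag.C_closed by blast
        have tk: "t \<otimes>\<^bsub>G\<^esub> k \<in> carrier G" using k by simp
        \<comment> \<open>The image of \<open>z\<close> lies in \<open>N'\<close> and is homogeneous
          of degree \<open>tk\<close> in \<open>S\<close>, hence zero. So \<open>z\<close> lies in
          \<open>N\<close>, and the coefficient \<open>1\<close> in the definition of
          \<open>N\<close> yields \<open>z = 0\<close>.\<close>
        define z where "z = hc M1 x t \<cdot>\<^bsub>M1\<^esub> a"
        have z: "z \<in> mgr M1 (t \<otimes>\<^bsub>G\<^esub> k)"
          unfolding z_def by (rule M1.act_deg[OF k(1,2) M1.Mg.hpart_in[OF x(1) k(1)] k(3)])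
        have zc: "z \<in> carrier M1" using M1.Mg.C_closed[OF tk z] .
        have "q z = hc Q y t \<cdot>\<^bsub>Q\<^esub> a"
          unfolding z_def using q(3)[OF M1.Mg.hpart_closed[OF x(1) k(1)] ac] qh[OF x(1) k(1)] x by simp
        then have "q z \<in> N'" using N'S(4)[OF N'h[OF y k(1)] ac] by simp
        moreover have "q z = hc Q (q z) (t \<otimes>\<^bsub>G\<^esub> k)"
          using Q.Mg.hpart_hom[OF tk q(4)[OF tk z] tk] by simp
        ultimately have "q z = \<zero>\<^bsub>Q\<^esub>" using N'(2) k(4) by simp
        then have "z \<in> N" using Q(4)[OF zc] by simp
        then have "hc M1 z (t \<otimes>\<^bsub>G\<^esub> k) \<cdot>\<^bsub>M\<^esub> \<one>\<^bsub>A\<^esub> = \<zero>\<^bsub>M\<^esub>"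
          using ND(2)[OF _ tk G.one_closed one_deg, of z] tk k(4) by simp
        then show "hc M1 x t \<cdot>\<^bsub>M\<^esub> a = \<zero>\<^bsub>M\<^esub>"
          using M1.Mg.hpart_hom[OF tk z tk] zc WM by (simp add: z_def M1s)
      qed (use x M1s in simp)
      then show "y \<in> {\<zero>\<^bsub>Q\<^esub>}" using Q(4)[OF x(1)] x(2) by simp
    qed
  qed (rule Q(1))
  moreover have "isomorphic (Gr G' Bt) (\<Phi> M1) (\<Phi> M)"
  proof (rule Phi_isomorphic[OF M1g(1) M])
    show "ghom G A M1 M (\<lambda>x. x)" unfolding M1_def by (rule ghom_gr_sub[OF sW])
    show "mgr M s \<subseteq> (\<lambda>x. x) ` carrier M1" if "s \<in> S" for s
      using part_hom[OF M that] part_W by (auto simp: M1s)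
  qed (simp add: M1s)
  moreover have "isomorphic (Gr G' Bt) (\<Phi> M1) (\<Phi> Q)"
  proof (rule Phi_isomorphic[OF M1g(1) Q(1,2)])
    fix x assume x: "x \<in> part M1" "q x = \<zero>\<^bsub>Q\<^esub>"
    then have xc: "x \<in> carrier M1" by (simp add: part_iff M1g(1))
    then have xN: "x \<in> N" using Q(4) x by simp
    \<comment> \<open>In degrees of \<open>S\<close> the coefficient \<open>1\<close> in the
      definition of \<open>N\<close> kills the component; elsewhere \<open>x\<close> has
      none.\<close>
    have "hc M1 x t = \<zero>\<^bsub>M1\<^esub>" if t: "t \<in> carrier G" for t
    proof (cases "t \<in> S")
      case True
      then show ?thesis
        using ND(2)[OF xN t G.one_closed one_deg] t hc1[of x t] xc WM by (simp add: M1s)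
    qed (use x t in \<open>simp add: part_iff M1g(1)\<close>)
    then show "x = \<zero>\<^bsub>M1\<^esub>"
      using M1.Mg.hpart_inject[OF xc M1.M.zero_closed] by (simp add: M1.Mg.hpart_zero)
  next
    show "mgr Q s \<subseteq> q ` carrier M1" if "s \<in> S" for s
      using that S_carrier Q.Mg.C_closed Q(3) by auto
  qed
  ultimately show thesis
    using that Bt.isomorphic_Gr_trans[OF Bt.isomorphic_Gr_sym] Phi_graded[OF M]
      Phi_graded[OF M1g(1)] Phi_graded[OF Q(1)] by metis
qed

text \<open>An object of the target category is given through some \<open>X\<close> isomorphic to an
  \<open>M_S\<close>. Generation in degrees \<open>T\<close> passes along that isomorphism and
  regrading preserves it, so \<open>X\<close> can be eliminated in favour of
  \<open>M\<close>.\<close>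

lemma cat_L_tildeE:
  fixes V :: "('a, 'm, 'h) gr_module"
  assumes "V \<in> Ob (cat_L_tilde G' G A \<phi> g S U)"
  obtains M :: "('a, 'm, 'g) gr_module" where "graded_module G' Bt V" "graded_module G A M"
    "generated_in B T (MS M)" "isomorphic (Gr G' Bt) (\<Phi> M) V"
proof -
  obtain X M :: "('a, 'm, 'g) gr_module" where V: "graded_module G' Bt V"
    "isomorphic (Gr G' Bt) V (mod_tilde G g \<phi> X)"
    and X: "graded_module G B X" "generated_in B T X" and M: "graded_module G A M"
    and iso: "isomorphic (Gr G B) X (MS M)"
    using assms by (auto simp: cat_L_tilde_def cat_L_def full_subcat_def Let_def Gr_def)
  obtain u v where u: "ghom G B X (MS M) u" "ghom G B (MS M) X v"
    "\<And>x. x \<in> carrier X \<Longrightarrow> v (u x) = x" "\<And>y. y \<in> part M \<Longrightarrow> u (v y) = y"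
    using isomorphic_GrE[OF iso] by metis
  interpret X: graded_mod G B X using X(1) by unfold_locales
  note gMS = MS_graded[OF M]
  \<comment> \<open>Regrading yields a graded module only for \<open>X\<close> supported in
    \<open>S\<close>; this is inherited from \<open>M_S\<close>.\<close>
  have supp: "mgr X t \<subseteq> {\<zero>\<^bsub>X\<^esub>}" if t: "t \<in> carrier G - S" for t
  proof
    fix x assume x: "x \<in> mgr X t"
    have "u x \<in> mgr (MS M) t" using ghomD(4)[OF u(1) _ x] t by simp
    then have "u x = \<zero>\<^bsub>MS M\<^esub>" using MS_support[OF t, of M] by auto
    then have "v (u x) = \<zero>\<^bsub>X\<^esub>" using Bs.ghom_zero[OF gMS X(1) u(2)] by simp
    then show "x \<in> {\<zero>\<^bsub>X\<^esub>}" using u(3) X.Mg.C_closed x t by auto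
  qed
  have "u ` carrier X = part M"
    using u(4) ghomD(1)[OF u(1)] ghomD(1)[OF u(2)] by force
  then have "generated_in B T (MS M)"
    by (rule Bs.generated_in_ghom_image[OF X(1) gMS u(1) _ X(2) T_carrier])
  moreover have gX: "graded_module G' Bt (mod_tilde G g \<phi> X)"
    by (rule mod_tilde_graded_module(1)[OF X(1) supp])
  have "isomorphic (Gr G' Bt) (mod_tilde G g \<phi> X) (\<Phi> M)"
    unfolding Phi_ob_def
    by (rule isomorphic_GrI[OF ghom_tilde[OF u(1)] ghom_tilde[OF u(2)]])
      (use u(3,4) gX Phi_graded[OF M] Bt.graded_ring_axioms in
        \<open>simp_all add: mod_tilde_simps Phi_ob_def\<close>)
  then have "isomorphic (Gr G' Bt) (\<Phi> M) V"
    using V(1) gX Phi_graded[OF M]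
    by (intro Bt.isomorphic_Gr_sym[OF Bt.isomorphic_Gr_trans[OF V(2)]])
  ultimately show thesis using that V(1) M by blast
qed

lemma isomorphic_generated:
  assumes "isomorphic (Gr G' Bt) X V" "graded_module G' Bt X" "graded_module G' Bt V"
    and "generated_in Bt H' X"
  shows "generated_in Bt H' V"
proof -
  obtain u v where u: "ghom G' Bt X V u" "ghom G' Bt V X v"
    "\<And>x. x \<in> carrier X \<Longrightarrow> v (u x) = x" "\<And>y. y \<in> carrier V \<Longrightarrow> u (v y) = y"
    using isomorphic_GrE[OF assms(1)] by metis
  have "u ` carrier X = carrier V"
    using u(4) ghomD(1)[OF u(1)] ghomD(1)[OF u(2)] by force
  then show ?thesis
    by (rule Bt.generated_in_ghom_image[OF assms(2,3) u(1) _ assms(4) H'_carrier])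
qed

lemma cat_L_tilde_generated:
  fixes V :: "('a, 'm, 'h) gr_module"
  assumes "V \<in> Ob (cat_L_tilde G' G A \<phi> g S U)"
  shows "generated_in Bt H' V"
proof -
  obtain M :: "('a, 'm, 'g) gr_module" where M: "graded_module G' Bt V" "graded_module G A M"
    "generated_in B T (MS M)" "isomorphic (Gr G' Bt) (\<Phi> M) V"
    using assms by (rule cat_L_tildeE)
  have "generated_in Bt H' (\<Phi> M)"
    unfolding Phi_ob_def by (rule generated_in_tilde[OF MS_graded[OF M(2)] MS_support M(3)])
  then show ?thesis by (rule isomorphic_generated[OF M(4) Phi_graded[OF M(2)] M(1)])
qed

lemma Phi_equivalence:
  "is_equivalence
      (cat_G G A S U :: (('a, 'm, 'g) gr_module, 'm \<Rightarrow> 'm) cat)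
      (cat_L_tilde G' G A \<phi> g S U :: (('a, 'm, 'h) gr_module, 'm \<Rightarrow> 'm) cat)
      (Phi_ob G A \<phi> g S) (Phi_mor G A S)"
proof (rule is_equivalence_of_full_faithful)
  let ?C = "cat_G G A S U :: (('a, 'm, 'g) gr_module, 'm \<Rightarrow> 'm) cat"
  let ?D = "cat_L_tilde G' G A \<phi> g S U :: (('a, 'm, 'h) gr_module, 'm \<Rightarrow> 'm) cat"
  have Cs: "Hom ?C = gr_hom G A" "Idm ?C = (\<lambda>M. \<lambda>x\<in>carrier M. x)"
    "Cmp ?C = (\<lambda>M N L v u. compose (carrier M) v u)"
    by (simp_all add: cat_G_def full_subcat_def Gr_def)
  have Ds: "Hom ?D = gr_hom G' Bt" "Idm ?D = (\<lambda>M. \<lambda>x\<in>carrier M. x)"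
    "Cmp ?D = (\<lambda>M N L v u. compose (carrier M) v u)"
    by (simp_all add: cat_L_tilde_def full_subcat_def Gr_def Let_def)
  show "category ?C" unfolding cat_G_def by (intro category_full_subcat category_Gr)
  show "category ?D" unfolding cat_L_tilde_def Let_def
    by (intro category_full_subcat Bt.category_Gr)
  have part_sub: "part M \<subseteq> carrier M" if "M \<in> Ob ?C" for M
    using that by (auto simp: cat_G_iff part_iff)
  show "is_functor ?C ?D \<Phi> (Phi_mor G A S)"
    unfolding is_functor_def Cs Ds
  proof (intro conjI ballI)
    fix X assume X: "X \<in> Ob ?C"
    show "\<Phi> X \<in> Ob ?D" by (rule Phi_in_L(1)) (use X in \<open>simp_all add: cat_G_iff\<close>)
    show "Phi_mor G A S X X (\<lambda>x\<in>carrier X. x) = (\<lambda>x\<in>carrier (\<Phi> X). x)"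
      using part_sub[OF X] by (auto simp: Phi_mor_def Phi_simps fun_eq_iff)
    fix Y assume Y: "Y \<in> Ob ?C"
    fix u assume u: "u \<in> gr_hom G A X Y"
    have Pu: "ghom G' Bt (\<Phi> X) (\<Phi> Y) u"
      using u X Y ghom_Phi by (auto simp: cat_G_iff gr_hom_iff)
    interpret PX: graded_mod G' Bt "\<Phi> X"
      using X Phi_graded by unfold_locales (auto simp: cat_G_iff)
    show "Phi_mor G A S X Y u \<in> gr_hom G' Bt (\<Phi> X) (\<Phi> Y)"
      unfolding gr_hom_iff
    proof
      show "ghom G' Bt (\<Phi> X) (\<Phi> Y) (Phi_mor G A S X Y u)"
        by (rule ghomI) (use ghomD[OF Pu] PX.M.a_closed PX.act_closed PX.Mg.C_closed in
            \<open>simp_all add: Phi_mor_def Phi_simps\<close>)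
    qed (simp add: Phi_mor_def Phi_simps)
    fix Z v
    show "Phi_mor G A S X Z (compose (carrier X) v u) =
        compose (carrier (\<Phi> X)) (Phi_mor G A S Y Z v) (Phi_mor G A S X Y u)"
      using part_sub[OF X] ghomD(1)[OF Pu]
      by (auto simp: Phi_mor_def Phi_simps compose_def fun_eq_iff)
  qed
  fix X Y assume X: "X \<in> Ob ?C" and Y: "Y \<in> Ob ?C"
  show "\<exists>u\<in>Hom ?C X Y. Phi_mor G A S X Y u = w" if w: "w \<in> Hom ?D (\<Phi> X) (\<Phi> Y)" for w
  proof -
    have w': "ghom G' Bt (\<Phi> X) (\<Phi> Y) w" using w by (simp add: Ds gr_hom_iff)
    note X' = X[unfolded cat_G_iff] and Y' = Y[unfolded cat_G_iff]
    have tf: "N \<subseteq> {\<zero>\<^bsub>Y\<^esub>}" if "graded_submod G A N Y"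
      "\<And>x s. x \<in> N \<Longrightarrow> s \<in> S \<Longrightarrow> hc Y x s = \<zero>\<^bsub>Y\<^esub>" for N
      using conjunct2[OF conjunct2[OF Y']] that by simp
    obtain F where F: "ghom G A X Y F" "\<And>x. x \<in> part X \<Longrightarrow> F x = w x"
      using Phi_full[OF conjunct1[OF X'] conjunct1[OF conjunct2[OF X']] conjunct1[OF Y'] tf w'] by metis
    interpret X: graded_mod G A X using X by unfold_locales (simp add: cat_G_iff)
    have "restrict F (carrier X) \<in> gr_hom G A X Y"
      using ghomD[OF F(1)] X.Mg.C_closed by (auto simp: gr_hom_iff intro!: ghomI)
    moreover have "Phi_mor G A S X Y (restrict F (carrier X)) = w"
      using w F(2) part_sub[OF X]
      by (auto simp: Phi_mor_def Ds gr_hom_iff Phi_simps fun_eq_iff extensional_def)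
    ultimately show ?thesis unfolding Cs by blast
  qed
  show "u = v" if uv: "u \<in> Hom ?C X Y" "v \<in> Hom ?C X Y" "Phi_mor G A S X Y u = Phi_mor G A S X Y v"
    for u v
  proof (rule extensionalityI)
    show "u \<in> extensional (carrier X)" "v \<in> extensional (carrier X)"
      using uv by (simp_all add: Cs gr_hom_iff)
    have "u x = v x" if "t \<in> T" "x \<in> mgr X t" for t x
    proof -
      have "x \<in> part X" using part_hom[of X t x] that T_S X by (auto simp: cat_G_iff)
      then show ?thesis using fun_cong[OF uv(3), of x] by (simp add: Phi_mor_def)
    qed
    then show "u x = v x" if "x \<in> carrier X" for x
      using ghom_eq_of_generated[of X Y u v T] uv X Y that T_carrier
      by (auto simp: cat_G_iff Cs gr_hom_iff)
  qed
next
  fix V :: "('a, 'm, 'h) gr_module" assume "V \<in> Ob (cat_L_tilde G' G A \<phi> g S U)"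
  then obtain M :: "('a, 'm, 'g) gr_module" where M: "graded_module G' Bt V" "graded_module G A M"
    "generated_in B T (MS M)" "isomorphic (Gr G' Bt) (\<Phi> M) V"
    by (rule cat_L_tildeE)
  obtain Q :: "('a, 'm, 'g) gr_module"
    where Q: "Q \<in> Ob (cat_G G A S U)" "isomorphic (Gr G' Bt) (\<Phi> Q) (\<Phi> M)"
    using Phi_reflect[OF M(2,3)] .
  have gQ: "graded_module G' Bt (\<Phi> Q)" using Q Phi_graded by (auto simp: cat_G_iff)
  have "isomorphic (Gr G' Bt) (\<Phi> Q) V"
    by (rule Bt.isomorphic_Gr_trans[OF Q(2) M(4) gQ M(1)])
  then have "isomorphic (cat_L_tilde G' G A \<phi> g S U) (\<Phi> Q) V"
    by (simp add: isomorphic_def is_iso_def cat_L_tilde_def full_subcat_def Let_def)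
  then show "\<exists>X\<in>Ob (cat_G G A S U). isomorphic (cat_L_tilde G' G A \<phi> g S U) (\<Phi> X) V"
    using Q(1) by blast
qed

end

section \<open>Free modules and presentations\<close>

lemma infinite_times_lepoll:
  assumes "infinite C" "A \<lesssim> C" "B \<lesssim> C" shows "A \<times> B \<lesssim> C"
proof -
  have "C \<times> C \<lesssim> C"
    using card_of_Times_same_infinite[OF assms(1)] ordIso_imp_ordLeq
    unfolding lepoll_def card_of_ordLeq by blast
  then show ?thesis using times_lepoll_mono[OF assms(2,3)] lepoll_trans by blast
qed

text \<open>Sort finite subsets by size: those of size \<open>n + 1\<close> arise by inserting a
  point into those of size \<open>n\<close>, so each class embeds in \<open>C\<close>, and a
  countable union of such classes still does.\<close>

lemma infinite_Fpow_lepoll: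
  assumes "infinite C" shows "Fpow C \<lesssim> C"
proof -
  define L where "L n = {F. F \<subseteq> C \<and> finite F \<and> card F = n}" for n
  have "L n \<lesssim> C" for n
  proof (induction n)
    case 0
    have "L 0 \<subseteq> {{}}" by (auto simp: L_def)
    moreover have "{{}} \<lesssim> C" using assms finite_lepoll_infinite by blast
    ultimately show ?case using subset_imp_lepoll lepoll_trans by blast
  next
    case (Suc n)
    have "L (Suc n) \<subseteq> (\<lambda>(x, F). insert x F) ` (C \<times> L n)"
    proof
      fix F assume F: "F \<in> L (Suc n)"
      then obtain x F' where "F = insert x F'" "x \<notin> F'" "card F' = n"
        by (auto simp: L_def card_Suc_eq)
      then show "F \<in> (\<lambda>(x, F). insert x F) ` (C \<times> L n)" using F by (auto simp: L_def)
    qed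
    then have "L (Suc n) \<lesssim> C \<times> L n"
      using image_lepoll lepoll_trans subset_imp_lepoll by metis
    then show ?case using infinite_times_lepoll[OF assms lepoll_refl Suc] lepoll_trans by blast
  qed
  then have "(card_of (L n), card_of C) \<in> ordLeq" for n unfolding lepoll_def card_of_ordLeq .
  moreover have "(card_of (UNIV :: nat set), card_of C) \<in> ordLeq" using assms infinite_iff_card_of_nat by blast
  ultimately have "(card_of (\<Union>n. L n), card_of C) \<in> ordLeq" using card_of_UNION_ordLeq_infinite[OF assms] by blast
  then have "(\<Union>n. L n) \<lesssim> C" unfolding lepoll_def card_of_ordLeq .
  moreover have "Fpow C \<subseteq> (\<Union>n. L n)" by (auto simp: Fpow_def L_def)
  ultimately show ?thesis using subset_imp_lepoll lepoll_trans by blast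
qed

lemma (in graded_group) C_finsum:
  assumes "k \<in> I" "\<And>i. i \<in> E \<Longrightarrow> f i \<in> C k" shows "(\<Oplus>i\<in>E. f i) \<in> C k"
  using assms(2)
proof (induction E rule: infinite_finite_induct)
  case (insert i E)
  then have "f \<in> E \<rightarrow> carrier M" "f i \<in> carrier M" using C_closed assms(1) by auto
  then show ?case using insert C_add assms(1) by simp
qed (use C_zero assms(1) in \<open>auto simp: add.finprod_infinite\<close>)

lemma (in right_mod) finsum_act:
  assumes "\<And>i. i \<in> E \<Longrightarrow> f i \<in> carrier M" "a \<in> carrier A"
  shows "finsum M f E \<cdot>\<^bsub>M\<^esub> a = finsum M (\<lambda>i. f i \<cdot>\<^bsub>M\<^esub> a) E"
  using assms(1)
proof (induction E rule: infinite_finite_induct)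
  case (insert i E)
  then have "f \<in> E \<rightarrow> carrier M" "(\<lambda>i. f i \<cdot>\<^bsub>M\<^esub> a) \<in> E \<rightarrow> carrier M" using assms(2) by auto
  then show ?case using insert assms(2) by (simp add: act_add_left)
qed (use assms(2) in \<open>auto simp: M.add.finprod_infinite\<close>)

text \<open>The basis element with index \<open>j\<close> has degree \<open>d j\<close>; hence the
  coefficient at \<open>j\<close> of an element of degree \<open>t\<close> has degree
  \<open>d j\<close> inverse times \<open>t\<close>. Vanishing off \<open>J\<close> makes functions
  that agree on \<open>J\<close> equal.\<close>

definition free_module ::
  "('g, 'y) monoid_scheme \<Rightarrow> ('k, 'a, 'g) gr_algebra \<Rightarrow> 'j set \<Rightarrow> ('j \<Rightarrow> 'g) \<Rightarrow> ('a, 'j \<Rightarrow> 'a, 'g) gr_module"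
  where "free_module G A J d = \<lparr>carrier = {f. (\<forall>j\<in>J. f j \<in> carrier A) \<and> (\<forall>j. j \<notin> J \<longrightarrow> f j = \<zero>\<^bsub>A\<^esub>) \<and>
       finite {j. f j \<noteq> \<zero>\<^bsub>A\<^esub>}}, mult = undefined, one = undefined, zero = (\<lambda>j. \<zero>\<^bsub>A\<^esub>),
     add = (\<lambda>f f' j. f j \<oplus>\<^bsub>A\<^esub> f' j), ract = (\<lambda>f a j. f j \<otimes>\<^bsub>A\<^esub> a),
     mgr = (\<lambda>t. {f. (\<forall>j\<in>J. f j \<in> agr A (inv\<^bsub>G\<^esub> (d j) \<otimes>\<^bsub>G\<^esub> t)) \<and> (\<forall>j. j \<notin> J \<longrightarrow> f j = \<zero>\<^bsub>A\<^esub>) \<and>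
       finite {j. f j \<noteq> \<zero>\<^bsub>A\<^esub>}})\<rparr>"

text \<open>A finitely supported function is determined by its graph over the support, a finite
  subset of \<open>J \<times> carrier A\<close>.\<close>

lemma free_module_lepoll:
  assumes "infinite (UNIV :: 'm set)" "J \<lesssim> (UNIV :: 'm set)" "carrier A \<lesssim> (UNIV :: 'm set)"
  shows "carrier (free_module G A J d) \<lesssim> (UNIV :: 'm set)"
proof -
  have "carrier (free_module G A J d) \<subseteq>
      {f. f ` J \<subseteq> carrier A \<and> {x. f x \<noteq> \<zero>\<^bsub>A\<^esub>} \<subseteq> J \<and> finite {x. f x \<noteq> \<zero>\<^bsub>A\<^esub>}}"
    by (auto simp: free_module_def)
  moreover have "Fpow (J \<times> carrier A) \<lesssim> (UNIV :: 'm set)"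
  proof -
    obtain h :: "_ \<Rightarrow> 'm" where h: "inj_on h (J \<times> carrier A)"
      using infinite_times_lepoll[OF assms] by (auto simp: lepoll_def)
    have "inj_on (image h) (Fpow (J \<times> carrier A))"
      using inj_on_image_Fpow[OF h] .
    then have "Fpow (J \<times> carrier A) \<lesssim> Fpow (UNIV :: 'm set)"
      unfolding lepoll_def by (intro exI[of _ "image h"]) (auto simp: Fpow_def)
    then show ?thesis using infinite_Fpow_lepoll[OF assms(1)] lepoll_trans by blast
  qed
  ultimately show ?thesis
    by (rule lepoll_trans[OF subset_imp_lepoll lepoll_trans[OF lepoll_restricted_funspace]])
qed

locale free_setup = graded_ring G A
  for G :: "('g, 'y) monoid_scheme" and A :: "('k, 'a, 'g) gr_algebra" +
  fixes J :: "'j set" and d :: "'j \<Rightarrow> 'g"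
  assumes d_closed: "j \<in> J \<Longrightarrow> d j \<in> carrier G"
begin

abbreviation "F \<equiv> free_module G A J d"

lemma F_simps:
  "f \<in> carrier F \<longleftrightarrow> (\<forall>j\<in>J. f j \<in> carrier A) \<and> (\<forall>j. j \<notin> J \<longrightarrow> f j = \<zero>\<^bsub>A\<^esub>) \<and> finite {j. f j \<noteq> \<zero>\<^bsub>A\<^esub>}"
  "zero F = (\<lambda>j. \<zero>\<^bsub>A\<^esub>)" "f \<oplus>\<^bsub>F\<^esub> f' = (\<lambda>j. f j \<oplus>\<^bsub>A\<^esub> f' j)" "f \<cdot>\<^bsub>F\<^esub> a = (\<lambda>j. f j \<otimes>\<^bsub>A\<^esub> a)"
  by (simp_all add: free_module_def)

lemma F_closed: "f \<in> carrier F \<Longrightarrow> f j \<in> carrier A"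
  by (cases "j \<in> J") (auto simp: F_simps)

lemma F_supp:
  assumes "f \<in> carrier F" "f' \<in> carrier F" "\<And>j. f j = \<zero>\<^bsub>A\<^esub> \<Longrightarrow> f' j = \<zero>\<^bsub>A\<^esub> \<Longrightarrow> h j = \<zero>\<^bsub>A\<^esub>"
    and "\<And>j. j \<in> J \<Longrightarrow> h j \<in> carrier A"
  shows "h \<in> carrier F"
proof -
  have "finite ({j. f j \<noteq> \<zero>\<^bsub>A\<^esub>} \<union> {j. f' j \<noteq> \<zero>\<^bsub>A\<^esub>})" using assms(1,2) by (simp add: F_simps)
  then have "finite {j. h j \<noteq> \<zero>\<^bsub>A\<^esub>}" by (rule rev_finite_subset) (use assms(3) in auto)
  moreover have "h j = \<zero>\<^bsub>A\<^esub>" if "j \<notin> J" for j using assms(1-3) that by (simp add: F_simps)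
  ultimately show ?thesis using assms(4) by (simp add: F_simps)
qed

lemma free_module_graded: "graded_module G A F"
  and free_module_hpart: "\<And>f t j. f \<in> carrier F \<Longrightarrow> t \<in> carrier G \<Longrightarrow> j \<in> J \<Longrightarrow>
    hpart F (carrier G) (mgr F) f t j = Ag.hp (f j) (inv\<^bsub>G\<^esub> (d j) \<otimes>\<^bsub>G\<^esub> t)"
proof -
  have di: "inv\<^bsub>G\<^esub> (d j) \<otimes>\<^bsub>G\<^esub> t \<in> carrier G" if "j \<in> J" "t \<in> carrier G" for j t
    using that d_closed by simp
  have add_closed: "f \<oplus>\<^bsub>F\<^esub> f' \<in> carrier F" if "f \<in> carrier F" "f' \<in> carrier F" for f f'
    by (rule F_supp[OF that]) (simp_all add: F_simps(3) F_closed that)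
  have act_closed: "f \<cdot>\<^bsub>F\<^esub> a \<in> carrier F" if "f \<in> carrier F" "a \<in> carrier A" for f a
    by (rule F_supp[OF that(1) that(1)]) (simp_all add: F_simps(4) F_closed that)
  have zero_closed: "\<zero>\<^bsub>F\<^esub> \<in> carrier F" by (simp add: F_simps)
  interpret F: abelian_group F
  proof (rule abelian_groupI)
    fix f assume f: "f \<in> carrier F"
    have "(\<lambda>j. \<ominus>\<^bsub>A\<^esub> f j) \<in> carrier F"
      using A.minus_equality[of "\<zero>\<^bsub>A\<^esub>" "\<zero>\<^bsub>A\<^esub>"] by (intro F_supp[OF f f]) (auto simp: F_closed f)
    then show "\<exists>f'\<in>carrier F. f' \<oplus>\<^bsub>F\<^esub> f = \<zero>\<^bsub>F\<^esub>"
      by (rule bexI[rotated]) (simp add: F_simps(2,3) A.l_neg F_closed[OF f])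
  qed (use add_closed zero_closed in \<open>simp_all add: F_simps(2,3) A.a_ac F_closed\<close>)
  have rm: "right_module A F"
    unfolding right_module_def using F.abelian_group_axioms act_closed
    by (auto simp: F_simps(3,4) A.l_distr A.r_distr A.m_assoc F_closed)
  define p where "p f t j = (if j \<in> J then Ag.hp (f j) (inv\<^bsub>G\<^esub> (d j) \<otimes>\<^bsub>G\<^esub> t) else \<zero>\<^bsub>A\<^esub>)" for f t j
  have p_closed: "p f t \<in> carrier F" if "f \<in> carrier F" "t \<in> carrier G" for f t
    by (rule F_supp[OF that(1) that(1)])
      (use that di in \<open>auto simp: p_def Ag.hpart_zero Ag.hpart_closed F_closed\<close>)
  have ds: "direct_sum_of F (carrier G) (mgr F) \<and>
      (\<forall>f\<in>carrier F. \<forall>t\<in>carrier G. hpart F (carrier G) (mgr F) f t = p f t)"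
  proof (rule F.direct_sum_of_projections)
    fix f t assume f: "f \<in> carrier F" and t: "t \<in> carrier G"
    show "p f t \<in> carrier F" using p_closed f t .
    show "p (f \<oplus>\<^bsub>F\<^esub> f') t = p f t \<oplus>\<^bsub>F\<^esub> p f' t" if "f' \<in> carrier F" for f'
      using f t that di by (auto simp: p_def F_simps(3) Ag.hpart_add F_closed)
    show "p (p f t) r = (if t = r then p f t else \<zero>\<^bsub>F\<^esub>)" if r: "r \<in> carrier G" for r
    proof
      fix j
      show "p (p f t) r j = (if t = r then p f t else \<zero>\<^bsub>F\<^esub>) j"
      proof (cases "j \<in> J")
        case True
        have "inv\<^bsub>G\<^esub> (d j) \<otimes>\<^bsub>G\<^esub> r = inv\<^bsub>G\<^esub> (d j) \<otimes>\<^bsub>G\<^esub> t \<longleftrightarrow> t = r"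
          using d_closed[OF True] t r by auto
        then show ?thesis
          using Ag.hpart_hom[OF di[OF True t] Ag.hpart_in[OF F_closed[OF f] di[OF True t]] di[OF True r]] True
          by (simp add: p_def F_simps(2))
      qed (simp add: p_def F_simps(2))
    qed
  next
    fix f assume f: "f \<in> carrier F"
    \<comment> \<open>Degrees occurring in \<open>f\<close> are products of \<open>d j\<close>, for
      \<open>j\<close> in the support, with a degree occurring in the coefficient at
      \<open>j\<close>; there are finitely many of both.\<close>
    have "{t \<in> carrier G. p f t \<noteq> \<zero>\<^bsub>F\<^esub>} \<subseteq>
        (\<Union>j\<in>{j \<in> J. f j \<noteq> \<zero>\<^bsub>A\<^esub>}. (\<lambda>u. d j \<otimes>\<^bsub>G\<^esub> u) ` hsupp A (carrier G) (agr A) (f j))"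
    proof
      fix t assume "t \<in> {t \<in> carrier G. p f t \<noteq> \<zero>\<^bsub>F\<^esub>}"
      then obtain j where j: "t \<in> carrier G" "j \<in> J" "Ag.hp (f j) (inv\<^bsub>G\<^esub> (d j) \<otimes>\<^bsub>G\<^esub> t) \<noteq> \<zero>\<^bsub>A\<^esub>"
        by (auto simp: p_def F_simps(2) fun_eq_iff split: if_splits)
      then have "f j \<noteq> \<zero>\<^bsub>A\<^esub>" using di Ag.hpart_zero by auto
      moreover have "t = d j \<otimes>\<^bsub>G\<^esub> (inv\<^bsub>G\<^esub> (d j) \<otimes>\<^bsub>G\<^esub> t)" using j d_closed by (simp flip: G.m_assoc)
      moreover have "inv\<^bsub>G\<^esub> (d j) \<otimes>\<^bsub>G\<^esub> t \<in> hsupp A (carrier G) (agr A) (f j)"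
        using j di by (simp add: hsupp_def)
      ultimately show "t \<in> (\<Union>j\<in>{j \<in> J. f j \<noteq> \<zero>\<^bsub>A\<^esub>}.
          (\<lambda>u. d j \<otimes>\<^bsub>G\<^esub> u) ` hsupp A (carrier G) (agr A) (f j))" using j(2) by blast
    qed
    moreover have "finite {j \<in> J. f j \<noteq> \<zero>\<^bsub>A\<^esub>}"
      using f by (auto simp: F_simps intro: finite_subset[of _ "{j. f j \<noteq> \<zero>\<^bsub>A\<^esub>}"])
    ultimately show "finite {t \<in> carrier G. p f t \<noteq> \<zero>\<^bsub>F\<^esub>}"
      using Ag.finite_hsupp F_closed[OF f] by (elim finite_subset) auto
    show "f = \<zero>\<^bsub>F\<^esub>" if z: "\<And>t. t \<in> carrier G \<Longrightarrow> p f t = \<zero>\<^bsub>F\<^esub>"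
    proof
      fix j
      show "f j = \<zero>\<^bsub>F\<^esub> j"
      proof (cases "j \<in> J")
        case True
        have "Ag.hp (f j) u = \<zero>\<^bsub>A\<^esub>" if u: "u \<in> carrier G" for u
          using fun_cong[OF z[of "d j \<otimes>\<^bsub>G\<^esub> u"], of j] True u d_closed[OF True]
          by (simp add: p_def F_simps(2) flip: G.m_assoc)
        then show ?thesis
          using Ag.hpart_inject[of "f j" "\<zero>\<^bsub>A\<^esub>"] F_closed[OF f] by (simp add: F_simps(2) Ag.hpart_zero)
      qed (use f in \<open>simp add: F_simps\<close>)
    qed
  next
    fix t assume t: "t \<in> carrier G"
    have "f j \<in> agr A (inv\<^bsub>G\<^esub> (d j) \<otimes>\<^bsub>G\<^esub> t) \<longleftrightarrow> f j \<in> carrier A \<and> p f t j = f j" if "j \<in> J" for f j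
      using Ag.hpart_hom[OF di[OF that t] _ di[OF that t]] Ag.hpart_in[OF _ di[OF that t]]
        Ag.C_closed[OF di[OF that t]] that by (auto simp: p_def) metis
    then show "mgr F t = {f \<in> carrier F. p f t = f}"
      by (auto simp: free_module_def p_def fun_eq_iff)
  qed
  show "hpart F (carrier G) (mgr F) f t j = Ag.hp (f j) (inv\<^bsub>G\<^esub> (d j) \<otimes>\<^bsub>G\<^esub> t)"
    if "f \<in> carrier F" "t \<in> carrier G" "j \<in> J" for f t j
    using ds that by (simp add: p_def)
  have "f \<cdot>\<^bsub>F\<^esub> a \<in> mgr F (s \<otimes>\<^bsub>G\<^esub> t)"
    if st: "s \<in> carrier G" "t \<in> carrier G" and fa: "f \<in> mgr F s" "a \<in> agr A t" for s t f a
  proof -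
    have ac: "a \<in> carrier A" using fa Ag.C_closed st by blast
    have "f j \<otimes>\<^bsub>A\<^esub> a \<in> agr A (inv\<^bsub>G\<^esub> (d j) \<otimes>\<^bsub>G\<^esub> (s \<otimes>\<^bsub>G\<^esub> t))" if "j \<in> J" for j
      using mult_deg[OF di[OF that st(1)] st(2), of "f j" a] fa that st d_closed
      by (simp add: free_module_def G.m_assoc)
    moreover have "finite {j. f j \<otimes>\<^bsub>A\<^esub> a \<noteq> \<zero>\<^bsub>A\<^esub>}"
      using fa ac by (auto simp: free_module_def intro: finite_subset[of _ "{j. f j \<noteq> \<zero>\<^bsub>A\<^esub>}"])
    ultimately show ?thesis using fa ac by (simp add: free_module_def)
  qed
  then show "graded_module G A F" using ds rm by (simp add: graded_module_def)
qed

sublocale F: graded_mod G A F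
  using free_module_graded by unfold_locales

definition single :: "'j \<Rightarrow> 'a \<Rightarrow> 'j \<Rightarrow> 'a" where
  "single j a = (\<lambda>i. if i = j then a else \<zero>\<^bsub>A\<^esub>)"

lemma single_one_deg: "j \<in> J \<Longrightarrow> single j \<one>\<^bsub>A\<^esub> \<in> mgr F (d j)"
proof -
  assume j: "j \<in> J"
  have "single j \<one>\<^bsub>A\<^esub> i \<in> agr A (inv\<^bsub>G\<^esub> (d i) \<otimes>\<^bsub>G\<^esub> d j)" if "i \<in> J" for i
    using j that d_closed one_deg Ag.C_zero by (auto simp: single_def)
  moreover have "finite {i. single j \<one>\<^bsub>A\<^esub> i \<noteq> \<zero>\<^bsub>A\<^esub>}"
    by (rule finite_subset[of _ "{j}"]) (auto simp: single_def)
  ultimately show ?thesis using j by (auto simp: free_module_def single_def)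
qed

text \<open>Induction on a finite set containing the support: one coordinate is split off as a
  multiple of a basis element, whose degree is in \<open>D\<close>.\<close>

lemma free_module_generated:
  assumes "d ` J \<subseteq> D"
  shows "generated_in A D F"
  unfolding generated_in_iff[OF A.ring_axioms F.right_module]
proof (intro allI impI subsetI)
  fix N f assume N: "submod A N F" "\<forall>t\<in>D. mgr F t \<subseteq> N" and "f \<in> carrier F"
  note NS = submodD[OF N(1)]
  have "f \<in> carrier F \<Longrightarrow> {j. f j \<noteq> \<zero>\<^bsub>A\<^esub>} \<subseteq> E \<Longrightarrow> f \<in> N" if "finite E" for E
    using that
  proof (induction E arbitrary: f)
    case empty
    then have "f = \<zero>\<^bsub>F\<^esub>" by (auto simp: F_simps)
    then show ?case using NS(2) by simp
  next
    case (insert j E)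
    show ?case
    proof (cases "j \<in> J")
      case True
      have f': "f(j := \<zero>\<^bsub>A\<^esub>) \<in> carrier F"
        by (rule F_supp[OF insert.prems(1) insert.prems(1)]) (auto simp: F_closed insert.prems)
      have "f(j := \<zero>\<^bsub>A\<^esub>) \<in> N" by (rule insert.IH[OF f']) (use insert.prems in auto)
      moreover have "single j \<one>\<^bsub>A\<^esub> \<cdot>\<^bsub>F\<^esub> f j \<in> N"
        using NS(4) N(2) single_one_deg[OF True] assms True F_closed[OF insert.prems(1)] by blast
      moreover have "f = f(j := \<zero>\<^bsub>A\<^esub>) \<oplus>\<^bsub>F\<^esub> single j \<one>\<^bsub>A\<^esub> \<cdot>\<^bsub>F\<^esub> f j"
        using F_closed[OF insert.prems(1)] by (auto simp: F_simps(3,4) single_def fun_eq_iff)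
      ultimately show ?thesis using NS(3) by metis
    next
      case False
      then show ?thesis using insert by (auto simp: F_simps)
    qed
  qed
  then show "f \<in> N" using \<open>f \<in> carrier F\<close> by (auto simp: F_simps)
qed

end

section \<open>Factorisation through quotients, and presentations\<close>

context graded_ring
begin

lemma alg_restrict_mult_hpart:
  assumes "a \<in> carrier A" "b \<in> carrier A" "u \<in> carrier G"
  shows "Ag.hp (a \<otimes>\<^bsub>restr U\<^esub> b) u = (if u \<in> U then Ag.hp (a \<otimes>\<^bsub>A\<^esub> b) u else \<zero>\<^bsub>A\<^esub>)"
proof -
  interpret R: graded_mod G A "regular_module A" using graded_regular_module by unfold_locales
  show ?thesis
    using R.sact_hpart[of a b u U] assms hpart_cong_record(1)[of "regular_module A" A "carrier G" "agr A"]
    by (simp add: alg_restrict_mult)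
qed

lemma ghom_factor:
  assumes "graded_module G A X" "graded_module G A Y" "graded_module G A V"
    and q: "ghom G A X Y q" "q ` carrier X = carrier Y" and e: "ghom G A X V e"
    and ker: "\<And>x. x \<in> carrier X \<Longrightarrow> q x = \<zero>\<^bsub>Y\<^esub> \<Longrightarrow> e x = \<zero>\<^bsub>V\<^esub>"
  obtains \<pi> where "ghom G A Y V \<pi>" "\<And>x. x \<in> carrier X \<Longrightarrow> \<pi> (q x) = e x"
proof -
  interpret X: graded_mod G A X by unfold_locales fact
  interpret Y: graded_mod G A Y by unfold_locales fact
  interpret V: graded_mod G A V by unfold_locales fact
  note qD = ghomD[OF q(1)] and eD = ghomD[OF e]
  have eq: "e x = e y" if "x \<in> carrier X" "y \<in> carrier X" "q x = q y" for x y
  proof -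
    have "q (x \<oplus>\<^bsub>X\<^esub> \<ominus>\<^bsub>X\<^esub> y) = \<zero>\<^bsub>Y\<^esub>"
      using that qD ghom_minus[OF assms(1,2) q(1)] by (simp add: Y.M.r_neg)
    then have "e x \<oplus>\<^bsub>V\<^esub> \<ominus>\<^bsub>V\<^esub> e y = \<zero>\<^bsub>V\<^esub>"
      using ker[of "x \<oplus>\<^bsub>X\<^esub> \<ominus>\<^bsub>X\<^esub> y"] that eD ghom_minus[OF assms(1,3) e] by simp
    then show ?thesis using that eD(1) by (metis V.M.minus_equality V.M.minus_minus V.M.a_inv_closed)
  qed
  define \<pi> where "\<pi> y = e (inv_into (carrier X) q y)" for y
  have \<pi>: "\<pi> (q x) = e x" if "x \<in> carrier X" for x
    unfolding \<pi>_def using that by (intro eq) (auto simp: inv_into_into f_inv_into_f)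
  have surj: "\<exists>x\<in>carrier X. y = q x" if "y \<in> carrier Y" for y using that q(2) by auto
  have "ghom G A Y V \<pi>"
  proof (rule ghomI)
    fix y assume y: "y \<in> carrier Y"
    then obtain x where x: "x \<in> carrier X" "y = q x" using surj by blast
    show "\<pi> y \<in> carrier V" using x \<pi> eD by simp
    show "\<pi> (y \<oplus>\<^bsub>Y\<^esub> z) = \<pi> y \<oplus>\<^bsub>V\<^esub> \<pi> z" if z: "z \<in> carrier Y" for z
    proof -
      obtain x' where x': "x' \<in> carrier X" "z = q x'" using surj[OF z] by blast
      show ?thesis using x x' \<pi>[of "x \<oplus>\<^bsub>X\<^esub> x'"] by (simp add: \<pi> qD eD)
    qed
    show "\<pi> (y \<cdot>\<^bsub>Y\<^esub> a) = \<pi> y \<cdot>\<^bsub>V\<^esub> a" if "a \<in> carrier A" for a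
      using x that \<pi>[of "x \<cdot>\<^bsub>X\<^esub> a"] by (simp add: \<pi> qD eD)
  next
    fix t y assume t: "t \<in> carrier G" and y: "y \<in> mgr Y t"
    obtain x where x: "x \<in> carrier X" "y = q x" using surj Y.Mg.C_closed[OF t y] by blast
    have "y = q (X.Mg.hp x t)"
      using ghom_hpart[OF assms(1,2) q(1) x(1) t] Y.Mg.hpart_hom[OF t y t] x by simp
    then show "\<pi> y \<in> mgr V t"
      using \<pi> X.Mg.hpart_closed[OF x(1) t] eD(4)[OF t X.Mg.hpart_in[OF x(1) t]] by simp
  qed
  then show thesis using that \<pi> by blast
qed

text \<open>
  Projectivity of \<open>Q\<close> lifts the cokernel map to \<open>V'\<close>, and the lift kills the relations because
  these are generated in degrees \<open>D\<close>, where \<open>\<pi>\<close> is injective.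
\<close>

lemma presented_isomorphic:
  fixes V V' :: "('a, 'm, 'g) gr_module"
  assumes pres: "presented_in G A D V" and D: "D \<subseteq> carrier G"
    and V': "graded_module G A V'" "generated_in A D V'" and \<pi>: "ghom G A V' V \<pi>"
    and surj: "\<And>t. t \<in> D \<Longrightarrow> mgr V t \<subseteq> \<pi> ` carrier V'"
    and inj: "\<And>t x. t \<in> D \<Longrightarrow> x \<in> mgr V' t \<Longrightarrow> \<pi> x = \<zero>\<^bsub>V\<^esub> \<Longrightarrow> x = \<zero>\<^bsub>V'\<^esub>"
  shows "isomorphic (Gr G A) V V'"
proof -
  obtain P Q :: "('a, 'm, 'g) gr_module" and f p where
    P: "graded_module G A P" "generated_in A D P" and Q: "gr_projective G A Q" "generated_in A D Q"
    and f: "f \<in> gr_hom G A P Q" and coker: "is_cokernel G A P Q f V p"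
    using pres by (auto simp: presented_in_def gr_projective_def)
  have V: "graded_module G A V" and p: "p \<in> gr_hom G A Q V"
    and pf: "\<And>x. x \<in> carrier P \<Longrightarrow> p (f x) = \<zero>\<^bsub>V\<^esub>"
    and univ: "\<And>W q. graded_module G A W \<Longrightarrow> q \<in> gr_hom G A Q W \<Longrightarrow>
      (\<And>x. x \<in> carrier P \<Longrightarrow> q (f x) = \<zero>\<^bsub>W\<^esub>) \<Longrightarrow>
      \<exists>!r. r \<in> gr_hom G A V W \<and> compose (carrier Q) r p = q"
    using coker unfolding is_cokernel_def by blast+
  have gQ: "graded_module G A Q" using Q(1) by (simp add: gr_projective_def)
  interpret P: graded_mod G A P using P(1) by unfold_locales
  interpret Q: graded_mod G A Q using gQ by unfold_locales
  interpret V: graded_mod G A V using V by unfold_locales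
  interpret V': graded_mod G A V' using V' by unfold_locales
  have pg: "ghom G A Q V p" and fg: "ghom G A P Q f" using p f by (simp_all add: gr_hom_iff)
  \<comment> \<open>The cokernel map factors through its own image by a morphism \<open>r\<close>.
    Followed by the inclusion, \<open>r\<close> solves the same factorisation problem as the
    identity of \<open>V\<close>, so uniqueness in the universal property shows that the image is
    everything.\<close>
  have p_surj: "p ` carrier Q = carrier V"
  proof -
    let ?V1 = "gr_sub V (p ` carrier Q)"
    have g1: "graded_submod G A (p ` carrier Q) V" by (rule ghom_image[OF gQ V pg])
    have incl: "ghom G A ?V1 V (\<lambda>x. x)"
      using g1 by (auto simp: ghom_def gr_sub_def graded_submod_def submod_def)
    have "p \<in> gr_hom G A Q ?V1"
      using p Q.Mg.C_closed by (auto simp: gr_hom_iff ghom_def gr_sub_def)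
    moreover have "p (f x) = \<zero>\<^bsub>?V1\<^esub>" if "x \<in> carrier P" for x
      using pf[OF that] by (simp add: gr_sub_def)
    ultimately obtain r where r: "r \<in> gr_hom G A V ?V1" "compose (carrier Q) r p = p"
      using univ[OF V.gr_sub_graded(1)[OF g1]] by blast
    have "r \<in> gr_hom G A V V"
      using r(1) ghom_comp[OF _ incl, of V r] by (simp add: gr_hom_iff)
    moreover have "(\<lambda>x\<in>carrier V. x) \<in> gr_hom G A V V"
      using V.Mg.C_closed by (auto simp: gr_hom_iff ghom_def)
    moreover have "compose (carrier Q) (\<lambda>x\<in>carrier V. x) p = p"
      using p ghomD(1)[OF pg] by (auto simp: compose_def gr_hom_iff extensional_def fun_eq_iff)
    ultimately have "r = (\<lambda>x\<in>carrier V. x)" using univ[OF V p pf] r(2) by blast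
    moreover have "r x \<in> p ` carrier Q" if "x \<in> carrier V" for x
      using that r(1) ghomD(1)[of G A V ?V1 r x] by (simp add: gr_hom_iff gr_sub_def)
    ultimately have "x \<in> p ` carrier Q" if "x \<in> carrier V" for x using that by simp
    then show ?thesis using ghomD(1)[OF pg] by blast
  qed
  have genV: "generated_in A D V" by (rule generated_in_ghom_image[OF gQ V pg p_surj Q(2) D])
  have \<pi>_surj: "\<pi> ` carrier V' = carrier V" by (rule surj_of_generated[OF V'(1) V \<pi> genV surj])
  have "restrict \<pi> (carrier V') \<in> gr_hom G A V' V" "restrict \<pi> (carrier V') ` carrier V' = carrier V"
    using ghomD[OF \<pi>] V'.Mg.C_closed \<pi>_surj by (auto simp: gr_hom_iff intro!: ghomI)
  then obtain f' where f': "f' \<in> gr_hom G A Q V'"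
    "compose (carrier Q) (restrict \<pi> (carrier V')) f' = p"
    using Q(1) V'(1) V p unfolding gr_projective_def by blast
  have f'g: "ghom G A Q V' f'" using f' by (simp add: gr_hom_iff)
  have \<pi>f': "\<pi> (f' x) = p x" if "x \<in> carrier Q" for x
    using fun_cong[OF f'(2), of x] that ghomD(1)[OF f'g] by (simp add: compose_def)
  have "f' (f x) = \<zero>\<^bsub>V'\<^esub>" if x: "x \<in> carrier P" for x
  proof (rule ghom_eq_of_generated[OF P(1) V'(1) ghom_comp[OF fg f'g] _ P(2) _ D x])
    show "ghom G A P V' (\<lambda>_. \<zero>\<^bsub>V'\<^esub>)"
      using V'.Mg.C_zero by (auto simp: ghom_def)
    show "f' (f y) = \<zero>\<^bsub>V'\<^esub>" if "t \<in> D" "y \<in> mgr P t" for t y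
    proof (rule inj[OF that(1)])
      have tG: "t \<in> carrier G" using that D by blast
      have yP: "y \<in> carrier P" using P.Mg.C_closed[OF tG that(2)] .
      show "f' (f y) \<in> mgr V' t" using ghomD(4)[OF f'g tG] ghomD(4)[OF fg tG] that(2) by blast
      show "\<pi> (f' (f y)) = \<zero>\<^bsub>V\<^esub>" using \<pi>f' pf yP ghomD(1)[OF fg] by simp
    qed
  qed
  from ex1_implies_ex[OF univ[OF V'(1) f'(1) this]]
  obtain r where r: "r \<in> gr_hom G A V V'" "compose (carrier Q) r p = f'" by blast
  have rg: "ghom G A V V' r" using r by (simp add: gr_hom_iff)
  have rp: "r (p x) = f' x" if "x \<in> carrier Q" for x
    using fun_cong[OF r(2), of x] that by (simp add: compose_def)
  have \<pi>r: "\<pi> (r y) = y" if "y \<in> carrier V" for y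
  proof -
    have "y \<in> p ` carrier Q" using p_surj that by simp
    then obtain x where "x \<in> carrier Q" "y = p x" by blast
    then show ?thesis by (simp add: rp \<pi>f')
  qed
  have r\<pi>: "r (\<pi> x) = x" if x: "x \<in> carrier V'" for x
  proof (rule ghom_eq_of_generated[OF V'(1) V'(1) ghom_comp[OF \<pi> rg] _ V'(2) _ D x])
    show "ghom G A V' V' (\<lambda>x. x)" by (auto simp: ghom_def)
    show "r (\<pi> y) = y" if "t \<in> D" "y \<in> mgr V' t" for t y
    proof -
      have tG: "t \<in> carrier G" using that D by blast
      have y: "y \<in> carrier V'" using V'.Mg.C_closed[OF tG that(2)] .
      have c: "\<pi> y \<in> carrier V" "r (\<pi> y) \<in> carrier V'" using ghomD(1)[OF \<pi> y] ghomD(1)[OF rg] by auto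
      \<comment> \<open>The difference is homogeneous of degree \<open>t\<close> and killed by
        \<pi>, which is injective in that degree.\<close>
      have "r (\<pi> y) \<oplus>\<^bsub>V'\<^esub> \<ominus>\<^bsub>V'\<^esub> y = \<zero>\<^bsub>V'\<^esub>"
      proof (rule inj[OF that(1)])
        show "r (\<pi> y) \<oplus>\<^bsub>V'\<^esub> \<ominus>\<^bsub>V'\<^esub> y \<in> mgr V' t"
          using V'.Mg.C_add[OF tG _ V'.Mg.C_minus[OF tG that(2)]] ghomD(4)[OF rg tG]
            ghomD(4)[OF \<pi> tG that(2)] by blast
        show "\<pi> (r (\<pi> y) \<oplus>\<^bsub>V'\<^esub> \<ominus>\<^bsub>V'\<^esub> y) = \<zero>\<^bsub>V\<^esub>"
          using c y by (simp add: ghomD(2)[OF \<pi>] ghom_minus[OF V'(1) V \<pi>] \<pi>r V.M.r_neg)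
      qed
      then show ?thesis using c y by (metis V'.M.minus_equality V'.M.minus_minus V'.M.a_inv_closed)
    qed
  qed
  show ?thesis
    by (rule isomorphic_GrI[OF rg \<pi> \<pi>r r\<pi> graded_ring_axioms V V'(1)])
qed

end

text \<open>
  The left adjoint of \<open>\<Phi>\<close> in disguise: take the free \<open>A\<close>-module on the homogeneous elements of
  \<open>V\<close> of degree in \<open>H'\<close> and divide out the relations that hold in \<open>V\<close> in these degrees.
\<close>

lemma (in pseudo_graded) cover_exists:
  fixes V :: "('a, 'm, 'h) gr_module"
  assumes V: "graded_module G' Bt V"
    and large: "infinite (UNIV :: 'm set)" "carrier A \<lesssim> (UNIV :: 'm set)"
  obtains M :: "('a, 'm, 'g) gr_module" and \<pi>
  where "graded_module G A M" "generated_in A T M" "ghom G' Bt (\<Phi> M) V \<pi>"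
    "\<And>\<sigma>. \<sigma> \<in> H' \<Longrightarrow> mgr V \<sigma> \<subseteq> \<pi> ` carrier (\<Phi> M)"
    "\<And>\<sigma> x. \<sigma> \<in> H' \<Longrightarrow> x \<in> mgr (\<Phi> M) \<sigma> \<Longrightarrow> \<pi> x = \<zero>\<^bsub>V\<^esub> \<Longrightarrow> x = \<zero>\<^bsub>\<Phi> M\<^esub>"
proof -
  interpret V: graded_mod G' Bt V using V by unfold_locales
  define J where "J = (\<Union>\<sigma>\<in>H'. mgr V \<sigma>)"
  have "\<forall>v\<in>J. \<exists>\<sigma>. \<sigma> \<in> H' \<and> v \<in> mgr V \<sigma>" by (auto simp: J_def)
  \<comment> \<open>Zero is homogeneous of every degree, so an element of \<open>J\<close> may have
    several degrees and one of them has to be chosen.\<close>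
  from bchoice[OF this] obtain \<tau> where \<tau>: "\<And>v. v \<in> J \<Longrightarrow> \<tau> v \<in> H' \<and> v \<in> mgr V (\<tau> v)"
    by blast
  define d where "d v = shift (\<tau> v)" for v
  have dT: "d v \<in> T" if "v \<in> J" for v using \<tau>[OF that] by (auto simp: T_shift d_def)
  have dG: "d v \<in> carrier G" if "v \<in> J" for v using subsetD[OF T_carrier dT[OF that]] .
  have JV: "v \<in> carrier V" if "v \<in> J" for v using \<tau>[OF that] V.Mg.C_closed[of "\<tau> v" v] by simp
  interpret free_setup G A J d by unfold_locales (rule dG)
  note gF = free_module_graded
  have Fg: "generated_in A T F" by (rule free_module_generated) (use dT in blast)
  \<comment> \<open>A part of degree \<open>u\<close> of the coefficient at \<open>v\<close> sits in
    degree \<open>d v\<close> times \<open>u\<close> of the free module. As \<open>d v\<close> is in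
    \<open>T\<close>, this lies in \<open>S\<close> exactly when \<open>u\<close> is in
    \<open>U\<close>.\<close>
  have part_B: "f v \<in> carrier B" if f: "f \<in> part F" for f v
  proof (cases "v \<in> J")
    case True
    have fF: "f \<in> carrier F" using f by (simp add: part_iff gF)
    have "Ag.hp (f v) u = \<zero>\<^bsub>A\<^esub>" if u: "u \<in> carrier G - U" for u
    proof -
      have du: "d v \<otimes>\<^bsub>G\<^esub> u \<in> carrier G - S" using transporterD(2)[OF dT[OF True]] u dG[OF True] by simp
      then have "hc F f (d v \<otimes>\<^bsub>G\<^esub> u) v = \<zero>\<^bsub>A\<^esub>" using f by (simp add: part_iff gF F_simps(2))
      then show ?thesis
        using free_module_hpart[OF fF _ True, of "d v \<otimes>\<^bsub>G\<^esub> u"] du u dG[OF True]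
        by (simp flip: G.m_assoc)
    qed
    then show ?thesis using F_closed[OF fF] by (simp add: alg_restrict_carrier Ag.part_iff)
  next
    case False
    then show ?thesis using f Ag.part_zero by (simp add: part_iff gF F_simps alg_restrict_carrier)
  qed
  \<comment> \<open>By the same bookkeeping, truncating the action to \<open>S\<close> amounts to
    multiplying each coordinate in \<open>B\<close>.\<close>
  have ract_F: "(f \<cdot>\<^bsub>MS F\<^esub> a) v = f v \<otimes>\<^bsub>B\<^esub> a" if f: "f \<in> carrier F" and a: "a \<in> carrier A" for f a v
  proof (cases "v \<in> J")
    case True
    have fa: "f \<cdot>\<^bsub>MS F\<^esub> a \<in> carrier F" using ract_closed[OF gF f a] by (simp add: part_iff gF)
    show ?thesis
    proof (rule Ag.hpart_inject)
      fix u assume u: "u \<in> carrier G"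
      have du: "d v \<otimes>\<^bsub>G\<^esub> u \<in> carrier G" and eq: "inv\<^bsub>G\<^esub> (d v) \<otimes>\<^bsub>G\<^esub> (d v \<otimes>\<^bsub>G\<^esub> u) = u"
        using u dG[OF True] by (simp_all flip: G.m_assoc)
      have "Ag.hp ((f \<cdot>\<^bsub>MS F\<^esub> a) v) u = hc F (f \<cdot>\<^bsub>MS F\<^esub> a) (d v \<otimes>\<^bsub>G\<^esub> u) v"
        using free_module_hpart[OF fa du True] by (simp add: eq)
      also have "\<dots> = (if u \<in> U then Ag.hp (f v \<otimes>\<^bsub>A\<^esub> a) u else \<zero>\<^bsub>A\<^esub>)"
        using ract_hpart[OF gF f a du] transporterD(2)[OF dT[OF True] u]
          free_module_hpart[OF F.act_closed[OF f a] du True]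
        by (simp add: eq F_simps(2,4))
      also have "\<dots> = Ag.hp (f v \<otimes>\<^bsub>B\<^esub> a) u"
        using alg_restrict_mult_hpart[OF F_closed[OF f] a u] by simp
      finally show "Ag.hp ((f \<cdot>\<^bsub>MS F\<^esub> a) v) u = Ag.hp (f v \<otimes>\<^bsub>B\<^esub> a) u" .
    qed (use F_closed[OF fa] F_closed[OF f] a alg_restrict_mult_closed in auto)
  next
    case False
    then show ?thesis using ract_closed[OF gF f a] f a
      by (simp add: part_iff gF F_simps alg_restrict_mult_zero)
  qed
  \<comment> \<open>Evaluation of formal combinations in \<open>V\<close>. It is meaningful on
    elements supported in \<open>S\<close>, whose coefficients lie in \<open>B\<close> by
    \<open>part_B\<close>; on all of the free module it is not, since only \<open>B\<close> acts on
    \<open>V\<close>.\<close>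
  define \<epsilon> where "\<epsilon> f = finsum V (\<lambda>v. v \<cdot>\<^bsub>V\<^esub> f v) {v. f v \<noteq> \<zero>\<^bsub>A\<^esub>}" for f
  have supp: "finite {v. f v \<noteq> \<zero>\<^bsub>A\<^esub>}" "{v. f v \<noteq> \<zero>\<^bsub>A\<^esub>} \<subseteq> J" if "f \<in> part F" for f
    using that by (auto simp: part_iff gF F_simps)
  have actB: "v \<cdot>\<^bsub>V\<^esub> f v \<in> carrier V" if "f \<in> part F" "v \<in> J" for f v
    using V.act_closed[OF JV[OF that(2)], of "f v"] part_B[OF that(1)] by (simp add: alg_tilde_simps)
  have zeroV: "v \<cdot>\<^bsub>V\<^esub> \<zero>\<^bsub>A\<^esub> = \<zero>\<^bsub>V\<^esub>" if "v \<in> J" for v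
    using V.act_zero_right[OF JV[OF that]] by (simp add: alg_tilde_simps alg_restrict_simps)
  have \<epsilon>_superset: "\<epsilon> f = finsum V (\<lambda>v. v \<cdot>\<^bsub>V\<^esub> f v) E"
    if "f \<in> part F" "finite E" "E \<subseteq> J" "{v. f v \<noteq> \<zero>\<^bsub>A\<^esub>} \<subseteq> E" for f E
    unfolding \<epsilon>_def using that actB[OF that(1)] zeroV
    by (intro V.M.add.finprod_mono_neutral_cong_left) (auto simp: subset_iff)
  have part_add: "f \<oplus>\<^bsub>F\<^esub> f' \<in> part F" if "f \<in> part F" "f' \<in> part F" for f f'
    using that by (simp add: part_iff gF F.Mg.hpart_add)
  have \<epsilon>_add: "\<epsilon> (f \<oplus>\<^bsub>F\<^esub> f') = \<epsilon> f \<oplus>\<^bsub>V\<^esub> \<epsilon> f'" if f: "f \<in> part F" "f' \<in> part F" for f f'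
  proof -
    let ?E = "{v. f v \<noteq> \<zero>\<^bsub>A\<^esub>} \<union> {v. f' v \<noteq> \<zero>\<^bsub>A\<^esub>}"
    have E: "finite ?E" "?E \<subseteq> J" using supp f by auto
    have c: "f v \<in> carrier B" "f' v \<in> carrier B" for v using part_B f by auto
    have "\<epsilon> (f \<oplus>\<^bsub>F\<^esub> f') = finsum V (\<lambda>v. v \<cdot>\<^bsub>V\<^esub> (f \<oplus>\<^bsub>F\<^esub> f') v) ?E"
      by (rule \<epsilon>_superset[OF part_add[OF f] E]) (auto simp: F_simps(3))
    also have "\<dots> = finsum V (\<lambda>v. v \<cdot>\<^bsub>V\<^esub> f v \<oplus>\<^bsub>V\<^esub> v \<cdot>\<^bsub>V\<^esub> f' v) ?E"
    proof (rule V.M.add.finprod_cong')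
      fix v assume "v \<in> ?E"
      then have v: "v \<in> carrier V" using E JV by blast
      show "v \<cdot>\<^bsub>V\<^esub> (f \<oplus>\<^bsub>F\<^esub> f') v = v \<cdot>\<^bsub>V\<^esub> f v \<oplus>\<^bsub>V\<^esub> v \<cdot>\<^bsub>V\<^esub> f' v"
        using V.act_add_right[OF v, of "f v" "f' v"] c
        by (simp add: F_simps(3) alg_tilde_simps alg_restrict_simps)
    qed (use E actB f in \<open>auto simp: subset_iff\<close>)
    also have "\<dots> = finsum V (\<lambda>v. v \<cdot>\<^bsub>V\<^esub> f v) ?E \<oplus>\<^bsub>V\<^esub> finsum V (\<lambda>v. v \<cdot>\<^bsub>V\<^esub> f' v) ?E"
      using E actB f by (intro V.M.finsum_addf) (auto simp: subset_iff)
    also have "\<dots> = \<epsilon> f \<oplus>\<^bsub>V\<^esub> \<epsilon> f'"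
      using \<epsilon>_superset[OF f(1) E] \<epsilon>_superset[OF f(2) E] by simp
    finally show ?thesis .
  qed
  have \<epsilon>_act: "\<epsilon> (f \<cdot>\<^bsub>MS F\<^esub> a) = \<epsilon> f \<cdot>\<^bsub>V\<^esub> a" if f: "f \<in> part F" and a: "a \<in> carrier B" for f a
  proof -
    let ?E = "{v. f v \<noteq> \<zero>\<^bsub>A\<^esub>}"
    note E = supp[OF f]
    have aA: "a \<in> carrier A" using B_carrier[OF a] .
    have fF: "f \<in> carrier F" using f by (simp add: part_iff gF)
    note fa = ract_closed[OF gF fF aA] and r = ract_F[OF fF aA]
    have "\<epsilon> (f \<cdot>\<^bsub>MS F\<^esub> a) = finsum V (\<lambda>v. v \<cdot>\<^bsub>V\<^esub> (f \<cdot>\<^bsub>MS F\<^esub> a) v) ?E"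
      by (rule \<epsilon>_superset[OF fa E]) (auto simp: r aA alg_restrict_mult_zero)
    also have "\<dots> = finsum V (\<lambda>v. v \<cdot>\<^bsub>V\<^esub> f v \<cdot>\<^bsub>V\<^esub> a) ?E"
    proof (rule V.M.add.finprod_cong')
      fix v assume "v \<in> ?E"
      then have v: "v \<in> carrier V" using E JV by blast
      show "v \<cdot>\<^bsub>V\<^esub> (f \<cdot>\<^bsub>MS F\<^esub> a) v = v \<cdot>\<^bsub>V\<^esub> f v \<cdot>\<^bsub>V\<^esub> a"
        using V.act_mult[OF v, of "f v" a] part_B[OF f] a by (simp add: r alg_tilde_simps)
    qed (use E actB[OF f] V.act_closed a in \<open>auto simp: subset_iff alg_tilde_simps\<close>)
    also have "\<dots> = \<epsilon> f \<cdot>\<^bsub>V\<^esub> a"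
      unfolding \<epsilon>_def using V.finsum_act[of ?E "\<lambda>v. v \<cdot>\<^bsub>V\<^esub> f v" a] E actB[OF f] a
      by (auto simp: alg_tilde_simps subset_iff)
    finally show ?thesis .
  qed
  \<comment> \<open>The degree of the coefficient at \<open>v\<close> lies in \<open>U\<close> and
    thus is \<open>\<phi> \<rho>\<close>. The product of \<open>\<phi> (\<tau> v)\<close> and
    \<open>\<phi> \<rho>\<close> is \<open>\<phi> \<sigma>\<close>, again in \<open>U\<close>, so
    \<phi> is multiplicative here and the degrees match in \<open>G'\<close>.\<close>
  have \<epsilon>_deg: "\<epsilon> f \<in> mgr V \<sigma>" if \<sigma>: "\<sigma> \<in> carrier G'" and f: "f \<in> mgr F (shift \<sigma>)" for f \<sigma>
    unfolding \<epsilon>_def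
  proof (rule V.Mg.C_finsum[OF \<sigma>])
    fix v assume "v \<in> {v. f v \<noteq> \<zero>\<^bsub>A\<^esub>}"
    then have v: "v \<in> J" and fv: "f v \<in> agr A (inv\<^bsub>G\<^esub> (d v) \<otimes>\<^bsub>G\<^esub> shift \<sigma>)"
      using f by (auto simp: free_module_def)
    let ?u = "inv\<^bsub>G\<^esub> (d v) \<otimes>\<^bsub>G\<^esub> shift \<sigma>"
    have u: "?u \<in> carrier G" and du: "d v \<otimes>\<^bsub>G\<^esub> ?u = shift \<sigma>"
      using dG[OF v] shift_closed[OF \<sigma>] by (simp_all flip: G.m_assoc)
    then have uU: "?u \<in> U" using transporterD(2)[OF dT[OF v] u] shift_S[OF \<sigma>] by simp
    then obtain \<rho> where \<rho>: "\<rho> \<in> carrier G'" "?u = \<phi> \<rho>" by (auto simp: U_image)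
    have \<tau>v: "\<tau> v \<in> carrier G'" "v \<in> mgr V (\<tau> v)" using \<tau>[OF v] by auto
    have "g \<otimes>\<^bsub>G\<^esub> (\<phi> (\<tau> v) \<otimes>\<^bsub>G\<^esub> \<phi> \<rho>) = g \<otimes>\<^bsub>G\<^esub> \<phi> \<sigma>"
      using du \<rho> \<tau>v(1) \<sigma> phi_closed g_carrier by (simp add: d_def shift_def G.m_assoc)
    then have eq: "\<phi> (\<tau> v) \<otimes>\<^bsub>G\<^esub> \<phi> \<rho> = \<phi> \<sigma>" using \<rho>(1) \<tau>v(1) \<sigma> phi_closed g_carrier by simp
    then have "\<tau> v \<otimes>\<^bsub>G'\<^esub> \<rho> = \<sigma>"
      using phi_mult[OF \<tau>v(1) \<rho>(1)] phi_U[OF \<sigma>] phi_inj \<tau>v(1) \<rho>(1) \<sigma> by simp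
    moreover have "f v \<in> agr Bt \<rho>" using fv uU \<rho>(2) by (simp add: alg_tilde_simps alg_restrict_simps)
    ultimately show "v \<cdot>\<^bsub>V\<^esub> f v \<in> mgr V \<sigma>" using V.act_deg[OF \<tau>v(1) \<rho>(1) \<tau>v(2)] by simp
  qed
  have \<epsilon>_hom: "ghom G' Bt (\<Phi> F) V \<epsilon>"
  proof (rule ghomI)
    show "\<epsilon> f \<in> carrier V" if "f \<in> carrier (\<Phi> F)" for f
      unfolding \<epsilon>_def using that supp(2)[of f] actB[of f]
      by (intro V.M.finsum_closed) (auto simp: Phi_simps subset_iff)
  qed (use \<epsilon>_add \<epsilon>_act \<epsilon>_deg in \<open>simp_all add: Phi_simps alg_tilde_simps\<close>)
  note gPF = Phi_graded[OF gF]
  have \<epsilon>_zero: "\<epsilon> \<zero>\<^bsub>F\<^esub> = \<zero>\<^bsub>V\<^esub>" using Bt.ghom_zero[OF gPF V \<epsilon>_hom] by (simp add: Phi_simps)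
  \<comment> \<open>Imposing all relations valid in degrees of \<open>T\<close> makes the induced
    map \<pi> injective in the degrees of \<open>H'\<close>.\<close>
  define R where "R = (\<Union>t\<in>T. {f \<in> mgr F t. \<epsilon> f = \<zero>\<^bsub>V\<^esub>})"
  have R_hom: "\<exists>t\<in>carrier G. f \<in> mgr F t" if "f \<in> R" for f
    using that T_carrier by (auto simp: R_def)
  then have RF: "R \<subseteq> carrier F" using F.Mg.C_closed by blast
  define W where "W = F.span R"
  have gW: "graded_submod G A W F" unfolding W_def by (rule F.span_graded[OF R_hom])
  \<comment> \<open>The relations are closed up under \<open>A\<close>, although \<epsilon> respects
    only \<open>B\<close>. A multiple of a relation reaches \<open>S\<close> only through
    coefficients with degree in \<open>U\<close>, so \<epsilon> kills its components there.\<close>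
  have \<epsilon>_W: "\<forall>s\<in>S. \<epsilon> (hc F f s) = \<zero>\<^bsub>V\<^esub>" if "f \<in> W" for f
    using that unfolding W_def
  proof induction
    case zero
    show ?case using \<epsilon>_zero S_carrier F.Mg.hpart_zero by auto
  next
    case (step y f k a)
    then obtain t where t: "t \<in> T" "f \<in> mgr F t" "\<epsilon> f = \<zero>\<^bsub>V\<^esub>" by (auto simp: R_def)
    have tG: "t \<in> carrier G" and tS: "t \<in> S" using t T_carrier T_S by auto
    have yF: "y \<in> carrier F" using step(1) F.span_closed[OF RF] by auto
    have aA: "a \<in> carrier A" using Ag.C_closed step(3,4) by blast
    have fF: "f \<in> carrier F" using F.Mg.C_closed[OF tG t(2)] .
    show ?case
    proof
      fix s assume s: "s \<in> S"
      then have sG: "s \<in> carrier G" using S_carrier by blast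
      have "\<epsilon> (hc F (f \<cdot>\<^bsub>F\<^esub> a) s) = \<zero>\<^bsub>V\<^esub>"
      proof (cases "s = t \<otimes>\<^bsub>G\<^esub> k")
        case True
        then have k: "k \<in> U" using transporterD(2)[OF t(1) step(3)] s by simp
        have "hc F (f \<cdot>\<^bsub>F\<^esub> a) s = f \<cdot>\<^bsub>MS F\<^esub> a"
          using F.Mg.hpart_hom[OF _ F.act_deg[OF tG step(3) t(2) step(4)] sG] True k sG
            ract_hom[OF gF t(1) step(3) t(2) step(4)] by simp
        moreover have "a \<in> carrier Bt" using B_hom[OF k step(4)] by (simp add: alg_tilde_simps)
        ultimately show ?thesis
          using \<epsilon>_act[OF part_hom[OF gF tS t(2)] B_hom[OF k step(4)]] V.act_zero_left t(3) by simp
      next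
        case False
        then show ?thesis
          using F.Mg.hpart_hom[OF _ F.act_deg[OF tG step(3) t(2) step(4)] sG] tG step(3) \<epsilon>_zero by simp
      qed
      moreover have "hc F y s \<in> part F" "hc F (f \<cdot>\<^bsub>F\<^esub> a) s \<in> part F"
        using part_hom[OF gF s] F.Mg.hpart_in[OF _ sG] yF F.act_closed[OF fF aA] by blast+
      ultimately show "\<epsilon> (hc F (y \<oplus>\<^bsub>F\<^esub> f \<cdot>\<^bsub>F\<^esub> a) s) = \<zero>\<^bsub>V\<^esub>"
        using step.IH s by (simp add: F.Mg.hpart_add[OF yF F.act_closed[OF fF aA] sG] \<epsilon>_add)
    qed
  qed
  have "carrier F \<lesssim> (UNIV :: 'm set)"
    by (rule free_module_lepoll[OF large(1) subset_imp_lepoll[OF subset_UNIV] large(2)])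
  then obtain M :: "('a, 'm, 'g) gr_module" and q where M: "graded_module G A M" "ghom G A F M q"
    "q ` carrier F = carrier M" "\<And>x. x \<in> carrier F \<Longrightarrow> q x = \<zero>\<^bsub>M\<^esub> \<longleftrightarrow> x \<in> W"
    by (rule F.quotient_exists[OF gW]) (rule that)
  interpret M: graded_mod G A M using M(1) by unfold_locales
  note gPM = Phi_graded[OF M(1)] and Pq = ghom_Phi[OF gF M(1,2)]
  have q_surj: "q ` carrier (\<Phi> F) = carrier (\<Phi> M)"
  proof (rule Phi_surj[OF gF M(1,2)])
    show "mgr M s \<subseteq> q ` carrier F" if "s \<in> S" for s
      using that S_carrier M.Mg.C_closed M(3) by auto
  qed
  \<comment> \<open>An element of \<open>W\<close> that is supported in \<open>S\<close> is
    evaluated to zero in every degree of \<open>G'\<close>, because \<open>shift\<close> takes these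
    degrees into \<open>S\<close>.\<close>
  have ker: "\<epsilon> f = \<zero>\<^bsub>V\<^esub>" if "f \<in> carrier (\<Phi> F)" "q f = \<zero>\<^bsub>\<Phi> M\<^esub>" for f
  proof (rule V.Mg.hpart_inject)
    have f: "f \<in> part F" "f \<in> carrier F" using that by (simp_all add: Phi_simps part_iff gF)
    have fW: "f \<in> W" using M(4)[OF f(2)] that(2) by (simp add: Phi_simps)
    show "\<epsilon> f \<in> carrier V" using ghomD(1)[OF \<epsilon>_hom that(1)] .
    fix \<sigma> assume \<sigma>: "\<sigma> \<in> carrier G'"
    show "V.Mg.hp (\<epsilon> f) \<sigma> = V.Mg.hp \<zero>\<^bsub>V\<^esub> \<sigma>"
      using Bt.ghom_hpart[OF gPF V \<epsilon>_hom that(1) \<sigma>] Phi_hpart[OF gF f(1) \<sigma>] \<epsilon>_W[OF fW] shift_S[OF \<sigma>]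
      by (simp add: V.Mg.hpart_zero[OF \<sigma>])
  qed simp
  obtain \<pi> where \<pi>: "ghom G' Bt (\<Phi> M) V \<pi>" "\<And>f. f \<in> carrier (\<Phi> F) \<Longrightarrow> \<pi> (q f) = \<epsilon> f"
    by (rule Bt.ghom_factor[OF gPF gPM V Pq q_surj \<epsilon>_hom ker]) (assumption | rule that)+
  show thesis
  proof (rule that[OF M(1) _ \<pi>(1)])
    show "generated_in A T M" by (rule generated_in_ghom_image[OF gF M(1-3) Fg T_carrier])
    show "mgr V \<sigma> \<subseteq> \<pi> ` carrier (\<Phi> M)" if "\<sigma> \<in> H'" for \<sigma>
    proof
      fix v assume "v \<in> mgr V \<sigma>"
      then have v: "v \<in> J" using that by (auto simp: J_def)
      let ?e = "single v \<one>\<^bsub>A\<^esub>"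
      have e: "?e \<in> part F" using part_hom[OF gF _ single_one_deg[OF v]] dT[OF v] T_S by blast
      have "\<epsilon> ?e = finsum V (\<lambda>w. w \<cdot>\<^bsub>V\<^esub> ?e w) {v}"
        by (rule \<epsilon>_superset[OF e]) (use v in \<open>auto simp: single_def\<close>)
      also have "\<dots> = v"
        using V.act_one[OF JV[OF v]] JV[OF v]
        by (simp add: single_def alg_tilde_simps alg_restrict_simps V.M.finsum_insert[of "{}", simplified])
      finally have "\<pi> (q ?e) = v" using \<pi>(2) e by (simp add: Phi_simps)
      then show "v \<in> \<pi> ` carrier (\<Phi> M)" using ghomD(1)[OF Pq] e by (force simp: Phi_simps)
    qed
    fix \<sigma> x assume \<sigma>: "\<sigma> \<in> H'" and x: "x \<in> mgr (\<Phi> M) \<sigma>" "\<pi> x = \<zero>\<^bsub>V\<^esub>"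
    have \<sigma>G: "\<sigma> \<in> carrier G'" using \<sigma> by simp
    let ?t = "shift \<sigma>"
    have t: "?t \<in> T" "?t \<in> carrier G" "?t \<in> S"
      using \<sigma> T_shift shift_closed shift_S by auto
    have xt: "x \<in> mgr M ?t" using x(1) by (simp add: Phi_simps \<sigma>G)
    have "x \<in> q ` carrier F" using M(3) M.Mg.C_closed[OF t(2) xt] by simp
    then obtain f0 where f0: "f0 \<in> carrier F" "x = q f0" by blast
    define f where "f = hc F f0 ?t"
    have f: "f \<in> mgr F ?t" using F.Mg.hpart_in[OF f0(1) t(2)] by (simp add: f_def)
    have fp: "f \<in> part F" using part_hom[OF gF t(3) f] .
    have qf: "q f = x"
      using ghom_hpart[OF gF M(1,2) f0(1) t(2)] M.Mg.hpart_hom[OF t(2) xt t(2)] f0(2) by (simp add: f_def)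
    then have "\<epsilon> f = \<zero>\<^bsub>V\<^esub>" using \<pi>(2)[of f] fp x(2) by (simp add: Phi_simps)
    then have "f \<in> R" using f t(1) by (auto simp: R_def)
    then have "f \<in> W" using F.span_base[OF RF] by (auto simp: W_def)
    then show "x = \<zero>\<^bsub>\<Phi> M\<^esub>" using M(4)[OF F.Mg.C_closed[OF t(2) f]] qf by (simp add: Phi_simps)
  qed
qed

text \<open>The cover is bijective in degrees of \<open>H'\<close> and its source is generated
  there, so the presentation turns it into an isomorphism. The module \<open>M\<close> behind the
  cover then witnesses membership through \<open>M_S\<close>.\<close>

lemma (in pseudo_graded) presented_in_cat_L_tilde:
  fixes V :: "('a, 'm, 'h) gr_module"
  assumes "presented_in G' Bt H' V" and V: "graded_module G' Bt V"
    and "infinite (UNIV :: 'm set)" "carrier A \<lesssim> (UNIV :: 'm set)"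
  shows "V \<in> Ob (cat_L_tilde G' G A \<phi> g S U)"
proof -
  obtain M :: "('a, 'm, 'g) gr_module" and \<pi> where M: "graded_module G A M" "generated_in A T M"
    and \<pi>: "ghom G' Bt (\<Phi> M) V \<pi>" "\<And>\<sigma>. \<sigma> \<in> H' \<Longrightarrow> mgr V \<sigma> \<subseteq> \<pi> ` carrier (\<Phi> M)"
    "\<And>\<sigma> x. \<sigma> \<in> H' \<Longrightarrow> x \<in> mgr (\<Phi> M) \<sigma> \<Longrightarrow> \<pi> x = \<zero>\<^bsub>V\<^esub> \<Longrightarrow> x = \<zero>\<^bsub>\<Phi> M\<^esub>"
    by (rule cover_exists[OF V assms(3,4)]) (rule that)
  have "isomorphic (Gr G' Bt) V (\<Phi> M)"
    by (rule Bt.presented_isomorphic[OF assms(1) H'_carrier Phi_graded[OF M(1)] Phi_in_L(2)[OF M] \<pi>])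
  moreover have "MS M \<in> Ob (cat_L G A S U)"
    using MS_graded[OF M(1)] MS_generated[OF M] M(1) Bs.isomorphic_Gr_refl[OF MS_graded[OF M(1)]]
    by (auto simp: cat_L_def full_subcat_def Gr_def)
  ultimately show ?thesis
    using V unfolding Phi_ob_def by (auto simp: cat_L_tilde_def full_subcat_def Let_def Gr_def)
qed

theorem proposition3p2:
  fixes G' :: "'h monoid" and G :: "'g monoid" and \<phi> :: "'h \<Rightarrow> 'g"
    and K :: "'k ring" and A B :: "('k, 'a, 'g) gr_algebra"
    and Bt :: "('k, 'a, 'h) gr_algebra"
    and S U :: "'g set" and H' :: "'h set" and g :: 'g
  assumes "group G'" and "group G"
    and "pseudomorphism G' G \<phi>"
    and "U = \<phi> ` carrier G'"
    and "ring_supporting G U"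
    and "cring K" and "graded_algebra K G A"
    and "B = alg_restrict G U A"
    and "Bt = alg_tilde \<phi> B"
    and "right_modular G S U"
    and "g \<in> transporter G S U"
    and "H' = {\<sigma> \<in> carrier G'. \<phi> \<sigma> \<in> transporter G U U}"
    \<comment> \<open>the universe \<open>'m\<close> in which all modules live is large enough\<close>
    and "infinite (UNIV :: 'm set)" and "carrier A \<lesssim> (UNIV :: 'm set)"
  shows "subgroup H' G' \<and>
    is_equivalence
      (cat_G G A S U :: (('a, 'm, 'g) gr_module, 'm \<Rightarrow> 'm) cat)
      (cat_L_tilde G' G A \<phi> g S U :: (('a, 'm, 'h) gr_module, 'm \<Rightarrow> 'm) cat)
      (Phi_ob G A \<phi> g S) (Phi_mor G A S) \<and>
    (\<forall>V :: ('a, 'm, 'h) gr_module.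
      V \<in> Ob (cat_L_tilde G' G A \<phi> g S U) \<longrightarrow> generated_in Bt H' V) \<and>
    (\<forall>V :: ('a, 'm, 'h) gr_module.
      V \<in> Ob (Gr G' Bt) \<and> presented_in G' Bt H' V \<longrightarrow> V \<in> Ob (cat_L_tilde G' G A \<phi> g S U))"
proof -
  interpret graded_ring G A using assms(7) by (rule graded_ring_of_algebra)
  interpret pseudo_graded G A G' \<phi> U S g
    using assms(1,3-5,10,11) by (intro pseudo_graded.intro pseudo_graded_axioms.intro graded_ring_axioms)
  show ?thesis
    unfolding assms(8,9,12)
    using H'_subgroup Phi_equivalence cat_L_tilde_generated presented_in_cat_L_tilde assms(13,14)
    by (auto simp: Gr_def)
qed

end
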